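(* Let $W$ be a graphon such that $W$ and $x\mapsto W(x,x)$ are Riemann integrable and $\int_{[0,1]^2}W(x,y)\,dx\,dy>0$. Let $\theta_N\in(0,1)$ satisfy $N^{2/3}\theta_N\gtrsim1$ and $\theta_N\to0$. Let $\beta_0\in(0,1/\|W\|_{\mathrm{op}})$, $\alpha\in(0,1)$ and $t\in\mathbb R$ be fixed. Define $$\hat c_\alpha:=-z_{\alpha/2}\sqrt{\frac{1}{2N^2\theta_N^2}\sum_{1\le i,j\le N}A_{G_N}(i,j)}-\frac{\beta_0}{2N^2\theta_N^2}\sum_{1\le i,j\le N}A_{G_N}(i,j),$$ $$\hat d_\alpha:=z_{\alpha/2}\sqrt{\frac{1}{2N^2\theta_N^2}\sum_{1\le i,j\le N}A_{G_N}(i,j)}-\frac{\beta_0}{2N^2\theta_N^2}\sum_{1\le i,j\le N}A_{G_N}(i,j),$$ and $\rho_N(\beta):=\mathbb P_\beta(H_N(\vec\sigma)<\hat c_\alpha)+\mathbb P_\beta(H_N(\vec\sigma)>\hat d_\alpha)$, the power function of the test rejecting $H_0:\beta=\beta_0$ when $H_N(\vec\sigma)<\hat c_\alpha$ or $H_N(\vec\sigma)>\hat d_\alpha$. Then, for the alternatives $H_{1,N}:\beta=\beta_0+t\sqrt{\theta_N}$, $$\lim_{N\to\infty}\rho_N(\beta_0+t\sqrt{\theta_N})=\Phi\left(-z_{\alpha/2}-t\sqrt{\tfrac12\int_{[0,1]^2}W(x,y)\,dx\,dy}\right)+\Phi\left(-z_{\alpha/2}+t\sqrt{\tfrac12\i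nt_{[0,1]^2}W(x,y)\,dx\,dy}\right).$$
   Context: A graphon is a symmetric measurable function $W:[0,1]^2\to[0,1]$; $\|W\|_{\mathrm{op}}$ is the operator norm of $T_W:L^2[0,1]\to L^2[0,1]$, $(T_Wf)(x)=\int_0^1W(x,y)f(y)\,dy$. $G_N\sim G(N,\theta_N,W)$ is the random graph (self-loops allowed) on $\{1,\dots,N\}$ with symmetric adjacency matrix $A_{G_N}$ whose entries $A_{G_N}(i,j)$, $1\le i\le j\le N$, are independent Bernoulli with parameters $\theta_NW(\frac iN,\frac jN)$. For $\vec\sigma\in\{-1,1\}^N$, $H_N(\vec\sigma)=-\frac{1}{2N\theta_N}\sum_{1\le i,j\le N}A_{G_N}(i,j)\sigma_i\sigma_j$. Given $G_N$, the Ising model has $\vec\sigma$ with mass function $\frac{1}{2^NZ_N(\beta)}e^{-\beta H_N(\vec\sigma)}$, $Z_N(\beta)=2^{-N}\sum_{\vec\sigma\in\{-1,1\}^N}e^{-\beta H_N(\vec\sigma)}$. The probabilities $\mathbb P_\beta(\cdot)$ in the definition of $\rho_N$ are over the joint randomness of $G_N$ and $\vec\sigma$. $\Phi$ is the standard normal distribution function and $z_a$ is the $(1-a)$-th quantile of $\mathcal N(0,1)$. $a_N\gtrsim b_N$ means $a_N\ge Cb_N$ for some constant $C>0$ and all large $N$. *)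

theory Defs
  imports "HOL-Probability.Probability"
begin

section \<open>Graphons\<close>

text \<open>Functions on the unit interval or square are represented by total functions, of which
  only the values on the interval or square matter. Measurability is Lebesgue measurability.\<close>

definition graphon :: "(real \<Rightarrow> real \<Rightarrow> real) \<Rightarrow> bool" where
  "graphon W \<longleftrightarrow>
     (\<lambda>(x, y). W x y) \<in> borel_measurable (lebesgue_on ({0..1} \<times> {0..1})) \<and>
     (\<forall>x\<in>{0..1}. \<forall>y\<in>{0..1}. W x y = W y x \<and> W x y \<in> {0..1})"

text \<open>Convergence of Riemann sums as the mesh tends to 0. In contrast to the Henstock--Kurzweil
  integral of the library, the mesh bound \<open>d\<close> may not depend on the tag.\<close>

definition riemann_integrable_on :: "('a::euclidean_space \<Rightarrow> real) \<Rightarrow> 'a set \<Rightarrow> bool"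
    (infixr "riemann'_integrable'_on" 46) where
  "f riemann_integrable_on S \<longleftrightarrow>
     (\<exists>I. \<forall>e>0. \<exists>d>0. \<forall>p. p tagged_division_of S \<and> (\<forall>(x, K)\<in>p. diameter K < d) \<longrightarrow>
        \<bar>(\<Sum>(x, K)\<in>p. measure lborel K * f x) - I\<bar> < e)"

definition graphon_integral :: "(real \<Rightarrow> real \<Rightarrow> real) \<Rightarrow> real" where
  "graphon_integral W = (LINT p|lebesgue_on ({0..1} \<times> {0..1}). W (fst p) (snd p))"

definition L2 :: "(real \<Rightarrow> real) set" where
  "L2 = {f \<in> borel_measurable (lebesgue_on {0..1}). integrable (lebesgue_on {0..1}) (\<lambda>x. (f x)\<^sup>2)}"

definition L2_norm :: "(real \<Rightarrow> real) \<Rightarrow> real" where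
  "L2_norm f = sqrt (LINT x|lebesgue_on {0..1}. (f x)\<^sup>2)"

definition graphon_operator :: "(real \<Rightarrow> real \<Rightarrow> real) \<Rightarrow> (real \<Rightarrow> real) \<Rightarrow> (real \<Rightarrow> real)" where
  "graphon_operator W f = (\<lambda>x. LINT y|lebesgue_on {0..1}. W x y * f y)"

definition op_norm :: "(real \<Rightarrow> real \<Rightarrow> real) \<Rightarrow> real" where
  "op_norm W = (SUP f\<in>{f \<in> L2. L2_norm f \<le> 1}. L2_norm (graphon_operator W f))"


section \<open>The random graph\<close>

text \<open>The entries on and above the diagonal are sampled independently, indexed by the pairs
  \<open>(i, j)\<close> with \<open>1 \<le> i \<le> j \<le> N\<close>, and then reflected. All entries with an index outside
  \<open>{1..N}\<close> are 0.\<close>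

definition random_graph_pmf ::
    "(real \<Rightarrow> real \<Rightarrow> real) \<Rightarrow> real \<Rightarrow> nat \<Rightarrow> (nat \<Rightarrow> nat \<Rightarrow> real) pmf" where
  "random_graph_pmf W \<theta> N =
     map_pmf (\<lambda>g i j. of_bool (g (min i j, max i j)))
       (Pi_pmf {(i, j). 1 \<le> i \<and> i \<le> j \<and> j \<le> N} False
         (\<lambda>(i, j). bernoulli_pmf (\<theta> * W (real i / real N) (real j / real N))))"


section \<open>The Ising model\<close>

definition spins :: "nat \<Rightarrow> (nat \<Rightarrow> real) set" where
  "spins N = {1..N} \<rightarrow>\<^sub>E {-1, 1}"

definition hamiltonian :: "nat \<Rightarrow> real \<Rightarrow> (nat \<Rightarrow> nat \<Rightarrow> real) \<Rightarrow> (nat \<Rightarrow> real) \<Rightarrow> real" where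
  "hamiltonian N \<theta> A \<sigma> = - (1 / (2 * real N * \<theta>)) * (\<Sum>i=1..N. \<Sum>j=1..N. A i j * \<sigma> i * \<sigma> j)"

definition partition_function :: "nat \<Rightarrow> real \<Rightarrow> (nat \<Rightarrow> nat \<Rightarrow> real) \<Rightarrow> real \<Rightarrow> real" where
  "partition_function N \<theta> A \<beta> = (1 / 2 ^ N) * (\<Sum>\<sigma>\<in>spins N. exp (- \<beta> * hamiltonian N \<theta> A \<sigma>))"

definition ising_mass ::
    "nat \<Rightarrow> real \<Rightarrow> (nat \<Rightarrow> nat \<Rightarrow> real) \<Rightarrow> real \<Rightarrow> (nat \<Rightarrow> real) \<Rightarrow> real" where
  "ising_mass N \<theta> A \<beta> \<sigma> =
     (if \<sigma> \<in> spins N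
      then 1 / (2 ^ N * partition_function N \<theta> A \<beta>) * exp (- \<beta> * hamiltonian N \<theta> A \<sigma>) else 0)"

definition ising_pmf ::
    "nat \<Rightarrow> real \<Rightarrow> (nat \<Rightarrow> nat \<Rightarrow> real) \<Rightarrow> real \<Rightarrow> (nat \<Rightarrow> real) pmf" where
  "ising_pmf N \<theta> A \<beta> = embed_pmf (ising_mass N \<theta> A \<beta>)"

lemma finite_spins: "finite (spins N)"
  by (simp add: spins_def finite_PiE)

lemma spins_nonempty: "spins N \<noteq> {}"
  by (simp add: spins_def PiE_eq_empty_iff)

text \<open>The argument of \<^const>\<open>embed_pmf\<close> above is indeed a probability mass function.\<close>

lemma pmf_ising_pmf: "pmf (ising_pmf N \<theta> A \<beta>) \<sigma> = ising_mass N \<theta> A \<beta> \<sigma>"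
proof -
  let ?S = "\<Sum>\<sigma>\<in>spins N. exp (- \<beta> * hamiltonian N \<theta> A \<sigma>)"
  have S: "?S > 0"
    by (intro sum_pos finite_spins spins_nonempty) simp
  have Z: "2 ^ N * partition_function N \<theta> A \<beta> = ?S"
    by (simp add: partition_function_def)
  have nonneg: "0 \<le> ising_mass N \<theta> A \<beta> \<sigma>" for \<sigma>
    unfolding ising_mass_def Z using S by simp
  have total: "(\<Sum>\<sigma>\<in>spins N. ising_mass N \<theta> A \<beta> \<sigma>) = 1"
  proof -
    have "(\<Sum>\<sigma>\<in>spins N. ising_mass N \<theta> A \<beta> \<sigma>)
        = (\<Sum>\<sigma>\<in>spins N. 1 / ?S * exp (- \<beta> * hamiltonian N \<theta> A \<sigma>))"
      by (rule sum.cong) (simp_all only: ising_mass_def Z if_True)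
    also have "\<dots> = 1 / ?S * ?S"
      by (simp only: sum_distrib_left)
    finally show ?thesis using S by simp
  qed
  have "(\<integral>\<^sup>+ \<sigma>. ennreal (ising_mass N \<theta> A \<beta> \<sigma>) \<partial>count_space UNIV)
      = (\<Sum>\<sigma>\<in>spins N. ennreal (ising_mass N \<theta> A \<beta> \<sigma>))"
    by (rule nn_integral_count_space') (auto simp: finite_spins ising_mass_def)
  also have "\<dots> = 1"
    using total nonneg by (simp add: sum_ennreal)
  finally show ?thesis
    unfolding ising_pmf_def using nonneg by (intro pmf_embed_pmf) auto
qed

definition joint_pmf ::
    "(real \<Rightarrow> real \<Rightarrow> real) \<Rightarrow> real \<Rightarrow> nat \<Rightarrow> real \<Rightarrow> ((nat \<Rightarrow> nat \<Rightarrow> real) \<times> (nat \<Rightarrow> real)) pmf" where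
  "joint_pmf W \<theta> N \<beta> =
     random_graph_pmf W \<theta> N \<bind> (\<lambda>A. map_pmf (\<lambda>\<sigma>. (A, \<sigma>)) (ising_pmf N \<theta> A \<beta>))"


section \<open>The test\<close>

definition Phi :: "real \<Rightarrow> real" where
  "Phi = cdf std_normal_distribution"

definition normal_quantile :: "real \<Rightarrow> real" where
  "normal_quantile p = Inf {x. p \<le> Phi x}"

definition z_value :: "real \<Rightarrow> real" where
  "z_value a = normal_quantile (1 - a)"

definition c_hat :: "real \<Rightarrow> real \<Rightarrow> nat \<Rightarrow> real \<Rightarrow> (nat \<Rightarrow> nat \<Rightarrow> real) \<Rightarrow> real" where
  "c_hat \<beta>\<^sub>0 \<alpha> N \<theta> A =
     - z_value (\<alpha> / 2) * sqrt (1 / (2 * (real N)\<^sup>2 * \<theta>\<^sup>2) * (\<Sum>i=1..N. \<Sum>j=1..N. A i j))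
     - \<beta>\<^sub>0 / (2 * (real N)\<^sup>2 * \<theta>\<^sup>2) * (\<Sum>i=1..N. \<Sum>j=1..N. A i j)"

definition d_hat :: "real \<Rightarrow> real \<Rightarrow> nat \<Rightarrow> real \<Rightarrow> (nat \<Rightarrow> nat \<Rightarrow> real) \<Rightarrow> real" where
  "d_hat \<beta>\<^sub>0 \<alpha> N \<theta> A =
     z_value (\<alpha> / 2) * sqrt (1 / (2 * (real N)\<^sup>2 * \<theta>\<^sup>2) * (\<Sum>i=1..N. \<Sum>j=1..N. A i j))
     - \<beta>\<^sub>0 / (2 * (real N)\<^sup>2 * \<theta>\<^sup>2) * (\<Sum>i=1..N. \<Sum>j=1..N. A i j)"

definition power_function ::
    "(real \<Rightarrow> real \<Rightarrow> real) \<Rightarrow> (nat \<Rightarrow> real) \<Rightarrow> real \<Rightarrow> real \<Rightarrow> nat \<Rightarrow> real \<Rightarrow> real" where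
  "power_function W \<theta> \<beta>\<^sub>0 \<alpha> N \<beta> =
     measure_pmf.prob (joint_pmf W (\<theta> N) N \<beta>)
       {(A, \<sigma>). hamiltonian N (\<theta> N) A \<sigma> < c_hat \<beta>\<^sub>0 \<alpha> N (\<theta> N) A} +
     measure_pmf.prob (joint_pmf W (\<theta> N) N \<beta>)
       {(A, \<sigma>). hamiltonian N (\<theta> N) A \<sigma> > d_hat \<beta>\<^sub>0 \<alpha> N (\<theta> N) A}"

end

theory Submission
  imports Defs "HOL-Real_Asymp.Real_Asymp"
begin

text \<open>The test statistic is governed by the characteristic function of \<open>H\<^sub>N\<close> given the graph, and that is
a quotient of partition functions: the conditional expectation of \<open>exp (\<i> s H\<^sub>N)\<close> is
\<open>Z (\<beta> - \<i> s) / Z \<beta>\<close>. The scale is \<open>s = r \<surd>\<theta>\<close>.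

The high-temperature expansion is exact. With \<open>\<kappa> = z / (N \<theta>)\<close>, \<open>D\<close> loops and \<open>E\<close> proper edges,
\<open>Z z = exp (\<kappa> D / 2) (cosh \<kappa>)\<^sup>E P (tanh \<kappa>)\<close>, where \<open>P u\<close> is the average over uniform spins of the
product of \<open>1 + u \<sigma>\<^sub>i \<sigma>\<^sub>j\<close> over the edges (\<open>partition_factorization\<close>).

The power of \<open>cosh\<close> produces the Gaussian limit. Since \<open>ln (cosh \<kappa>)\<close> is \<open>\<kappa>\<^sup>2 / 2\<close> up to a quartic
term, moving from \<open>\<beta>\<close> to \<open>\<beta> - \<i> s\<close> changes \<open>E ln (cosh \<kappa>)\<close> by a quadratic expression in \<open>s\<close> up to
an error of order \<open>N\<^sup>2 \<theta> \<surd>\<theta> / (N \<theta>)\<^sup>4\<close> (\<open>cosh_ratio\<close>), and this tends to 0 because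
\<open>N\<^sup>2 \<theta>\<^sup>3\<close> stays away from 0 while \<open>\<theta>\<close> tends to 0. The edge count concentrates: \<open>E / (N\<^sup>2 \<theta>)\<close>
converges in probability to \<open>w\<close>, half the integral of the graphon. The quadratic expression is
\<open>- r\<^sup>2 w / 2\<close> in the limit, plus a large centring term. The edge count in the thresholds of the test
removes that term up to the drift \<open>- t w\<close> caused by the alternative.

The quotient of the two values of \<open>P\<close> tends to 1 for a soft reason.
\<open>P\<close> is a polynomial in \<open>u\<close> with non-negative coefficients and constant term 1 (the generating function
of the even subgraphs), so its relative change between two arguments of size at most \<open>m\<close> and
distance \<open>\<delta>\<close> is at most \<open>\<delta> / (v - m) * P v\<close> for any larger \<open>v\<close> (\<open>bond_sum_ratio\<close>). Take
\<open>v = b / (N \<theta>)\<close> with \<open>\<beta>\<^sub>0 < b\<close> and \<open>b\<close> still below the inverse operator norm; then \<open>\<delta> / (v - m)\<close> is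
of order \<open>\<surd>\<theta>\<close>, and it is enough that the expectation of \<open>P v\<close> over the graph is bounded.

By independence of the edges that expectation is the same spin average with the deterministic bonds
\<open>b W (i/N, j/N) / N\<close> in place of \<open>v\<close>. Its logarithmic derivative in the bond strength is a sum of
spin correlations, which are dominated by the resolvent of the bond matrix and hence bounded in
terms of the trace and the Frobenius norm as soon as the operator norm of this matrix is below 1
(\<open>spin_avg_bond_weight_bound\<close>). Riemann integrability makes the matrix close to the matrix of cell
averages of \<open>W\<close>, whose norm is at most that of the integral operator, as one sees by testing the
operator against step functions (\<open>grid_matrix_norm\<close>).

Averaging over the graph and Levy's continuity theorem finish the proof.\<close>

section \<open>Averages over independent uniform spins\<close>

definition spin_avg :: "nat \<Rightarrow> ((nat \<Rightarrow> real) \<Rightarrow> 'a) \<Rightarrow> 'a::real_normed_field" where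
  "spin_avg N f = (\<Sum>\<sigma>\<in>spins N. f \<sigma>) / 2 ^ N"

lemma spin_values: "\<sigma> \<in> spins N \<Longrightarrow> i \<in> {1..N} \<Longrightarrow> \<sigma> i = 1 \<or> \<sigma> i = -1"
  by (auto simp: spins_def PiE_def Pi_def)

lemma spin_square [simp]: "\<sigma> \<in> spins N \<Longrightarrow> i \<in> {1..N} \<Longrightarrow> \<sigma> i * \<sigma> i = 1"
  using spin_values[of \<sigma> N i] by auto

lemma card_spins: "card (spins N) = 2 ^ N"
  by (simp add: spins_def card_PiE numeral_2_eq_2)

lemma spin_avg_cong: "(\<And>\<sigma>. \<sigma> \<in> spins N \<Longrightarrow> f \<sigma> = g \<sigma>) \<Longrightarrow> spin_avg N f = spin_avg N g"
  by (simp add: spin_avg_def cong: sum.cong)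

lemma spin_avg_add: "spin_avg N (\<lambda>\<sigma>. f \<sigma> + g \<sigma>) = spin_avg N f + spin_avg N g"
  by (simp add: spin_avg_def sum.distrib add_divide_distrib)

lemma spin_avg_cmult: "spin_avg N (\<lambda>\<sigma>. c * f \<sigma>) = c * spin_avg N f"
  by (simp add: spin_avg_def sum_distrib_left)

lemma spin_avg_sum: "spin_avg N (\<lambda>\<sigma>. \<Sum>i\<in>I. f i \<sigma>) = (\<Sum>i\<in>I. spin_avg N (f i))"
  unfolding spin_avg_def by (subst sum.swap) (simp add: sum_divide_distrib)

lemma spin_avg_const [simp]: "spin_avg N (\<lambda>_. c) = c"
  by (simp add: spin_avg_def card_spins)

lemma spin_avg_flip:
  assumes "x \<in> {1..N}"
  shows "spin_avg N (\<lambda>\<sigma>. f (\<sigma>(x := - \<sigma> x))) = spin_avg N f"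
proof -
  have "(\<Sum>\<sigma>\<in>spins N. f (\<sigma>(x := - \<sigma> x))) = (\<Sum>\<sigma>\<in>spins N. f \<sigma>)"
    by (rule sum.reindex_bij_witness[of _ "\<lambda>\<sigma>. \<sigma>(x := - \<sigma> x)" "\<lambda>\<sigma>. \<sigma>(x := - \<sigma> x)"])
       (use assms in \<open>force simp: spins_def PiE_def Pi_def extensional_def\<close>)+
  then show ?thesis by (simp add: spin_avg_def)
qed

lemma spin_avg_odd:
  fixes f :: "(nat \<Rightarrow> real) \<Rightarrow> real"
  assumes "x \<in> {1..N}" and "\<And>\<sigma>. \<sigma> \<in> spins N \<Longrightarrow> f (\<sigma>(x := - \<sigma> x)) = - f \<sigma>"
  shows "spin_avg N f = 0"
proof -
  have "spin_avg N f = spin_avg N (\<lambda>\<sigma>. f (\<sigma>(x := - \<sigma> x)))"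
    using assms(1) by (simp add: spin_avg_flip)
  also have "\<dots> = spin_avg N (\<lambda>\<sigma>. (-1) * f \<sigma>)"
    by (rule spin_avg_cong) (simp add: assms(2))
  also have "\<dots> = - spin_avg N f" by (subst spin_avg_cmult) simp
  finally show ?thesis by simp
qed

definition spin_monomial :: "nat \<Rightarrow> (nat \<Rightarrow> nat) \<Rightarrow> (nat \<Rightarrow> real) \<Rightarrow> real" where
  "spin_monomial N m \<sigma> = (\<Prod>i=1..N. \<sigma> i ^ m i)"

text \<open>Non-negativity of the average alone is not preserved by multiplication with a bond
\<open>1 + c \<sigma>\<^sub>x \<sigma>\<^sub>y\<close>; non-negativity of all correlations with spin monomials is.\<close>

definition ferromagnetic :: "nat \<Rightarrow> ((nat \<Rightarrow> real) \<Rightarrow> real) \<Rightarrow> bool" where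
  "ferromagnetic N g \<longleftrightarrow> (\<forall>m. 0 \<le> spin_avg N (\<lambda>\<sigma>. spin_monomial N m \<sigma> * g \<sigma>))"

lemma spin_monomial_flip:
  assumes "x \<in> {1..N}"
  shows "spin_monomial N m (\<sigma>(x := - \<sigma> x)) = (-1) ^ m x * spin_monomial N m \<sigma>"
proof -
  have "spin_monomial N m (\<sigma>(x := - \<sigma> x)) = (- \<sigma> x) ^ m x * (\<Prod>i\<in>{1..N} - {x}. \<sigma> i ^ m i)"
    unfolding spin_monomial_def using assms by (subst prod.remove[of _ x]) auto
  also have "\<dots> = (-1) ^ m x * (\<sigma> x ^ m x * (\<Prod>i\<in>{1..N} - {x}. \<sigma> i ^ m i))"
    by (subst power_minus) simp
  also have "\<sigma> x ^ m x * (\<Prod>i\<in>{1..N} - {x}. \<sigma> i ^ m i) = spin_monomial N m \<sigma>"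
    unfolding spin_monomial_def using assms by (subst (2) prod.remove[of _ x]) auto
  finally show ?thesis .
qed

text \<open>A monomial with an odd exponent averages to 0, by flipping that spin; all others are pointwise
non-negative.\<close>

lemma ferromagnetic_one: "ferromagnetic N (\<lambda>_. 1)"
  unfolding ferromagnetic_def
proof
  fix m
  show "0 \<le> spin_avg N (\<lambda>\<sigma>. spin_monomial N m \<sigma> * 1)"
  proof (cases "\<exists>x\<in>{1..N}. odd (m x)")
    case True
    then obtain x where x: "x \<in> {1..N}" "odd (m x)" by blast
    have "spin_avg N (spin_monomial N m) = 0"
      using x by (intro spin_avg_odd[of x]) (auto simp: spin_monomial_flip)
    then show ?thesis by simp
  next
    case False
    have "spin_monomial N m \<sigma> \<ge> 0" for \<sigma>
      unfolding spin_monomial_def using False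
      by (intro prod_nonneg) (auto simp: zero_le_power_eq)
    then show ?thesis by (simp add: spin_avg_def sum_nonneg)
  qed
qed

lemma ferromagnetic_spin_mult:
  assumes "ferromagnetic N g" "x \<in> {1..N}"
  shows "ferromagnetic N (\<lambda>\<sigma>. \<sigma> x * g \<sigma>)"
  unfolding ferromagnetic_def
proof
  fix m
  have "spin_monomial N (m(x := Suc (m x))) \<sigma> = spin_monomial N m \<sigma> * \<sigma> x" for \<sigma>
    unfolding spin_monomial_def using assms(2)
    by (subst (1 2) prod.remove[of _ x]) auto
  then show "0 \<le> spin_avg N (\<lambda>\<sigma>. spin_monomial N m \<sigma> * (\<sigma> x * g \<sigma>))"
    using assms(1)[unfolded ferromagnetic_def, rule_format, of "m(x := Suc (m x))"]
    by (simp add: mult.assoc)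
qed

lemma ferromagnetic_add:
  "ferromagnetic N f \<Longrightarrow> ferromagnetic N g \<Longrightarrow> ferromagnetic N (\<lambda>\<sigma>. f \<sigma> + g \<sigma>)"
  by (simp add: ferromagnetic_def spin_avg_add distrib_left)

lemma ferromagnetic_cmult:
  assumes "ferromagnetic N g" "c \<ge> 0"
  shows "ferromagnetic N (\<lambda>\<sigma>. c * g \<sigma>)"
  using assms by (simp add: ferromagnetic_def mult.left_commute[of _ c] spin_avg_cmult)

lemma ferromagnetic_nonneg: "ferromagnetic N g \<Longrightarrow> 0 \<le> spin_avg N g"
  unfolding ferromagnetic_def
  by (drule spec[of _ "\<lambda>_. 0"]) (simp add: spin_monomial_def)

lemma ferromagnetic_bond:
  assumes "ferromagnetic N g" "c \<ge> 0" "x \<in> {1..N}" "y \<in> {1..N}"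
  shows "ferromagnetic N (\<lambda>\<sigma>. (1 + c * \<sigma> x * \<sigma> y) * g \<sigma>)"
proof -
  have "ferromagnetic N (\<lambda>\<sigma>. g \<sigma> + c * (\<sigma> x * (\<sigma> y * g \<sigma>)))"
    using assms by (intro ferromagnetic_add ferromagnetic_cmult ferromagnetic_spin_mult)
  then show ?thesis by (simp add: algebra_simps)
qed

lemma ferromagnetic_bonds:
  assumes "ferromagnetic N g" "finite F"
    and "\<And>e. e \<in> F \<Longrightarrow> w e \<ge> 0 \<and> p e \<in> {1..N} \<and> q e \<in> {1..N}"
  shows "ferromagnetic N (\<lambda>\<sigma>. (\<Prod>e\<in>F. 1 + w e * \<sigma> (p e) * \<sigma> (q e)) * g \<sigma>)"
  using assms(2,3)
proof (induction F rule: finite_induct)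
  case (insert e F)
  have "ferromagnetic N (\<lambda>\<sigma>. (1 + w e * \<sigma> (p e) * \<sigma> (q e)) *
      ((\<Prod>e\<in>F. 1 + w e * \<sigma> (p e) * \<sigma> (q e)) * g \<sigma>))"
    using insert by (intro ferromagnetic_bond) auto
  then show ?case using insert.hyps by (simp add: mult.assoc)
qed (use assms in simp)

lemma spin_avg_bond_mono:
  assumes "ferromagnetic N g" "c \<ge> 0" "x \<in> {1..N}" "y \<in> {1..N}"
  shows "spin_avg N g \<le> spin_avg N (\<lambda>\<sigma>. (1 + c * \<sigma> x * \<sigma> y) * g \<sigma>)"
proof -
  have "0 \<le> spin_avg N (\<lambda>\<sigma>. c * (\<sigma> x * (\<sigma> y * g \<sigma>)))"
    using assms by (intro ferromagnetic_nonneg ferromagnetic_cmult ferromagnetic_spin_mult)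
  moreover have "spin_avg N (\<lambda>\<sigma>. (1 + c * \<sigma> x * \<sigma> y) * g \<sigma>) =
      spin_avg N g + spin_avg N (\<lambda>\<sigma>. c * (\<sigma> x * (\<sigma> y * g \<sigma>)))"
    by (simp add: spin_avg_add[symmetric] algebra_simps)
  ultimately show ?thesis by simp
qed

section \<open>Domination of spin correlations by walks\<close>

text \<open>In terms of subgraphs: a subgraph whose odd vertices are \<open>x\<close> and \<open>y\<close> uses some edge at \<open>x\<close>; removing
that edge moves the odd vertex from \<open>x\<close> to its neighbour. The induction adds the edges at \<open>x\<close> one at
a time. The factor \<open>R\<close> collects the edges that avoid \<open>x\<close>, and without edges at \<open>x\<close> the correlation
vanishes by flipping the spin at \<open>x\<close>.\<close>

lemma star_correlation_bound:
  assumes K: "finite K" "K \<subseteq> {1..N} - {x}" and xy: "x \<in> {1..N}" "y \<in> {1..N}" "x \<noteq> y"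
    and u: "\<And>k. k \<in> K \<Longrightarrow> u k \<ge> 0"
    and R: "ferromagnetic N R" "\<And>\<sigma>. R (\<sigma>(x := - \<sigma> x)) = R \<sigma>"
  shows "spin_avg N (\<lambda>\<sigma>. \<sigma> x * \<sigma> y * ((\<Prod>k\<in>K. 1 + u k * \<sigma> x * \<sigma> k) * R \<sigma>))
    \<le> (\<Sum>k\<in>K. u k * spin_avg N (\<lambda>\<sigma>. \<sigma> k * \<sigma> y * ((\<Prod>k\<in>K. 1 + u k * \<sigma> x * \<sigma> k) * R \<sigma>)))"
  using K u
proof (induction K rule: finite_induct)
  case empty
  have "spin_avg N (\<lambda>\<sigma>. \<sigma> x * \<sigma> y * R \<sigma>) = 0"
    using xy R(2) by (intro spin_avg_odd[of x]) auto
  then show ?case by simp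
next
  case (insert l K)
  define Q where "Q = (\<lambda>\<sigma>. (\<Prod>k\<in>K. 1 + u k * \<sigma> x * \<sigma> k) * R \<sigma>)"
  define Q' where "Q' = (\<lambda>\<sigma>. (1 + u l * \<sigma> x * \<sigma> l) * Q \<sigma>)"
  have l: "l \<in> {1..N}" "u l \<ge> 0" using insert by auto
  have Q: "ferromagnetic N Q"
    unfolding Q_def using insert xy R by (intro ferromagnetic_bonds) auto
  have mono: "spin_avg N (\<lambda>\<sigma>. \<sigma> k * \<sigma> y * Q \<sigma>) \<le> spin_avg N (\<lambda>\<sigma>. \<sigma> k * \<sigma> y * Q' \<sigma>)"
    if "k \<in> {1..N}" for k
  proof -
    have "ferromagnetic N (\<lambda>\<sigma>. \<sigma> k * (\<sigma> y * Q \<sigma>))"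
      using that xy Q by (intro ferromagnetic_spin_mult)
    from spin_avg_bond_mono[OF this l(2) xy(1) l(1)]
    show ?thesis by (simp add: Q'_def algebra_simps)
  qed
  have Q'eq: "(\<Prod>k\<in>insert l K. 1 + u k * \<sigma> x * \<sigma> k) * R \<sigma> = Q' \<sigma>" for \<sigma>
    using insert.hyps by (simp add: Q'_def Q_def mult.assoc)
  have "spin_avg N (\<lambda>\<sigma>. \<sigma> x * \<sigma> y * Q' \<sigma>)
      = spin_avg N (\<lambda>\<sigma>. \<sigma> x * \<sigma> y * Q \<sigma> + u l * (\<sigma> l * \<sigma> y * Q \<sigma>))"
  proof (rule spin_avg_cong)
    fix \<sigma> assume s: "\<sigma> \<in> spins N"
    have "\<sigma> x * \<sigma> y * Q' \<sigma> = \<sigma> x * \<sigma> y * Q \<sigma> + u l * ((\<sigma> x * \<sigma> x) * \<sigma> l * \<sigma> y * Q \<sigma>)"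
      by (simp add: Q'_def algebra_simps)
    then show "\<sigma> x * \<sigma> y * Q' \<sigma> = \<sigma> x * \<sigma> y * Q \<sigma> + u l * (\<sigma> l * \<sigma> y * Q \<sigma>)"
      using s xy by simp
  qed
  also have "\<dots> = spin_avg N (\<lambda>\<sigma>. \<sigma> x * \<sigma> y * Q \<sigma>) + u l * spin_avg N (\<lambda>\<sigma>. \<sigma> l * \<sigma> y * Q \<sigma>)"
    by (simp add: spin_avg_add spin_avg_cmult)
  also have "\<dots> \<le> (\<Sum>k\<in>K. u k * spin_avg N (\<lambda>\<sigma>. \<sigma> k * \<sigma> y * Q \<sigma>))
      + u l * spin_avg N (\<lambda>\<sigma>. \<sigma> l * \<sigma> y * Q \<sigma>)"
    using insert by (simp add: Q_def)
  also have "\<dots> \<le> (\<Sum>k\<in>K. u k * spin_avg N (\<lambda>\<sigma>. \<sigma> k * \<sigma> y * Q' \<sigma>))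
      + u l * spin_avg N (\<lambda>\<sigma>. \<sigma> l * \<sigma> y * Q' \<sigma>)"
    using insert by (intro add_mono sum_mono mult_left_mono mono) auto
  also have "\<dots> = (\<Sum>k\<in>insert l K. u k * spin_avg N (\<lambda>\<sigma>. \<sigma> k * \<sigma> y * Q' \<sigma>))"
    using insert.hyps by simp
  finally show ?case by (simp only: Q'eq)
qed

definition edges :: "nat \<Rightarrow> (nat \<times> nat) set" where
  "edges N = {(i, j). 1 \<le> i \<and> i < j \<and> j \<le> N}"

lemma edges_subset: "edges N \<subseteq> {1..N} \<times> {1..N}"
  by (auto simp: edges_def)

lemma finite_edges [simp]: "finite (edges N)"
  by (rule finite_subset[OF edges_subset]) auto

definition bond_weight :: "nat \<Rightarrow> (nat \<Rightarrow> nat \<Rightarrow> real) \<Rightarrow> (nat \<Rightarrow> real) \<Rightarrow> real" where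
  "bond_weight N w \<sigma> = (\<Prod>e\<in>edges N. 1 + w (fst e) (snd e) * \<sigma> (fst e) * \<sigma> (snd e))"

text \<open>The recursion that bounds two-point functions by walks weighted with \<open>w\<close>. The summand \<open>k = x\<close>
is there to make the right-hand side a product with the full matrix \<open>w\<close>.\<close>

lemma correlation_bound:
  assumes xy: "x \<in> {1..N}" "y \<in> {1..N}" "x \<noteq> y"
    and w: "\<And>i j. i \<in> {1..N} \<Longrightarrow> j \<in> {1..N} \<Longrightarrow> w i j \<ge> 0 \<and> w i j = w j i"
  shows "spin_avg N (\<lambda>\<sigma>. \<sigma> x * \<sigma> y * bond_weight N w \<sigma>)
    \<le> (\<Sum>k=1..N. w x k * spin_avg N (\<lambda>\<sigma>. \<sigma> k * \<sigma> y * bond_weight N w \<sigma>))"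
proof -
  define E' where "E' = {e \<in> edges N. fst e \<noteq> x \<and> snd e \<noteq> x}"
  define R where "R = (\<lambda>\<sigma>. (\<Prod>e\<in>E'. 1 + w (fst e) (snd e) * \<sigma> (fst e) * \<sigma> (snd e)) * (1::real))"
  define h where "h = (\<lambda>k. (min x k, max x k))"
  let ?K = "{1..N} - {x}"
  have split: "edges N = h ` ?K \<union> E'"
  proof -
    have "(i, j) \<in> h ` ?K" if "(i, j) \<in> edges N" "i = x \<or> j = x" for i j
    proof -
      from that have "(i, j) = h (if i = x then j else i)" "(if i = x then j else i) \<in> ?K"
        by (auto simp: h_def edges_def)
      then show ?thesis by (rule image_eqI)
    qed
    then show ?thesis using xy by (auto simp: E'_def edges_def h_def min_def max_def split: if_splits)
  qed
  have bw: "bond_weight N w \<sigma> = (\<Prod>k\<in>?K. 1 + w x k * \<sigma> x * \<sigma> k) * R \<sigma>" for \<sigma>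
  proof -
    have "inj_on h ?K"
      by (auto simp: inj_on_def h_def min_def max_def split: if_splits)
    have "bond_weight N w \<sigma> =
        (\<Prod>e\<in>h ` ?K. 1 + w (fst e) (snd e) * \<sigma> (fst e) * \<sigma> (snd e)) * R \<sigma>"
      unfolding bond_weight_def split R_def mult_1_right
    proof (rule prod.union_disjoint)
      show "finite E'" by (simp add: E'_def)
      show "h ` ?K \<inter> E' = {}" by (auto simp: h_def E'_def min_def max_def split: if_splits)
    qed simp
    also have "(\<Prod>e\<in>h ` ?K. 1 + w (fst e) (snd e) * \<sigma> (fst e) * \<sigma> (snd e))
        = (\<Prod>k\<in>?K. 1 + w x k * \<sigma> x * \<sigma> k)"
      using \<open>inj_on h ?K\<close> w[OF xy(1)]
      by (subst prod.reindex) (auto simp: h_def min_def max_def algebra_simps split: if_splits intro!: prod.cong)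
    finally show ?thesis .
  qed
  have R: "ferromagnetic N R"
  proof -
    have "finite E'" by (simp add: E'_def)
    then show ?thesis
      unfolding R_def using w by (intro ferromagnetic_bonds ferromagnetic_one)
        (auto simp: E'_def edges_def)
  qed
  have pos: "0 \<le> spin_avg N (\<lambda>\<sigma>. \<sigma> x * \<sigma> y * bond_weight N w \<sigma>)"
  proof -
    have "ferromagnetic N (\<lambda>\<sigma>. (\<Prod>k\<in>?K. 1 + w x k * \<sigma> x * \<sigma> k) * R \<sigma>)"
      by (rule ferromagnetic_bonds[OF R]) (use w xy in auto)
    then have "ferromagnetic N (bond_weight N w)" by (simp only: bw[abs_def])
    then show ?thesis
      unfolding mult.assoc using xy by (intro ferromagnetic_nonneg ferromagnetic_spin_mult)
  qed
  have "spin_avg N (\<lambda>\<sigma>. \<sigma> x * \<sigma> y * bond_weight N w \<sigma>)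
    \<le> (\<Sum>k\<in>?K. w x k * spin_avg N (\<lambda>\<sigma>. \<sigma> k * \<sigma> y * bond_weight N w \<sigma>))"
    unfolding bw
  proof (rule star_correlation_bound)
    show "R (\<sigma>(x := - \<sigma> x)) = R \<sigma>" for \<sigma>
      by (auto simp: R_def E'_def intro!: prod.cong)
  qed (use xy w R in auto)
  also have "\<dots> \<le> w x x * spin_avg N (\<lambda>\<sigma>. \<sigma> x * \<sigma> y * bond_weight N w \<sigma>) + \<dots>"
    using w xy pos by simp
  also have "\<dots> = (\<Sum>k=1..N. w x k * spin_avg N (\<lambda>\<sigma>. \<sigma> k * \<sigma> y * bond_weight N w \<sigma>))"
    using xy(1) by (intro sum.remove[symmetric]) auto
  finally show ?thesis .
qed


section \<open>The partition function below the spectral threshold\<close>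

lemma bilinear_le_L2_set:
  fixes f g :: "'i \<Rightarrow> real"
  shows "(\<Sum>i\<in>A. f i * g i) \<le> L2_set f A * L2_set g A"
proof -
  have "(\<Sum>i\<in>A. f i * g i) \<le> (\<Sum>i\<in>A. \<bar>f i\<bar> * \<bar>g i\<bar>)"
    by (intro sum_mono) (metis abs_ge_self abs_mult)
  also have "\<dots> \<le> L2_set f A * L2_set g A" by (rule L2_set_mult_ineq)
  finally show ?thesis .
qed

text \<open>The hypothesis \<open>rec\<close> says \<open>n \<le> P I + w n\<close> entrywise. Iterating it would give
\<open>n \<le> P (I - w)\<^sup>-\<^sup>1\<close>; the argument avoids the series. Inserting the inequality into \<open>w n\<close> once gives
\<open>w n \<le> P w + w (w n)\<close>, so each column of \<open>w n\<close> has norm at most \<open>P / (1 - c)\<close> times the norm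
of the column of \<open>w\<close>. Inserting it once more and using Cauchy--Schwarz in each diagonal entry
gives the Frobenius norm.\<close>

lemma resolvent_trace_bound:
  fixes w n :: "'i \<Rightarrow> 'i \<Rightarrow> real" and P c :: real
  assumes fin: "finite A"
    and w: "\<And>i j. i \<in> A \<Longrightarrow> j \<in> A \<Longrightarrow> w i j \<ge> 0 \<and> w i j = w j i"
    and n: "\<And>i j. i \<in> A \<Longrightarrow> j \<in> A \<Longrightarrow> n i j \<ge> 0"
    and rec: "\<And>i j. i \<in> A \<Longrightarrow> j \<in> A \<Longrightarrow> n i j \<le> (if i = j then P else 0) + (\<Sum>k\<in>A. w i k * n k j)"
    and c: "c < 1" "\<And>v. L2_set (\<lambda>i. \<Sum>j\<in>A. w i j * v j) A \<le> c * L2_set v A"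
    and P: "P \<ge> 0"
  shows "(\<Sum>i\<in>A. \<Sum>j\<in>A. w i j * n i j)
    \<le> P * ((\<Sum>i\<in>A. w i i) + (\<Sum>i\<in>A. \<Sum>j\<in>A. (w i j)\<^sup>2) / (1 - c))"
proof -
  define wn where "wn = (\<lambda>j i. \<Sum>k\<in>A. w i k * n k j)"
  have wn0: "wn j i \<ge> 0" if "i \<in> A" "j \<in> A" for i j
    unfolding wn_def using that w n by (intro sum_nonneg) auto
  have rec2: "wn j i \<le> P * w i j + (\<Sum>k\<in>A. w i k * wn j k)" if ij: "i \<in> A" "j \<in> A" for i j
  proof -
    have "wn j i \<le> (\<Sum>k\<in>A. w i k * ((if k = j then P else 0) + wn j k))"
      unfolding wn_def using ij w by (intro sum_mono mult_left_mono rec) auto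
    also have "\<dots> = P * w i j + (\<Sum>k\<in>A. w i k * wn j k)"
      using fin ij by (simp add: distrib_left sum.distrib if_distrib[of "\<lambda>x. _ * x"] cong: if_cong)
    finally show ?thesis .
  qed
  have norm_wn: "L2_set (wn j) A \<le> P * L2_set (w j) A / (1 - c)" if j: "j \<in> A" for j
  proof -
    have "L2_set (wn j) A \<le> L2_set (\<lambda>i. P * w j i + (\<Sum>k\<in>A. w i k * wn j k)) A"
    proof (rule L2_set_mono)
      fix i assume "i \<in> A"
      then show "wn j i \<le> P * w j i + (\<Sum>k\<in>A. w i k * wn j k)" "0 \<le> wn j i"
        using rec2[of i j] wn0 w[of i j] j by auto
    qed
    also have "\<dots> \<le> L2_set (\<lambda>i. P * w j i) A + L2_set (\<lambda>i. \<Sum>k\<in>A. w i k * wn j k) A"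
      by (rule L2_set_triangle_ineq)
    also have "\<dots> \<le> P * L2_set (w j) A + c * L2_set (wn j) A"
      using c(2)[of "wn j"] P by (simp add: L2_set_right_distrib)
    finally have "(1 - c) * L2_set (wn j) A \<le> P * L2_set (w j) A"
      by (simp add: algebra_simps)
    then show ?thesis using c(1) by (simp add: pos_le_divide_eq mult.commute)
  qed
  have "(\<Sum>i\<in>A. \<Sum>j\<in>A. w i j * n i j) = (\<Sum>j\<in>A. \<Sum>i\<in>A. w i j * n i j)"
    by (rule sum.swap)
  also have "\<dots> = (\<Sum>j\<in>A. wn j j)"
    unfolding wn_def using w by (intro sum.cong refl) auto
  also have "\<dots> \<le> (\<Sum>j\<in>A. P * w j j + P * (\<Sum>i\<in>A. (w j i)\<^sup>2) / (1 - c))"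
  proof (rule sum_mono)
    fix j assume j: "j \<in> A"
    have "wn j j \<le> P * w j j + (\<Sum>k\<in>A. w j k * wn j k)" by (rule rec2[OF j j])
    also have "(\<Sum>k\<in>A. w j k * wn j k) \<le> L2_set (w j) A * L2_set (wn j) A"
      by (rule bilinear_le_L2_set)
    also have "\<dots> \<le> L2_set (w j) A * (P * L2_set (w j) A / (1 - c))"
      by (intro mult_left_mono norm_wn j) auto
    also have "\<dots> = P * (L2_set (w j) A)\<^sup>2 / (1 - c)"
      by (simp add: power2_eq_square)
    also have "(L2_set (w j) A)\<^sup>2 = (\<Sum>i\<in>A. (w j i)\<^sup>2)"
      by (simp add: L2_set_def sum_nonneg)
    finally show "wn j j \<le> P * w j j + P * (\<Sum>i\<in>A. (w j i)\<^sup>2) / (1 - c)" by simp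
  qed
  also have "\<dots> = P * ((\<Sum>i\<in>A. w i i) + (\<Sum>i\<in>A. \<Sum>j\<in>A. (w i j)\<^sup>2) / (1 - c))"
    by (simp add: sum.distrib sum_distrib_left distrib_left sum_divide_distrib)
  finally show ?thesis .
qed

text \<open>Scaling all bonds by \<open>s\<close>, the spin average \<open>p s\<close> satisfies \<open>p' \<le> B p\<close> on \<open>[0, 1]\<close> with \<open>B\<close> the
exponent in the conclusion, and \<open>p 0 = 1\<close>: the derivative is the sum of the bond strengths times
the two-point functions with the bond itself removed, and putting the bond back only increases them.\<close>

lemma spin_avg_bond_weight_bound:
  fixes w :: "nat \<Rightarrow> nat \<Rightarrow> real"
  assumes w: "\<And>i j. i \<in> {1..N} \<Longrightarrow> j \<in> {1..N} \<Longrightarrow> w i j \<ge> 0 \<and> w i j = w j i"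
    and c: "0 \<le> c" "c < 1" "\<And>v. L2_set (\<lambda>i. \<Sum>j=1..N. w i j * v j) {1..N} \<le> c * L2_set v {1..N}"
  shows "spin_avg N (bond_weight N w)
    \<le> exp ((\<Sum>i=1..N. w i i) + (\<Sum>i=1..N. \<Sum>j=1..N. (w i j)\<^sup>2) / (1 - c))"
proof -
  define B where "B = (\<Sum>i=1..N. w i i) + (\<Sum>i=1..N. \<Sum>j=1..N. (w i j)\<^sup>2) / (1 - c)"
  define b where "b = (\<lambda>e \<sigma>. w (fst e) (snd e) * \<sigma> (fst e) * \<sigma> (snd e))"
  define p where "p = (\<lambda>s. spin_avg N (\<lambda>\<sigma>. \<Prod>e\<in>edges N. 1 + s * b e \<sigma>))"
  define q where "q = (\<lambda>s. \<Sum>e\<in>edges N. spin_avg N (\<lambda>\<sigma>. b e \<sigma> * (\<Prod>e\<in>edges N - {e}. 1 + s * b e \<sigma>)))"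
  have p_alt: "p s = spin_avg N (bond_weight N (\<lambda>i j. s * w i j))" for s
    by (simp add: p_def bond_weight_def[abs_def] b_def mult.assoc)
  have deriv: "(p has_real_derivative q s) (at s)" for s
  proof -
    have d: "((\<lambda>s. \<Prod>e\<in>edges N. 1 + s * b e \<sigma>) has_real_derivative
        (\<Sum>e\<in>edges N. b e \<sigma> * (\<Prod>e\<in>edges N - {e}. 1 + s * b e \<sigma>))) (at s)" for \<sigma>
      by (rule has_field_derivative_prod) (auto intro!: derivative_eq_intros)
    have "((\<lambda>s. spin_avg N (\<lambda>\<sigma>. \<Prod>e\<in>edges N. 1 + s * b e \<sigma>)) has_real_derivative
        spin_avg N (\<lambda>\<sigma>. \<Sum>e\<in>edges N. b e \<sigma> * (\<Prod>e\<in>edges N - {e}. 1 + s * b e \<sigma>))) (at s)"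
      unfolding spin_avg_def by (intro DERIV_cdivide DERIV_sum d)
    then show ?thesis by (simp add: p_def q_def spin_avg_sum)
  qed
  have q_le: "q s \<le> B * p s" if s: "0 \<le> s" "s \<le> 1" for s
  proof -
    define n where "n = (\<lambda>i j. spin_avg N (\<lambda>\<sigma>. \<sigma> i * \<sigma> j * bond_weight N (\<lambda>i j. s * w i j) \<sigma>))"
    have fw: "ferromagnetic N (\<lambda>\<sigma>. \<Prod>e\<in>F. 1 + s * b e \<sigma>)" if "F \<subseteq> edges N" for F
    proof -
      have "ferromagnetic N (\<lambda>\<sigma>. (\<Prod>e\<in>F. 1 + (s * w (fst e) (snd e)) * \<sigma> (fst e) * \<sigma> (snd e)) * 1)"
        using that w s finite_subset[OF that] edges_subset[of N]
        by (intro ferromagnetic_bonds ferromagnetic_one) (auto intro!: mult_nonneg_nonneg)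
      then show ?thesis by (simp add: b_def mult.assoc)
    qed
    have fbw: "ferromagnetic N (bond_weight N (\<lambda>i j. s * w i j))"
      using fw[of "edges N"] by (simp add: bond_weight_def[abs_def] b_def mult.assoc)
    have n0: "n i j \<ge> 0" if "i \<in> {1..N}" "j \<in> {1..N}" for i j
      unfolding n_def mult.assoc using that
      by (intro ferromagnetic_nonneg ferromagnetic_spin_mult fbw)
    have p0: "p s \<ge> 0" unfolding p_alt by (rule ferromagnetic_nonneg[OF fbw])
    have "q s \<le> (\<Sum>e\<in>edges N. w (fst e) (snd e) * n (fst e) (snd e))"
      unfolding q_def
    proof (rule sum_mono)
      fix e assume e: "e \<in> edges N"
      then have e': "fst e \<in> {1..N}" "snd e \<in> {1..N}" using edges_subset by force+
      then have we: "w (fst e) (snd e) \<ge> 0" using w by auto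
      let ?R = "\<lambda>\<sigma>. \<Prod>e\<in>edges N - {e}. 1 + s * b e \<sigma>"
      have "spin_avg N (\<lambda>\<sigma>. b e \<sigma> * ?R \<sigma>)
          = w (fst e) (snd e) * spin_avg N (\<lambda>\<sigma>. \<sigma> (fst e) * (\<sigma> (snd e) * ?R \<sigma>))"
        by (simp add: b_def mult.assoc spin_avg_cmult)
      also have "\<dots> \<le> w (fst e) (snd e) * spin_avg N (\<lambda>\<sigma>. (1 + (s * w (fst e) (snd e)) * \<sigma> (fst e) * \<sigma> (snd e)) *
            (\<sigma> (fst e) * (\<sigma> (snd e) * ?R \<sigma>)))"
        using we s e' fw[of "edges N - {e}"]
        by (intro mult_left_mono spin_avg_bond_mono ferromagnetic_spin_mult) auto
      also have "spin_avg N (\<lambda>\<sigma>. (1 + (s * w (fst e) (snd e)) * \<sigma> (fst e) * \<sigma> (snd e)) *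
            (\<sigma> (fst e) * (\<sigma> (snd e) * ?R \<sigma>))) = n (fst e) (snd e)"
        unfolding n_def bond_weight_def using e
        by (subst (2) prod.remove[of _ e]) (simp_all add: b_def mult_ac)
      finally show "spin_avg N (\<lambda>\<sigma>. b e \<sigma> * ?R \<sigma>) \<le> w (fst e) (snd e) * n (fst e) (snd e)" .
    qed
    also have "\<dots> \<le> (\<Sum>e\<in>{1..N} \<times> {1..N}. w (fst e) (snd e) * n (fst e) (snd e))"
      using w n0 edges_subset by (intro sum_mono2) auto
    also have "\<dots> = (\<Sum>i=1..N. \<Sum>j=1..N. w i j * n i j)"
      by (simp add: sum.cartesian_product split_beta)
    also have "\<dots> \<le> p s * B"
      unfolding B_def
    proof (rule resolvent_trace_bound)
      fix i j assume ij: "i \<in> {1..N}" "j \<in> {1..N}"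
      have "n i j \<le> (if i = j then p s else 0) + (\<Sum>k=1..N. (s * w i k) * n k j)"
      proof (cases "i = j")
        case True
        have "n i j = p s"
          unfolding p_alt n_def using True ij by (intro spin_avg_cong) auto
        then show ?thesis using True w s n0 ij by (auto intro!: sum_nonneg)
      next
        case False
        have "n i j \<le> (\<Sum>k=1..N. (s * w i k) * n k j)"
          unfolding n_def by (rule correlation_bound) (use False ij w s in auto)
        then show ?thesis using False by simp
      qed
      also have "(\<Sum>k=1..N. (s * w i k) * n k j) \<le> (\<Sum>k=1..N. w i k * n k j)"
        using s w n0 ij by (intro sum_mono mult_right_mono) (auto intro: mult_left_le_one_le)
      finally show "n i j \<le> (if i = j then p s else 0) + (\<Sum>k=1..N. w i k * n k j)" by simp
    qed (use w n0 c p0 in auto)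
    finally show ?thesis by (simp add: mult.commute)
  qed
  have "p 1 * exp (- B * 1) \<le> p 0 * exp (- B * 0)"
  proof (rule DERIV_nonpos_imp_nonincreasing[of 0 1 "\<lambda>s. p s * exp (- B * s)"])
    fix s :: real assume s: "0 \<le> s" "s \<le> 1"
    have "((\<lambda>s. p s * exp (- B * s)) has_real_derivative (q s - B * p s) * exp (- B * s)) (at s)"
      by (auto intro!: derivative_eq_intros deriv simp: algebra_simps)
    moreover have "(q s - B * p s) * exp (- B * s) \<le> 0"
      using q_le[OF s] by (intro mult_nonpos_nonneg) auto
    ultimately show "\<exists>y. ((\<lambda>s. p s * exp (- B * s)) has_real_derivative y) (at s) \<and> y \<le> 0"
      by blast
  qed simp
  moreover have "p 0 = 1" by (simp add: p_def)
  ultimately have "p 1 \<le> exp B" by (simp add: exp_minus field_simps)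
  then show ?thesis by (simp add: p_alt B_def)
qed

section \<open>Lebesgue and Borel measurable functions\<close>

lemma lebesgue_measurable_AE:
  fixes f g :: "'a::euclidean_space \<Rightarrow> real"
  assumes g: "g \<in> borel_measurable borel" and ae: "AE x in lborel. f x = g x"
  shows "f \<in> borel_measurable lebesgue"
proof (rule measurableI)
  fix B :: "real set" assume B: "B \<in> sets borel"
  have A: "g -` B \<in> sets lebesgue"
    using measurable_sets[OF g B] by (simp add: sets_completionI_sets)
  have "AE x in lebesgue. x \<in> g -` B \<longleftrightarrow> x \<in> f -` B"
    using ae by (intro AE_completion) (auto elim!: eventually_mono)
  then have "f -` B \<in> sets lebesgue"
    using A by (rule completion.in_sets_AE) simp
  then show "f -` B \<inter> space lebesgue \<in> sets lebesgue" by simp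
qed simp

lemma integral_lebesgue_AE:
  fixes f g :: "'a::euclidean_space \<Rightarrow> real"
  assumes g: "g \<in> borel_measurable borel" and ae: "AE x in lborel. f x = g x"
  shows "integral\<^sup>L lebesgue f = integral\<^sup>L lborel g"
proof -
  have "integral\<^sup>L lebesgue f = integral\<^sup>L lebesgue g"
    using ae by (intro integral_cong_AE lebesgue_measurable_AE[OF g] AE_completion) auto
  also have "\<dots> = integral\<^sup>L lborel g"
    using g by (intro integral_completion) simp
  finally show ?thesis .
qed

section \<open>Riemann sums over the uniform grid\<close>

text \<open>Half-open intervals partition \<open>(0, 1]\<close> exactly, which makes integrals additive. Tagged divisions
consist of closed boxes, hence the closed cells below.\<close>

definition grid_interval :: "nat \<Rightarrow> nat \<Rightarrow> real set" where
  "grid_interval N i = {(real i - 1) / real N <.. real i / real N}"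

definition grid_cell :: "nat \<Rightarrow> nat \<times> nat \<Rightarrow> (real \<times> real) set" where
  "grid_cell N = (\<lambda>(i, j). {(real i - 1) / real N .. real i / real N} \<times> {(real j - 1) / real N .. real j / real N})"

lemma grid_interval_iff:
  assumes "N \<ge> 1" "i \<ge> 1" "x > 0"
  shows "x \<in> grid_interval N i \<longleftrightarrow> i = nat \<lceil>real N * x\<rceil>"
proof -
  have "x \<in> grid_interval N i \<longleftrightarrow> of_int (int i) - 1 < real N * x \<and> real N * x \<le> of_int (int i)"
    using assms by (auto simp: grid_interval_def field_simps)
  also have "\<dots> \<longleftrightarrow> \<lceil>real N * x\<rceil> = int i" by (simp add: ceiling_eq_iff)
  also have "\<dots> \<longleftrightarrow> i = nat \<lceil>real N * x\<rceil>" using assms by auto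
  finally show ?thesis .
qed

lemma grid_index:
  assumes "N \<ge> 1" "x \<in> {0<..1}"
  shows "nat \<lceil>real N * x\<rceil> \<in> {1..N}"
proof -
  have "real N * x > 0" "real N * x \<le> real N" using assms by (auto simp: mult_left_le)
  then have "0 < \<lceil>real N * x\<rceil>" "\<lceil>real N * x\<rceil> \<le> int N" by (simp_all only: zero_less_ceiling ceiling_le_iff of_int_of_nat_eq)
  then show ?thesis unfolding atLeastAtMost_iff by linarith
qed

lemma grid_interval_subset: "N \<ge> 1 \<Longrightarrow> i \<in> {1..N} \<Longrightarrow> grid_interval N i \<subseteq> {0<..1}"
proof
  fix x assume N: "N \<ge> 1" "i \<in> {1..N}" and x: "x \<in> grid_interval N i"
  then have "0 \<le> (real i - 1) / real N" "real i / real N \<le> 1" by auto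
  then show "x \<in> {0<..1}" using x unfolding grid_interval_def by (simp only: greaterThanAtMost_iff) linarith
qed

lemma sum_indicator_grid:
  assumes N: "N \<ge> 1"
  shows "(\<Sum>i=1..N. v i * indicator (grid_interval N i) x) =
    (if x \<in> {0<..1} then v (nat \<lceil>real N * x\<rceil>) else (0::real))"
proof (cases "x \<in> {0<..1}")
  case True
  then have x: "x > 0" "real N * x \<le> real N" "real N * x > 0" using N by (auto simp: mult_left_le)
  have "nat \<lceil>real N * x\<rceil> \<in> {1..N}" using grid_index[OF N True] .
  moreover have "(\<Sum>i=1..N. v i * indicator (grid_interval N i) x) =
    (\<Sum>i=1..N. if i = nat \<lceil>real N * x\<rceil> then v i else 0)"
    using N x by (intro sum.cong refl) (simp add: indicator_def grid_interval_iff)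
  ultimately show ?thesis using True by simp
next
  case False
  show ?thesis
  proof -
    have "x \<notin> grid_interval N i" if "i \<in> {1..N}" for i
      using False grid_interval_subset[OF N that] by blast
    then show ?thesis using False by (auto simp: indicator_def intro!: sum.neutral)
  qed
qed

lemma measure_grid_interval: "N \<ge> 1 \<Longrightarrow> measure lborel (grid_interval N i) = 1 / real N"
  by (simp add: grid_interval_def field_simps)

lemma grid_tagged_division:
  assumes N: "N \<ge> 1" and \<tau>: "\<And>c. c \<in> {1..N} \<times> {1..N} \<Longrightarrow> \<tau> c \<in> grid_cell N c"
  defines "p \<equiv> (\<lambda>c. (\<tau> c, grid_cell N c)) ` ({1..N} \<times> {1..N})"
  shows "p tagged_division_of ({0..1} \<times> {0..1})"
    and "\<forall>(x, K)\<in>p. diameter K \<le> 2 / real N"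
    and "(\<Sum>(x, K)\<in>p. measure lborel K * f x) = (\<Sum>c\<in>{1..N} \<times> {1..N}. f (\<tau> c)) / (real N)\<^sup>2"
proof -
  have cell: "grid_cell N (i, j) = cbox ((real i - 1) / real N, (real j - 1) / real N) (real i / real N, real j / real N)" for i j
    by (simp add: grid_cell_def cbox_Pair_eq)
  have int: "interior (grid_cell N (i, j)) =
      {(real i - 1) / real N <..< real i / real N} \<times> {(real j - 1) / real N <..< real j / real N}" for i j
    by (simp add: grid_cell_def interior_Times interior_atLeastAtMost_real)
  have disj1: "{(real i - 1) / real N <..< real i / real N} \<inter> {(real i' - 1) / real N <..< real i' / real N} = {}"
    if "i \<noteq> i'" for i i' :: nat
  proof -
    have False if x: "(real i - 1) < real N * x" "real N * x < real i" "(real i' - 1) < real N * x" "real N * x < real i'" for x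
    proof -
      have "real i < real i' + 1" "real i' < real i + 1" using x by linarith+
      then show False using \<open>i \<noteq> i'\<close> by linarith
    qed
    then have "x \<notin> {(real i - 1) / real N <..< real i / real N} \<inter> {(real i' - 1) / real N <..< real i' / real N}" for x
      using N by (auto simp: field_simps)
    then show ?thesis by blast
  qed
  have disj: "interior (grid_cell N c) \<inter> interior (grid_cell N c') = {}" if "c \<noteq> c'" for c c'
  proof -
    obtain i j i' j' where c: "c = (i, j)" "c' = (i', j')" by (cases c, cases c')
    then have "i \<noteq> i' \<or> j \<noteq> j'" using that by auto
    then show ?thesis unfolding c int using disj1[of i i'] disj1[of j j'] by blast
  qed
  have ne: "interior (grid_cell N c) \<noteq> {}" for c
  proof -
    obtain i j where c: "c = (i, j)" by (cases c)
    have "(real i - 1/2) / real N \<in> {(real i - 1) / real N <..< real i / real N}" for i :: nat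
      using N by (auto simp: field_simps)
    then show ?thesis unfolding c int by blast
  qed
  have inj: "inj_on (\<lambda>c. (\<tau> c, grid_cell N c)) ({1..N} \<times> {1..N})"
    using disj ne by (intro inj_onI) (metis Pair_inject inf.idem)
  have union1: "\<exists>i\<in>{1..N}. x \<in> {(real i - 1) / real N .. real i / real N}" if x: "x \<in> {0..1}" for x :: real
  proof (cases "x = 0")
    case True
    then show ?thesis using N by (intro bexI[of _ 1]) auto
  next
    case False
    then have x: "x > 0" "x \<le> 1" using x by auto
    have "nat \<lceil>real N * x\<rceil> \<in> {1..N}" using grid_index[OF N, of x] x by simp
    moreover have "x \<in> grid_interval N (nat \<lceil>real N * x\<rceil>)"
      using grid_interval_iff[of N "nat \<lceil>real N * x\<rceil>" x] calculation x N by auto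
    ultimately show ?thesis
      by (intro bexI[of _ "nat \<lceil>real N * x\<rceil>"]) (simp_all only: grid_interval_def greaterThanAtMost_iff atLeastAtMost_iff less_imp_le)
  qed
  have sub1: "{(real i - 1) / real N .. real i / real N} \<subseteq> {0..1}" if "i \<in> {1..N}" for i
  proof -
    have "0 \<le> (real i - 1) / real N" "real i / real N \<le> 1" using that N by auto
    then show ?thesis by fastforce
  qed
  show "p tagged_division_of ({0..1} \<times> {0..1})"
  proof (rule tagged_division_ofI)
    show "finite p" by (simp add: p_def)
  next
    fix x K assume "(x, K) \<in> p"
    then obtain i j where ij: "i \<in> {1..N}" "j \<in> {1..N}" "x = \<tau> (i, j)" "K = grid_cell N (i, j)"
      by (auto simp: p_def)
    show "x \<in> K" using \<tau> ij by auto
    show "K \<subseteq> {0..1} \<times> {0..1}"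
      unfolding ij(4) grid_cell_def prod.case using sub1 ij by (intro Sigma_mono) auto
    show "\<exists>a b. K = cbox a b" using ij cell by blast
  next
    fix x1 K1 x2 K2
    assume "(x1, K1) \<in> p" "(x2, K2) \<in> p" and ne: "(x1, K1) \<noteq> (x2, K2)"
    then obtain c1 c2 where "(x1, K1) = (\<tau> c1, grid_cell N c1)" "(x2, K2) = (\<tau> c2, grid_cell N c2)"
      unfolding p_def by blast
    then show "interior K1 \<inter> interior K2 = {}" using disj[of c1 c2] ne by auto
  next
    have "{K. \<exists>x. (x, K) \<in> p} = grid_cell N ` ({1..N} \<times> {1..N})"
      unfolding p_def by blast
    then have "\<Union> {K. \<exists>x. (x, K) \<in> p} = (\<Union>c\<in>{1..N} \<times> {1..N}. grid_cell N c)"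
      by (simp only:)
    also have "\<dots> = {0..1} \<times> {0..1}"
    proof
      show "(\<Union>c\<in>{1..N} \<times> {1..N}. grid_cell N c) \<subseteq> {0..1} \<times> {0..1}"
      proof (rule UN_least)
        fix c assume "c \<in> {1..N} \<times> {1..N}"
        then obtain i j where "c = (i, j)" "i \<in> {1..N}" "j \<in> {1..N}" by auto
        then show "grid_cell N c \<subseteq> {0..1} \<times> {0..1}"
          using sub1 by (simp only: grid_cell_def prod.case) (intro Sigma_mono; blast)
      qed
    next
      show "{0..1} \<times> {0..1} \<subseteq> (\<Union>c\<in>{1..N} \<times> {1..N}. grid_cell N c)"
      proof
        fix q :: "real \<times> real" assume q: "q \<in> {0..1} \<times> {0..1}"
        then obtain i j where "i \<in> {1..N}" "j \<in> {1..N}"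
          "fst q \<in> {(real i - 1) / real N .. real i / real N}"
          "snd q \<in> {(real j - 1) / real N .. real j / real N}"
          using union1[of "fst q"] union1[of "snd q"] by (auto simp: mem_Times_iff)
        then have "q \<in> grid_cell N (i, j)" "(i, j) \<in> {1..N} \<times> {1..N}"
          by (auto simp: grid_cell_def mem_Times_iff)
        then show "q \<in> (\<Union>c\<in>{1..N} \<times> {1..N}. grid_cell N c)" by blast
      qed
    qed
    finally show "\<Union> {K. \<exists>x. (x, K) \<in> p} = {0..1} \<times> {0..1}" .
  qed
  show "\<forall>(x, K)\<in>p. diameter K \<le> 2 / real N"
  proof safe
    fix x y K assume "((x, y), K) \<in> p"
    then obtain i j where K: "K = grid_cell N (i, j)" by (auto simp: p_def)
    show "diameter K \<le> 2 / real N"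
    proof (rule diameter_le)
      fix q r assume qr: "q \<in> K" "r \<in> K"
      have "\<bar>fst q - fst r\<bar> \<le> 1 / real N" "\<bar>snd q - snd r\<bar> \<le> 1 / real N"
        using qr N by (auto simp: K grid_cell_def diff_divide_distrib abs_le_iff)
      moreover have "norm (q - r) \<le> norm (fst (q - r)) + norm (snd (q - r))"
        using norm_Pair_le[of "fst (q - r)" "snd (q - r)"] by (simp only: prod.collapse)
      ultimately show "norm (q - r) \<le> 2 / real N" by simp
    qed simp
  qed
  have "(\<Sum>(x, K)\<in>p. measure lborel K * f x) = (\<Sum>c\<in>{1..N} \<times> {1..N}. measure lborel (grid_cell N c) * f (\<tau> c))"
    unfolding p_def by (subst sum.reindex[OF inj]) simp
  also have "\<dots> = (\<Sum>c\<in>{1..N} \<times> {1..N}. 1 / (real N)\<^sup>2 * f (\<tau> c))"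
  proof (rule sum.cong)
    fix c assume "c \<in> {1..N} \<times> {1..N}"
    obtain i j where c: "c = (i, j)" by (cases c)
    have "measure lborel (grid_cell N c) = 1 / (real N)\<^sup>2"
      unfolding c cell using N
      by (subst content_Pair) (simp add: power2_eq_square field_simps)
    then show "measure lborel (grid_cell N c) * f (\<tau> c) = 1 / (real N)\<^sup>2 * f (\<tau> c)" by simp
  qed simp
  also have "\<dots> = (\<Sum>c\<in>{1..N} \<times> {1..N}. f (\<tau> c)) / (real N)\<^sup>2"
    by (simp add: sum_divide_distrib)
  finally show "(\<Sum>(x, K)\<in>p. measure lborel K * f x) = (\<Sum>c\<in>{1..N} \<times> {1..N}. f (\<tau> c)) / (real N)\<^sup>2" .
qed

text \<open>The Darboux criterion in a form without suprema: two choices of tags on the same fine grid give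
nearly the same Riemann sum. As the tags in different cells can be chosen independently, this controls the
sum of the oscillations.\<close>

lemma riemann_integrable_grid_sums:
  assumes "f riemann_integrable_on ({0..1} \<times> {0..1})" and e: "e > 0"
  shows "\<forall>\<^sub>F N in sequentially. \<forall>\<tau> \<tau>'. (\<forall>c\<in>{1..N} \<times> {1..N}. \<tau> c \<in> grid_cell N c \<and> \<tau>' c \<in> grid_cell N c) \<longrightarrow>
    (\<Sum>c\<in>{1..N} \<times> {1..N}. f (\<tau> c) - f (\<tau>' c)) / (real N)\<^sup>2 < e"
proof -
  obtain I where "\<And>e. e > 0 \<Longrightarrow> \<exists>d>0. \<forall>p. p tagged_division_of ({0..1} \<times> {0..1}) \<and> (\<forall>(x, K)\<in>p. diameter K < d) \<longrightarrow>
        \<bar>(\<Sum>(x, K)\<in>p. measure lborel K * f x) - I\<bar> < e"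
    using assms(1) unfolding riemann_integrable_on_def by blast
  from this[of "e / 2"] obtain d where d: "d > 0"
    and close: "\<And>p. p tagged_division_of ({0..1} \<times> {0..1}) \<Longrightarrow> (\<forall>(x, K)\<in>p. diameter K < d) \<Longrightarrow>
        \<bar>(\<Sum>(x, K)\<in>p. measure lborel K * f x) - I\<bar> < e / 2"
    using e by auto
  have "\<forall>\<^sub>F N in sequentially. 2 / real N < d"
    using d by real_asymp
  then show ?thesis
    using eventually_ge_at_top[of "1::nat"]
  proof eventually_elim
    case (elim N)
    have *: "\<bar>(\<Sum>c\<in>{1..N} \<times> {1..N}. f (\<tau> c)) / (real N)\<^sup>2 - I\<bar> < e / 2"
      if t: "\<And>c. c \<in> {1..N} \<times> {1..N} \<Longrightarrow> \<tau> c \<in> grid_cell N c" for \<tau>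
    proof -
      note g = grid_tagged_division[OF elim(2) t]
      have "\<forall>(x, K)\<in>(\<lambda>c. (\<tau> c, grid_cell N c)) ` ({1..N} \<times> {1..N}). diameter K < d"
        using g(2) elim(1) by (auto intro: order.strict_trans1)
      then show ?thesis using close[OF g(1)] g(3)[of f] by simp
    qed
    show ?case
    proof safe
      fix \<tau> \<tau>' :: "nat \<times> nat \<Rightarrow> real \<times> real"
      assume t: "\<forall>c\<in>{1..N} \<times> {1..N}. \<tau> c \<in> grid_cell N c \<and> \<tau>' c \<in> grid_cell N c"
      have "(\<Sum>c\<in>{1..N} \<times> {1..N}. f (\<tau> c) - f (\<tau>' c)) / (real N)\<^sup>2
        = (\<Sum>c\<in>{1..N} \<times> {1..N}. f (\<tau> c)) / (real N)\<^sup>2 - (\<Sum>c\<in>{1..N} \<times> {1..N}. f (\<tau>' c)) / (real N)\<^sup>2"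
        by (simp add: sum_subtractf diff_divide_distrib)
      moreover have "\<bar>(\<Sum>c\<in>{1..N} \<times> {1..N}. f (\<tau> c)) / (real N)\<^sup>2 - I\<bar> < e / 2"
        and "\<bar>(\<Sum>c\<in>{1..N} \<times> {1..N}. f (\<tau>' c)) / (real N)\<^sup>2 - I\<bar> < e / 2"
        using t by (intro *; blast)+
      ultimately show "(\<Sum>c\<in>{1..N} \<times> {1..N}. f (\<tau> c) - f (\<tau>' c)) / (real N)\<^sup>2 < e" by linarith
    qed
  qed
qed

section \<open>Cell averages of a graphon\<close>

text \<open>Lebesgue measurability on the square does not pass to all sections, so that Fubini's theorem is
applied to a Borel function that agrees with \<open>W\<close> almost everywhere. It is cut off outside
\<open>(0, 1]\<^sup>2\<close>, the union of the half-open cells.\<close>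

definition borel_version :: "(real \<Rightarrow> real \<Rightarrow> real) \<Rightarrow> (real \<times> real \<Rightarrow> real) \<Rightarrow> bool" where
  "borel_version W V \<longleftrightarrow> V \<in> borel_measurable borel \<and> (\<forall>p. 0 \<le> V p \<and> V p \<le> 1) \<and>
     (\<forall>p. p \<notin> {0<..1} \<times> {0<..1} \<longrightarrow> V p = 0) \<and>
     (AE p in lborel. p \<in> {0<..1} \<times> {0<..1} \<longrightarrow> W (fst p) (snd p) = V p)"

lemma ex_borel_version:
  assumes W: "graphon W"
  shows "\<exists>V. borel_version W V"
proof -
  have S: "{0..1} \<times> {0..1} \<in> sets (borel :: (real \<times> real) measure)"
    by (intro borel_closed closed_Times) auto
  have "(\<lambda>p. indicator ({0..1} \<times> {0..1}) p *\<^sub>R (\<lambda>(x, y). W x y) p) \<in> borel_measurable lebesgue"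
    using W S unfolding graphon_def
    by (subst borel_measurable_restrict_space_iff[symmetric]) (auto simp: sets_completionI_sets)
  then obtain g :: "real \<times> real \<Rightarrow> real" where g: "g \<in> borel_measurable lborel"
    and ae: "AE p in lborel. indicator ({0..1} \<times> {0..1}) p *\<^sub>R (\<lambda>(x, y). W x y) p = g p"
    using completion_ex_borel_measurable_real by blast
  define V where "V = (\<lambda>p. indicator ({0<..1} \<times> {0<..1}) p * max 0 (min 1 (g p)))"
  have [measurable]: "g \<in> borel_measurable borel" using g by simp
  have "{0<..1} \<times> {0<..1} \<in> sets (borel \<Otimes>\<^sub>M borel :: (real \<times> real) measure)"
    by simp
  then have [measurable]: "{0<..1} \<times> {0<..1} \<in> sets (borel :: (real \<times> real) measure)"
    by (simp only: borel_prod)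
  have "V \<in> borel_measurable borel"
    unfolding V_def by measurable
  moreover have "AE p in lborel. p \<in> {0<..1} \<times> {0<..1} \<longrightarrow> W (fst p) (snd p) = V p"
    using ae
  proof eventually_elim
    case (elim p)
    show ?case
    proof
      assume p: "p \<in> {0<..1} \<times> {0<..1}"
      then have "p \<in> {0..1} \<times> {0..1}" by auto
      then have "g p = W (fst p) (snd p)" using elim by (simp add: split_beta)
      moreover have "W (fst p) (snd p) \<in> {0..1}"
        using W p unfolding graphon_def by (auto simp: mem_Times_iff)
      ultimately show "W (fst p) (snd p) = V p" using p by (simp add: V_def)
    qed
  qed
  ultimately have "borel_version W V"
    by (auto simp: borel_version_def V_def indicator_def)
  then show ?thesis by blast
qed

abbreviation cell_ind :: "nat \<Rightarrow> nat \<Rightarrow> nat \<Rightarrow> real \<times> real \<Rightarrow> real" where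
  "cell_ind N i j p \<equiv> indicator (grid_interval N i) (fst p) * indicator (grid_interval N j) (snd p)"

definition cell_mass :: "(real \<times> real \<Rightarrow> real) \<Rightarrow> nat \<Rightarrow> nat \<times> nat \<Rightarrow> real" where
  "cell_mass V N = (\<lambda>(i, j). LINT p|lborel. V p *
     cell_ind N i j p)"

lemma grid_interval_borel [measurable, simp]: "grid_interval N i \<in> sets borel"
  by (simp add: grid_interval_def)

lemma emeasure_grid_interval: "N \<ge> 1 \<Longrightarrow> emeasure lborel (grid_interval N i) = ennreal (1 / real N)"
  by (simp add: grid_interval_def field_simps)

lemma cell_indicator:
  assumes N: "N \<ge> 1"
  shows "integrable lborel (\<lambda>p. cell_ind N i j p)"
    and "(LINT p|lborel. cell_ind N i j p) = 1 / (real N)\<^sup>2"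
proof -
  let ?R = "grid_interval N i \<times> grid_interval N j"
  have R: "?R \<in> sets (lborel \<Otimes>\<^sub>M lborel)" by simp
  have e: "emeasure (lborel \<Otimes>\<^sub>M lborel) ?R = ennreal (1 / (real N)\<^sup>2)"
    using N by (subst lborel.emeasure_pair_measure_Times)
      (simp_all add: emeasure_grid_interval ennreal_mult[symmetric] power2_eq_square)
  have eq: "(\<lambda>p. cell_ind N i j p) = indicator ?R"
    by (auto simp: fun_eq_iff indicator_def)
  show "integrable lborel (\<lambda>p. cell_ind N i j p)"
    unfolding eq lborel_prod[symmetric] using R e by (simp add: integrable_indicator_iff)
  show "(LINT p|lborel. cell_ind N i j p) = 1 / (real N)\<^sup>2"
    unfolding eq lborel_prod[symmetric] using R e by (simp add: measure_def)
qed

lemma cell_integrable: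
  assumes N: "N \<ge> 1" and V: "borel_version W V"
  shows "integrable lborel (\<lambda>p. V p * cell_ind N i j p)"
proof (rule Bochner_Integration.integrable_bound[OF cell_indicator(1)[OF N, of i j]])
  have [measurable]: "V \<in> borel_measurable borel" using V by (simp add: borel_version_def)
  have [measurable]: "V \<in> borel_measurable (borel \<Otimes>\<^sub>M borel)" by (simp add: borel_prod)
  show "(\<lambda>p. V p * cell_ind N i j p) \<in> borel_measurable lborel"
    unfolding lborel_prod[symmetric] by measurable
  show "AE p in lborel. norm (V p * cell_ind N i j p)
      \<le> norm (cell_ind N i j p)"
    using V by (intro AE_I2) (auto simp: borel_version_def indicator_def)
qed

lemma cell_AE:
  assumes N: "N \<ge> 1" and V: "borel_version W V" and ij: "i \<in> {1..N}" "j \<in> {1..N}"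
  shows "AE p in lborel. fst p \<in> grid_interval N i \<and> snd p \<in> grid_interval N j \<longrightarrow>
    V p = W (fst p) (snd p) \<and> p \<in> grid_cell N (i, j)"
proof -
  have "AE p in lborel. p \<in> {0<..1} \<times> {0<..1} \<longrightarrow> W (fst p) (snd p) = V p"
    using V by (simp add: borel_version_def)
  then show ?thesis
  proof eventually_elim
    case (elim p)
    show ?case
    proof
      assume p: "fst p \<in> grid_interval N i \<and> snd p \<in> grid_interval N j"
      then have "p \<in> {0<..1} \<times> {0<..1}"
        using grid_interval_subset[OF N ij(1)] grid_interval_subset[OF N ij(2)] by (auto simp: mem_Times_iff)
      moreover have "p \<in> grid_cell N (i, j)"
        using p by (auto simp: grid_cell_def grid_interval_def mem_Times_iff)
      ultimately show "V p = W (fst p) (snd p) \<and> p \<in> grid_cell N (i, j)" using elim by simp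
    qed
  qed
qed

lemma cell_mass_bounds:
  assumes N: "N \<ge> 1" and V: "borel_version W V" and ij: "i \<in> {1..N}" "j \<in> {1..N}"
  shows "(\<And>p. p \<in> grid_cell N (i, j) \<Longrightarrow> W (fst p) (snd p) \<le> K) \<Longrightarrow> cell_mass V N (i, j) \<le> K / (real N)\<^sup>2"
    and "(\<And>p. p \<in> grid_cell N (i, j) \<Longrightarrow> K \<le> W (fst p) (snd p)) \<Longrightarrow> K / (real N)\<^sup>2 \<le> cell_mass V N (i, j)"
proof -
  let ?I = "\<lambda>p. cell_ind N i j p"
  have K: "integrable lborel (\<lambda>p. K * ?I p)" "(LINT p|lborel. K * ?I p) = K / (real N)\<^sup>2"
    using cell_indicator[OF N, of i j] by (simp_all only: integrable_mult_right integral_mult_right_zero) simp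
  show "cell_mass V N (i, j) \<le> K / (real N)\<^sup>2" if le: "\<And>p. p \<in> grid_cell N (i, j) \<Longrightarrow> W (fst p) (snd p) \<le> K"
  proof -
    have "AE p in lborel. V p * ?I p \<le> K * ?I p"
      using cell_AE[OF assms] by eventually_elim (use le in \<open>auto simp: indicator_def\<close>)
    then show ?thesis unfolding cell_mass_def prod.case K(2)[symmetric]
      using cell_integrable[OF N V] K(1) by (intro integral_mono_AE)
  qed
  show "K / (real N)\<^sup>2 \<le> cell_mass V N (i, j)" if le: "\<And>p. p \<in> grid_cell N (i, j) \<Longrightarrow> K \<le> W (fst p) (snd p)"
  proof -
    have "AE p in lborel. K * ?I p \<le> V p * ?I p"
      using cell_AE[OF assms] by eventually_elim (use le in \<open>auto simp: indicator_def\<close>)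
    then show ?thesis unfolding cell_mass_def prod.case K(2)[symmetric]
      using cell_integrable[OF N V] K(1) by (intro integral_mono_AE)
  qed
qed

lemma AE_fst_snd_nonzero: "AE p in (lborel :: (real \<times> real) measure). fst p \<noteq> 0 \<and> snd p \<noteq> 0"
proof -
  have "AE p in (lborel \<Otimes>\<^sub>M lborel :: (real \<times> real) measure). fst p \<noteq> 0 \<and> snd p \<noteq> 0"
  proof (rule lborel_pair.AE_pair_measure)
    show "{p \<in> space (lborel \<Otimes>\<^sub>M lborel :: (real \<times> real) measure). fst p \<noteq> 0 \<and> snd p \<noteq> 0}
        \<in> sets (lborel \<Otimes>\<^sub>M lborel)" by measurable
    have "AE x in lborel. AE y in lborel. x \<noteq> (0::real) \<and> y \<noteq> (0::real)"
      using AE_lborel_singleton[of "0::real"]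
    proof eventually_elim
      case (elim x)
      show ?case using AE_lborel_singleton[of "0::real"] by eventually_elim (use elim in simp)
    qed
    then show "AE x in lborel. AE y in lborel. fst (x, y) \<noteq> (0::real) \<and> snd (x, y) \<noteq> (0::real)" by simp
  qed
  then show ?thesis by (simp only: lborel_prod)
qed

lemma sum_cell_mass:
  assumes N: "N \<ge> 1" and V: "borel_version W V"
  shows "(\<Sum>c\<in>{1..N} \<times> {1..N}. cell_mass V N c) = graphon_integral W"
proof -
  let ?I = "\<lambda>i j p. cell_ind N i j p"
  have S: "{0..1} \<times> {0..1} \<in> sets (borel :: (real \<times> real) measure)"
    by (intro borel_closed closed_Times) auto
  have V0: "V p = 0" if "p \<notin> {0<..1} \<times> {0<..1}" for p
    using V that unfolding borel_version_def by blast
  have "graphon_integral W = (LINT p|lebesgue. indicator ({0..1} \<times> {0..1}) p *\<^sub>R W (fst p) (snd p))"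
    unfolding graphon_integral_def using S by (subst integral_restrict_space) (simp_all add: sets_completionI_sets)
  also have "\<dots> = (LINT p|lborel. V p)"
  proof (rule integral_lebesgue_AE)
    show "V \<in> borel_measurable borel" using V by (simp add: borel_version_def)
    have "AE p in lborel. p \<in> {0<..1} \<times> {0<..1} \<longrightarrow> W (fst p) (snd p) = V p"
      using V by (simp add: borel_version_def)
    then show "AE p in lborel. indicator ({0..1} \<times> {0..1}) p *\<^sub>R W (fst p) (snd p) = V p"
      using AE_fst_snd_nonzero
    proof eventually_elim
      case (elim p)
      have "p \<in> {0..1} \<times> {0..1} \<longleftrightarrow> p \<in> {0<..1} \<times> {0<..1}"
        using elim(2) by (cases p) auto
      then show ?case using elim(1) V0[of p] by (auto simp: indicator_def)
    qed
  qed
  also have "\<dots> = (LINT p|lborel. (\<Sum>c\<in>{1..N} \<times> {1..N}. V p * ?I (fst c) (snd c) p))"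
  proof (rule Bochner_Integration.integral_cong)
    fix p :: "real \<times> real"
    have "(\<Sum>c\<in>{1..N} \<times> {1..N}. V p * ?I (fst c) (snd c) p)
      = V p * (\<Sum>i=1..N. \<Sum>j=1..N. ?I i j p)"
      by (simp only: sum_distrib_left sum.cartesian_product split_beta)
    also have "(\<Sum>i=1..N. \<Sum>j=1..N. ?I i j p) =
      (\<Sum>i=1..N. 1 * indicator (grid_interval N i) (fst p)) * (\<Sum>j=1..N. 1 * indicator (grid_interval N j) (snd p))"
      by (simp add: sum_product)
    also have "V p * \<dots> = V p"
      unfolding sum_indicator_grid[OF N] using V0[of p] by (cases p) auto
    finally show "V p = (\<Sum>c\<in>{1..N} \<times> {1..N}. V p * ?I (fst c) (snd c) p)" by simp
  qed simp
  also have "\<dots> = (\<Sum>c\<in>{1..N} \<times> {1..N}. LINT p|lborel. V p * ?I (fst c) (snd c) p)"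
    by (intro Bochner_Integration.integral_sum cell_integrable[OF N V])
  also have "\<dots> = (\<Sum>c\<in>{1..N} \<times> {1..N}. cell_mass V N c)"
    by (simp add: cell_mass_def split_beta)
  finally show ?thesis by simp
qed

lemma grid_corner: "N \<ge> 1 \<Longrightarrow> (real i / real N, real j / real N) \<in> grid_cell N (i, j)"
  by (auto simp: grid_cell_def divide_right_mono)

text \<open>In each cell some value of \<open>W\<close> lies on the far side of the cell average as seen from the value at
the corner, up to a small error. So the distance from the corner value to the average is bounded by
a difference of two values of \<open>W\<close> in that cell, and these differences are summed by comparing two
choices of tags.\<close>

lemma cell_mass_close:
  assumes V: "borel_version W V"
    and R: "(\<lambda>(x, y). W x y) riemann_integrable_on ({0..1} \<times> {0..1})"
  shows "(\<lambda>N. \<Sum>i=1..N. \<Sum>j=1..N. \<bar>W (real i / real N) (real j / real N) / (real N)\<^sup>2 - cell_mass V N (i, j)\<bar>) \<longlonglongrightarrow> 0"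
proof (rule order_tendstoI)
  fix e :: real assume e: "0 < e"
  show "\<forall>\<^sub>F N in sequentially. (\<Sum>i=1..N. \<Sum>j=1..N. \<bar>W (real i / real N) (real j / real N) / (real N)\<^sup>2 - cell_mass V N (i, j)\<bar>) < e"
    using riemann_integrable_grid_sums[OF R half_gt_zero[OF e]] eventually_ge_at_top[of "1::nat"]
  proof eventually_elim
    case (elim N)
    note N = elim(2)
    define f where "f = (\<lambda>p. W (fst p) (snd p))"
    define q where "q = (\<lambda>c :: nat \<times> nat. (real (fst c) / real N, real (snd c) / real N))"
    have q: "q c \<in> grid_cell N c" for c unfolding q_def using grid_corner[OF N, of "fst c" "snd c"] by simp
    have "\<exists>p\<in>grid_cell N c. \<bar>f (q c) - (real N)\<^sup>2 * cell_mass V N c\<bar> \<le> \<bar>f (q c) - f p\<bar> + e / 2"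
      if c: "c \<in> {1..N} \<times> {1..N}" for c
    proof -
      obtain i j where ij: "c = (i, j)" "i \<in> {1..N}" "j \<in> {1..N}" using c by auto
      let ?m = "(real N)\<^sup>2 * cell_mass V N c"
      have "\<exists>p\<in>grid_cell N c. f p < ?m + e / 2"
      proof (rule ccontr)
        assume "\<not> ?thesis"
        then have "\<And>p. p \<in> grid_cell N c \<Longrightarrow> ?m + e / 2 \<le> f p" by force
        then have "(?m + e / 2) / (real N)\<^sup>2 \<le> cell_mass V N c"
          unfolding ij f_def by (intro cell_mass_bounds[OF N V ij(2,3)]) simp
        then show False using N e by (simp add: field_simps)
      qed
      moreover have "\<exists>p\<in>grid_cell N c. ?m - e / 2 < f p"
      proof (rule ccontr)
        assume "\<not> ?thesis"
        then have "\<And>p. p \<in> grid_cell N c \<Longrightarrow> f p \<le> ?m - e / 2" by force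
        then have "cell_mass V N c \<le> (?m - e / 2) / (real N)\<^sup>2"
          unfolding ij f_def by (intro cell_mass_bounds[OF N V ij(2,3)]) simp
        then show False using N e by (simp add: field_simps)
      qed
      ultimately obtain p p' where "p \<in> grid_cell N c" "f p < ?m + e / 2" "p' \<in> grid_cell N c" "?m - e / 2 < f p'"
        by blast
      then show ?thesis
        by (cases "f (q c) \<ge> ?m") (force intro!: bexI[of _ p] | force intro!: bexI[of _ p'])+
    qed
    then obtain \<tau> where \<tau>: "\<And>c. c \<in> {1..N} \<times> {1..N} \<Longrightarrow> \<tau> c \<in> grid_cell N c"
      "\<And>c. c \<in> {1..N} \<times> {1..N} \<Longrightarrow> \<bar>f (q c) - (real N)\<^sup>2 * cell_mass V N c\<bar> \<le> \<bar>f (q c) - f (\<tau> c)\<bar> + e / 2"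
      by metis
    \<comment> \<open>ordering the two tags in every cell removes the absolute values\<close>
    define hi where "hi = (\<lambda>c. if f (q c) \<ge> f (\<tau> c) then q c else \<tau> c)"
    define lo where "lo = (\<lambda>c. if f (q c) \<ge> f (\<tau> c) then \<tau> c else q c)"
    have "(\<Sum>i=1..N. \<Sum>j=1..N. \<bar>W (real i / real N) (real j / real N) / (real N)\<^sup>2 - cell_mass V N (i, j)\<bar>)
      = (\<Sum>c\<in>{1..N} \<times> {1..N}. \<bar>f (q c) / (real N)\<^sup>2 - cell_mass V N c\<bar>)"
      by (simp add: sum.cartesian_product split_beta f_def q_def)
    also have "\<dots> = (\<Sum>c\<in>{1..N} \<times> {1..N}. \<bar>f (q c) - (real N)\<^sup>2 * cell_mass V N c\<bar> / (real N)\<^sup>2)"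
    proof (rule sum.cong)
      fix c
      have "f (q c) / (real N)\<^sup>2 - cell_mass V N c = (f (q c) - (real N)\<^sup>2 * cell_mass V N c) / (real N)\<^sup>2"
        using N by (simp add: field_simps)
      then show "\<bar>f (q c) / (real N)\<^sup>2 - cell_mass V N c\<bar> = \<bar>f (q c) - (real N)\<^sup>2 * cell_mass V N c\<bar> / (real N)\<^sup>2"
        by simp
    qed simp
    also have "\<dots> \<le> (\<Sum>c\<in>{1..N} \<times> {1..N}. (f (hi c) - f (lo c) + e / 2) / (real N)\<^sup>2)"
    proof (intro sum_mono divide_right_mono)
      fix c assume "c \<in> {1..N} \<times> {1..N}"
      from \<tau>(2)[OF this] show "\<bar>f (q c) - (real N)\<^sup>2 * cell_mass V N c\<bar> \<le> f (hi c) - f (lo c) + e / 2"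
        by (auto simp: hi_def lo_def)
    qed simp
    also have "\<dots> = (\<Sum>c\<in>{1..N} \<times> {1..N}. f (hi c) - f (lo c)) / (real N)\<^sup>2 + e / 2"
      using N by (simp add: sum_divide_distrib[symmetric] sum.distrib add_divide_distrib power2_eq_square)
    also have "(\<Sum>c\<in>{1..N} \<times> {1..N}. f (hi c) - f (lo c)) / (real N)\<^sup>2 < e / 2"
    proof -
      have "\<forall>c\<in>{1..N} \<times> {1..N}. hi c \<in> grid_cell N c \<and> lo c \<in> grid_cell N c"
        using q \<tau>(1) by (simp add: hi_def lo_def)
      from elim(1)[rule_format, OF this[rule_format]] show ?thesis by (simp add: f_def split_beta)
    qed
    finally show ?case by simp
  qed
next
  fix e :: real assume e: "e < 0"
  have "0 \<le> (\<Sum>i=1..N. \<Sum>j=1..N. \<bar>W (real i / real N) (real j / real N) / (real N)\<^sup>2 - cell_mass V N (i, j)\<bar>)" for N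
    by (intro sum_nonneg) simp
  then show "\<forall>\<^sub>F N in sequentially. e < (\<Sum>i=1..N. \<Sum>j=1..N. \<bar>W (real i / real N) (real j / real N) / (real N)\<^sup>2 - cell_mass V N (i, j)\<bar>)"
    using e by (intro always_eventually) (meson order.strict_trans2)
qed

section \<open>The grid matrix and the graphon operator\<close>

text \<open>This bound makes the supremum in the definition of the operator norm a supremum of a bounded set.
It follows from \<open>\<bar>f\<bar> \<le> (1 + f\<^sup>2) / 2\<close>.\<close>

lemma graphon_operator_bounded:
  assumes W: "graphon W" and f: "f \<in> L2" "L2_norm f \<le> 1" and x: "x \<in> {0..1}"
  shows "\<bar>graphon_operator W f x\<bar> \<le> 1"
proof (cases "integrable (lebesgue_on {0..1}) (\<lambda>y. W x y * f y)")
  case True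
  have f2: "integrable (lebesgue_on {0..1}) (\<lambda>y. (f y)\<^sup>2)" using f by (simp add: L2_def)
  have one: "integrable (lebesgue_on {0..1::real}) (\<lambda>y. 1 :: real)" "(LINT y|lebesgue_on {0..1::real}. 1 :: real) = 1"
    by (simp_all add: measure_restrict_space)
  have sq: "(LINT y|lebesgue_on {0..1}. (f y)\<^sup>2) \<le> 1"
    using f(2) by (simp add: L2_norm_def)
  have "\<bar>graphon_operator W f x\<bar> \<le> (LINT y|lebesgue_on {0..1}. \<bar>W x y * f y\<bar>)"
    unfolding graphon_operator_def by (rule integral_abs_bound)
  also have "\<dots> \<le> (LINT y|lebesgue_on {0..1}. (1 + (f y)\<^sup>2) / 2)"
  proof (rule integral_mono)
    fix y assume "y \<in> space (lebesgue_on {0..1::real})"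
    then have y: "y \<in> {0..1}" by simp
    have "W x y \<in> {0..1}" using W x y by (simp add: graphon_def)
    then have "\<bar>W x y * f y\<bar> \<le> \<bar>f y\<bar>" by (simp add: abs_mult mult_left_le_one_le)
    also have "\<bar>f y\<bar> \<le> (1 + (f y)\<^sup>2) / 2"
      using zero_le_power2[of "\<bar>f y\<bar> - 1"] by (simp add: power2_diff)
    finally show "\<bar>W x y * f y\<bar> \<le> (1 + (f y)\<^sup>2) / 2" .
  qed (use True f2 one in auto)
  also have "\<dots> = (1 + (LINT y|lebesgue_on {0..1}. (f y)\<^sup>2)) / 2"
    using f2 one by (simp add: Bochner_Integration.integral_add)
  finally show ?thesis using sq by simp
next
  case False
  then show ?thesis by (simp add: graphon_operator_def not_integrable_integral_eq)
qed

lemma L2_norm_graphon_operator_le_op_norm: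
  assumes W: "graphon W" and f: "f \<in> L2" "L2_norm f \<le> 1"
  shows "L2_norm (graphon_operator W f) \<le> op_norm W"
  unfolding op_norm_def
proof (rule cSUP_upper)
  have "L2_norm (graphon_operator W f) \<le> 1" if f: "f \<in> L2" "L2_norm f \<le> 1" for f
  proof -
    have "(LINT x|lebesgue_on {0..1}. (graphon_operator W f x)\<^sup>2) \<le> 1"
    proof (cases "integrable (lebesgue_on {0..1}) (\<lambda>x. (graphon_operator W f x)\<^sup>2)")
      case True
      have "(LINT x|lebesgue_on {0..1}. (graphon_operator W f x)\<^sup>2) \<le> (LINT x|lebesgue_on {0..1::real}. 1)"
        using graphon_operator_bounded[OF W f] True
        by (intro integral_mono) (auto simp: abs_square_le_1)
      then show ?thesis by (simp add: measure_restrict_space)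
    qed (simp add: not_integrable_integral_eq)
    then show ?thesis by (simp add: L2_norm_def)
  qed
  then show "bdd_above ((\<lambda>f. L2_norm (graphon_operator W f)) ` {f \<in> L2. L2_norm f \<le> 1})"
    by (intro bdd_aboveI2[of _ _ 1]) auto
qed (use f in auto)

text \<open>The factor \<open>\<surd>N\<close> makes the embedding of vectors into square-integrable functions isometric.\<close>

definition grid_step :: "nat \<Rightarrow> (nat \<Rightarrow> real) \<Rightarrow> real \<Rightarrow> real" where
  "grid_step N v y = sqrt (real N) * (\<Sum>j=1..N. v j * indicator (grid_interval N j) y)"

lemma grid_step_measurable [measurable]: "grid_step N v \<in> borel_measurable borel"
  unfolding grid_step_def by measurable

lemma grid_step_outside: "N \<ge> 1 \<Longrightarrow> y \<notin> {0<..1} \<Longrightarrow> grid_step N v y = 0"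
  unfolding grid_step_def by (subst sum_indicator_grid) auto

lemma abs_grid_step_le: "\<bar>grid_step N v y\<bar> \<le> sqrt (real N) * (\<Sum>j=1..N. \<bar>v j\<bar>)"
proof -
  have "\<bar>\<Sum>j=1..N. v j * indicator (grid_interval N j) y\<bar> \<le> (\<Sum>j=1..N. \<bar>v j\<bar>)"
    by (rule order_trans[OF sum_abs]) (auto intro!: sum_mono simp: indicator_def)
  then show ?thesis by (simp add: grid_step_def abs_mult mult_left_mono)
qed

lemma integral_grid_step_square:
  assumes N: "N \<ge> 1"
  shows "integrable lborel (\<lambda>y. (grid_step N v y)\<^sup>2)"
    and "(LINT y|lborel. (grid_step N v y)\<^sup>2) = (L2_set v {1..N})\<^sup>2"
proof -
  have eq: "(grid_step N v y)\<^sup>2 = (\<Sum>j=1..N. (real N * (v j)\<^sup>2) * indicator (grid_interval N j) y)" for y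
    unfolding sum_indicator_grid[OF N] grid_step_def by (simp add: power_mult_distrib)
  have i: "integrable lborel (\<lambda>y. indicator (grid_interval N j) y :: real)" for j
    using N by (simp add: integrable_indicator_iff emeasure_grid_interval)
  show "integrable lborel (\<lambda>y. (grid_step N v y)\<^sup>2)"
    unfolding eq by (intro Bochner_Integration.integrable_sum integrable_mult_right i)
  have "(LINT y|lborel. (grid_step N v y)\<^sup>2) = (\<Sum>j=1..N. (real N * (v j)\<^sup>2) * (1 / real N))"
    unfolding eq using N i measure_grid_interval[OF N]
    by (subst Bochner_Integration.integral_sum) simp_all
  also have "\<dots> = (L2_set v {1..N})\<^sup>2"
    using N by (simp add: L2_set_def sum_nonneg)
  finally show "(LINT y|lborel. (grid_step N v y)\<^sup>2) = (L2_set v {1..N})\<^sup>2" .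
qed

lemma grid_step_L2:
  assumes N: "N \<ge> 1"
  shows "grid_step N v \<in> L2" and "L2_norm (grid_step N v) = L2_set v {1..N}"
proof -
  have ind: "indicator {0..1} y * (grid_step N v y)\<^sup>2 = (grid_step N v y)\<^sup>2" for y :: real
    using grid_step_outside[OF N, of y v] by (cases "y \<in> {0<..1}") (auto simp: indicator_def)
  have meas: "grid_step N v \<in> borel_measurable (lebesgue_on {0..1})"
    by (intro measurable_restrict_space1 measurable_completion) simp
  have "integrable lebesgue (\<lambda>y. (grid_step N v y)\<^sup>2)"
    using integral_grid_step_square[OF N] by (subst integrable_completion) auto
  then have "integrable (lebesgue_on {0..1}) (\<lambda>y. (grid_step N v y)\<^sup>2)"
    by (subst integrable_restrict_space) (simp_all add: ind)
  then show "grid_step N v \<in> L2" using meas by (simp add: L2_def)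
  have "(LINT y|lebesgue_on {0..1}. (grid_step N v y)\<^sup>2) = (LINT y|lebesgue. (grid_step N v y)\<^sup>2)"
    by (subst integral_restrict_space) (simp_all add: ind)
  also have "\<dots> = (L2_set v {1..N})\<^sup>2"
    using integral_grid_step_square[OF N] by (subst integral_completion) auto
  finally show "L2_norm (grid_step N v) = L2_set v {1..N}" by (simp add: L2_norm_def)
qed

definition borel_operator :: "(real \<times> real \<Rightarrow> real) \<Rightarrow> (real \<Rightarrow> real) \<Rightarrow> real \<Rightarrow> real" where
  "borel_operator V f x = (LINT y|lborel. V (x, y) * f y)"

lemma borel_version_measurable:
  assumes "borel_version W V"
  shows "V \<in> borel_measurable (borel \<Otimes>\<^sub>M borel)"
  using assms by (simp add: borel_version_def borel_prod)

text \<open>For almost every \<open>x\<close> the sections of \<open>W\<close> and of its Borel version at \<open>x\<close> agree almost everywhere,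
so both operators send a step function to the same function almost everywhere.\<close>

lemma L2_norm_graphon_operator_grid_step:
  assumes N: "N \<ge> 1" and V: "borel_version W V"
  shows "borel_operator V (grid_step N v) \<in> borel_measurable borel"
    and "(L2_norm (graphon_operator W (grid_step N v)))\<^sup>2 = (LINT x|lborel. (borel_operator V (grid_step N v) x)\<^sup>2)"
proof -
  note [measurable] = borel_version_measurable[OF V]
  show m: "borel_operator V (grid_step N v) \<in> borel_measurable borel"
    unfolding borel_operator_def by measurable
  have V0: "V p = 0" if "p \<notin> {0<..1} \<times> {0<..1}" for p
    using V that unfolding borel_version_def by blast
  have "AE p in lborel \<Otimes>\<^sub>M lborel. p \<in> {0<..1} \<times> {0<..1} \<longrightarrow> W (fst p) (snd p) = V p"
    using V unfolding borel_version_def lborel_prod by blast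
  from lborel_pair.AE_pair[OF this]
  have ae: "AE x in lborel. AE y in lborel. x \<in> {0<..1} \<and> y \<in> {0<..1} \<longrightarrow> W x y = V (x, y)"
    by simp
  have "(L2_norm (graphon_operator W (grid_step N v)))\<^sup>2 =
      (LINT x|lebesgue_on {0..1}. (graphon_operator W (grid_step N v) x)\<^sup>2)"
    by (simp add: L2_norm_def integral_nonneg_AE)
  also have "\<dots> = (LINT x|lebesgue. indicator {0..1} x *\<^sub>R (graphon_operator W (grid_step N v) x)\<^sup>2)"
    by (subst integral_restrict_space) simp_all
  also have "\<dots> = (LINT x|lborel. (borel_operator V (grid_step N v) x)\<^sup>2)"
  proof (rule integral_lebesgue_AE)
    show "(\<lambda>x. (borel_operator V (grid_step N v) x)\<^sup>2) \<in> borel_measurable borel"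
      using m by simp
    show "AE x in lborel. indicator {0..1} x *\<^sub>R (graphon_operator W (grid_step N v) x)\<^sup>2 =
        (borel_operator V (grid_step N v) x)\<^sup>2"
      using ae AE_lborel_singleton[of 0]
    proof eventually_elim
      case (elim x)
      show ?case
      proof (cases "x \<in> {0<..1}")
        case False
        then have "V (x, y) = 0" for y using V0 by auto
        then show ?thesis using False elim(2) by (simp add: borel_operator_def)
      next
        case True
        have "graphon_operator W (grid_step N v) x = (LINT y|lebesgue. indicator {0..1} y *\<^sub>R (W x y * grid_step N v y))"
          unfolding graphon_operator_def by (subst integral_restrict_space) simp_all
        also have "\<dots> = borel_operator V (grid_step N v) x"
          unfolding borel_operator_def
        proof (rule integral_lebesgue_AE)
          show "(\<lambda>y. V (x, y) * grid_step N v y) \<in> borel_measurable borel" by measurable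
          show "AE y in lborel. indicator {0..1} y *\<^sub>R (W x y * grid_step N v y) = V (x, y) * grid_step N v y"
            using elim(1)
          proof eventually_elim
            case (elim y)
            then show ?case using True grid_step_outside[OF N, of y v]
              by (cases "y \<in> {0<..1}") auto
          qed
        qed
        finally show ?thesis using True by simp
      qed
    qed
  qed
  finally show "(L2_norm (graphon_operator W (grid_step N v)))\<^sup>2 = (LINT x|lborel. (borel_operator V (grid_step N v) x)\<^sup>2)" .
qed

lemma borel_operator_grid_step_bounded:
  assumes N: "N \<ge> 1" and V: "borel_version W V"
  shows "\<bar>borel_operator V (grid_step N v) x\<bar> \<le> sqrt (real N) * (\<Sum>j=1..N. \<bar>v j\<bar>)"
    and "x \<notin> {0<..1} \<Longrightarrow> borel_operator V (grid_step N v) x = 0"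
proof -
  note [measurable] = borel_version_measurable[OF V]
  let ?B = "sqrt (real N) * (\<Sum>j=1..N. \<bar>v j\<bar>)"
  have B: "?B \<ge> 0" by (intro mult_nonneg_nonneg sum_nonneg) auto
  have i: "integrable lborel (\<lambda>y. ?B * indicator {0<..1::real} y)"
    by (intro integrable_mult_right) (simp add: integrable_indicator_iff)
  have "norm (LINT y|lborel. V (x, y) * grid_step N v y) \<le> (LINT y|lborel. ?B * indicator {0<..1::real} y)"
  proof (rule Bochner_Integration.integral_norm_bound_integral)
    have le: "norm (V (x, y) * grid_step N v y) \<le> ?B * indicator {0<..1::real} y" for y
    proof (cases "y \<in> {0<..1}")
      case True
      have "\<bar>V (x, y) * grid_step N v y\<bar> \<le> 1 * ?B"
        unfolding abs_mult using V abs_grid_step_le[of N v y] B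
        by (intro mult_mono) (auto simp: borel_version_def)
      then show ?thesis using True by simp
    qed (use grid_step_outside[OF N] in simp)
    then show "norm (V (x, y) * grid_step N v y) \<le> ?B * indicator {0<..1::real} y" for y .
    show "integrable lborel (\<lambda>y. V (x, y) * grid_step N v y)"
    proof (rule Bochner_Integration.integrable_bound[OF i])
      show "AE y in lborel. norm (V (x, y) * grid_step N v y) \<le> norm (?B * indicator {0<..1::real} y)"
        using le by (intro AE_I2) (metis abs_ge_self order_trans real_norm_def)
    qed measurable
  qed (rule i)
  then show "\<bar>borel_operator V (grid_step N v) x\<bar> \<le> ?B"
    by (simp add: borel_operator_def)
  assume "x \<notin> {0<..1}"
  then have "V (x, y) = 0" for y using V by (auto simp: borel_version_def)
  then show "borel_operator V (grid_step N v) x = 0" by (simp add: borel_operator_def)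
qed

lemma borel_operator_bilinear:
  assumes N: "N \<ge> 1" and V: "borel_version W V"
  shows "(LINT x|lborel. grid_step N u x * borel_operator V (grid_step N v) x)
    = real N * (\<Sum>i=1..N. \<Sum>j=1..N. u i * v j * cell_mass V N (i, j))"
proof -
  let ?I = "\<lambda>i j p. indicator (grid_interval N i) (fst p) * indicator (grid_interval N j) (snd p) :: real"
  have expand: "grid_step N u (fst p) * (V p * grid_step N v (snd p)) =
      (\<Sum>i=1..N. \<Sum>j=1..N. (real N * (u i * v j)) * (V p * ?I i j p))" for p
  proof -
    have "grid_step N u (fst p) * (V p * grid_step N v (snd p)) = real N * (V p *
        ((\<Sum>i=1..N. u i * indicator (grid_interval N i) (fst p)) * (\<Sum>j=1..N. v j * indicator (grid_interval N j) (snd p))))"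
      by (simp add: grid_step_def mult_ac)
    also have "\<dots> = (\<Sum>i=1..N. \<Sum>j=1..N. real N * (V p * ((u i * indicator (grid_interval N i) (fst p)) *
        (v j * indicator (grid_interval N j) (snd p)))))"
      by (subst sum_product) (simp only: sum_distrib_left)
    also have "\<dots> = (\<Sum>i=1..N. \<Sum>j=1..N. (real N * (u i * v j)) * (V p * ?I i j p))"
      by (intro sum.cong refl) (simp add: mult_ac)
    finally show ?thesis .
  qed
  have i: "integrable lborel (\<lambda>p. grid_step N u (fst p) * (V p * grid_step N v (snd p)))"
    unfolding expand using cell_integrable[OF N V]
    by (intro Bochner_Integration.integrable_sum integrable_mult_right)
  have "(LINT x|lborel. grid_step N u x * borel_operator V (grid_step N v) x)
    = (LINT x|lborel. LINT y|lborel. grid_step N u x * (V (x, y) * grid_step N v y))"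
    by (simp add: borel_operator_def)
  also have "\<dots> = (LINT p|lborel. grid_step N u (fst p) * (V p * grid_step N v (snd p)))"
    using i unfolding lborel_prod[symmetric]
    by (subst lborel_pair.integral_fst) (simp_all add: case_prod_beta')
  also have "\<dots> = (\<Sum>i=1..N. \<Sum>j=1..N. (real N * (u i * v j)) * cell_mass V N (i, j))"
    unfolding expand cell_mass_def prod.case using cell_integrable[OF N V]
    by (subst Bochner_Integration.integral_sum Bochner_Integration.integral_mult_right_zero | intro sum.cong refl Bochner_Integration.integrable_sum integrable_mult_right | simp)+
  also have "\<dots> = real N * (\<Sum>i=1..N. \<Sum>j=1..N. u i * v j * cell_mass V N (i, j))"
    by (simp add: sum_distrib_left mult_ac)
  finally show ?thesis .
qed

text \<open>The left-hand side is the inner product of the step function of \<open>u\<close> with the image of the step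
function of \<open>v\<close> under the integral operator.\<close>

lemma cell_mass_bilinear_le:
  assumes W: "graphon W" and N: "N \<ge> 1" and V: "borel_version W V"
  shows "real N * (\<Sum>i=1..N. \<Sum>j=1..N. u i * v j * cell_mass V N (i, j))
    \<le> op_norm W * (L2_set u {1..N} * L2_set v {1..N})"
proof -
  define a where "a = (\<lambda>u v. real N * (\<Sum>i=1..N. \<Sum>j=1..N. u i * v j * cell_mass V N (i, j)))"
  have unit: "a u v \<le> op_norm W * L2_set u {1..N}" if v: "L2_set v {1..N} \<le> 1" for u v
  proof (cases "L2_set u {1..N} = 0")
    case True
    then have "\<forall>i\<in>{1..N}. u i = 0" by (simp only: L2_set_eq_0_iff finite_atLeastAtMost)
    then have "a u v = 0" by (simp add: a_def)
    then show ?thesis using True by simp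
  next
    case False
    define G where "G = (L2_set u {1..N})\<^sup>2"
    define H where "H = (LINT x|lborel. (borel_operator V (grid_step N v) x)\<^sup>2)"
    have G: "G > 0" using False by (simp add: G_def)
    note m = L2_norm_graphon_operator_grid_step[OF N V, of v]
    note b = borel_operator_grid_step_bounded[OF N V, where v = v]
    have [measurable]: "borel_operator V (grid_step N v) \<in> borel_measurable borel" by (rule m)
    have op: "L2_norm (graphon_operator W (grid_step N v)) \<le> op_norm W"
      using v by (intro L2_norm_graphon_operator_le_op_norm W) (simp_all add: grid_step_L2[OF N])
    have op0: "0 \<le> L2_norm (graphon_operator W (grid_step N v))"
      by (simp add: L2_norm_def integral_nonneg_AE)
    have H: "H \<le> (op_norm W)\<^sup>2"
      unfolding H_def m(2)[symmetric] using op op0 by (rule power_mono)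
    let ?B = "sqrt (real N) * (\<Sum>j=1..N. \<bar>v j\<bar>)"
    let ?C = "sqrt (real N) * (\<Sum>j=1..N. \<bar>u j\<bar>)"
    have B: "0 \<le> ?B" "0 \<le> ?C" by (intro mult_nonneg_nonneg sum_nonneg; simp)+
    have ind: "integrable lborel (\<lambda>y. K * indicator {0<..1::real} y)" for K :: real
      by (intro integrable_mult_right) (simp add: integrable_indicator_iff)
    have iH: "integrable lborel (\<lambda>x. (borel_operator V (grid_step N v) x)\<^sup>2)"
    proof (rule Bochner_Integration.integrable_bound[OF ind[of "?B\<^sup>2"]])
      show "AE x in lborel. norm ((borel_operator V (grid_step N v) x)\<^sup>2) \<le> norm (?B\<^sup>2 * indicator {0<..1::real} x)"
      proof (rule AE_I2)
        fix x :: real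
        have "(borel_operator V (grid_step N v) x)\<^sup>2 \<le> ?B\<^sup>2"
          using b(1)[of x] B by (metis abs_le_square_iff abs_of_nonneg)
        then show "norm ((borel_operator V (grid_step N v) x)\<^sup>2) \<le> norm (?B\<^sup>2 * indicator {0<..1::real} x)"
          using b(2)[of x] by (cases "x \<in> {0<..1}") (simp_all add: power_mult_distrib)
      qed
    qed measurable
    have iA: "integrable lborel (\<lambda>x. grid_step N u x * borel_operator V (grid_step N v) x)"
    proof (rule Bochner_Integration.integrable_bound[OF ind[of "?C * ?B"]])
      show "AE x in lborel. norm (grid_step N u x * borel_operator V (grid_step N v) x) \<le> norm (?C * ?B * indicator {0<..1::real} x)"
      proof (rule AE_I2)
        fix x :: real
        have "\<bar>grid_step N u x\<bar> * \<bar>borel_operator V (grid_step N v) x\<bar> \<le> ?C * ?B"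
          using b(1)[of x] B abs_grid_step_le[of N u x] by (intro mult_mono) auto
        then show "norm (grid_step N u x * borel_operator V (grid_step N v) x) \<le> norm (?C * ?B * indicator {0<..1::real} x)"
          using b(2)[of x] B by (cases "x \<in> {0<..1}") (simp_all add: abs_mult)
      qed
    qed measurable
    note iG = integral_grid_step_square[OF N, of u]
    \<comment> \<open>the minimiser of the integral of \<open>(h - s g)\<^sup>2\<close> over \<open>s\<close>, as in the proof of Cauchy--Schwarz\<close>
    define s where "s = a u v / G"
    have "0 \<le> (LINT x|lborel. (borel_operator V (grid_step N v) x - s * grid_step N u x)\<^sup>2)"
      by (intro integral_nonneg_AE) simp
    also have "\<dots> = (LINT x|lborel. (borel_operator V (grid_step N v) x)\<^sup>2
        - 2 * s * (grid_step N u x * borel_operator V (grid_step N v) x) + s\<^sup>2 * (grid_step N u x)\<^sup>2)"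
      by (intro Bochner_Integration.integral_cong) (simp_all add: power2_eq_square algebra_simps)
    also have "\<dots> = H - 2 * s * a u v + s\<^sup>2 * G"
      using iH iA iG by (simp add: H_def G_def a_def borel_operator_bilinear[OF N V])
    also have "\<dots> = H - (a u v)\<^sup>2 / G"
      using G by (simp add: s_def field_simps power2_eq_square)
    finally have "(a u v)\<^sup>2 \<le> H * G" using G by (simp add: field_simps)
    also have "\<dots> \<le> (op_norm W)\<^sup>2 * G" using H G by simp
    also have "\<dots> = (op_norm W * L2_set u {1..N})\<^sup>2" by (simp add: G_def power_mult_distrib)
    finally show ?thesis
      using op op0 by (intro power2_le_imp_le[of "a u v"]) (auto intro!: mult_nonneg_nonneg)
  qed
  show ?thesis
  proof (cases "L2_set v {1..N} = 0")
    case True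
    then have "\<forall>i\<in>{1..N}. v i = 0" by (simp only: L2_set_eq_0_iff finite_atLeastAtMost)
    then show ?thesis using True by simp
  next
    case False
    define n where "n = L2_set v {1..N}"
    have n: "n > 0" using False L2_set_nonneg[of v "{1..N}"] unfolding n_def by linarith
    \<comment> \<open>the operator norm only concerns functions of norm at most 1\<close>
    define v' where "v' = (\<lambda>j. (1 / n) * v j)"
    have "L2_set v' {1..N} = (1 / n) * n"
      unfolding v'_def n_def by (rule L2_set_right_distrib[symmetric]) simp
    then have "L2_set v' {1..N} \<le> 1" using n by simp
    from unit[OF this, of u] have "n * a u v' \<le> n * (op_norm W * L2_set u {1..N})"
      using n by simp
    moreover have "n * a u v' = a u v"
      using n by (simp add: a_def v'_def sum_distrib_left)
    ultimately have "a u v \<le> op_norm W * (L2_set u {1..N} * n)" by (simp add: mult_ac)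
    then show ?thesis unfolding a_def n_def .
  qed
qed

definition grid_error :: "(real \<Rightarrow> real \<Rightarrow> real) \<Rightarrow> (real \<times> real \<Rightarrow> real) \<Rightarrow> nat \<Rightarrow> real" where
  "grid_error W V N = (\<Sum>i=1..N. \<Sum>j=1..N. \<bar>W (real i / real N) (real j / real N) / (real N)\<^sup>2 - cell_mass V N (i, j)\<bar>)"

lemma grid_point_graphon:
  assumes W: "graphon W" and ij: "i \<in> {1..N}" "j \<in> {1..N}"
  shows "0 \<le> W (real i / real N) (real j / real N)" "W (real i / real N) (real j / real N) \<le> 1"
    "W (real i / real N) (real j / real N) = W (real j / real N) (real i / real N)"
proof -
  have "real i / real N \<in> {0..1}" "real j / real N \<in> {0..1}" using ij by auto
  then show "0 \<le> W (real i / real N) (real j / real N)" "W (real i / real N) (real j / real N) \<le> 1"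
    "W (real i / real N) (real j / real N) = W (real j / real N) (real i / real N)"
    using W unfolding graphon_def by force+
qed

text \<open>Replace the sampled matrix by the matrix of cell averages. The difference has entries of size at
most \<open>1 / N\<close> after scaling by \<open>N\<close>, so its Frobenius norm is controlled by the sum of the absolute
values of its entries.\<close>

lemma grid_matrix_norm:
  assumes W: "graphon W" and N: "N \<ge> 1" and V: "borel_version W V"
  shows "L2_set (\<lambda>i. \<Sum>j=1..N. W (real i / real N) (real j / real N) / real N * v j) {1..N}
    \<le> (op_norm W + sqrt (grid_error W V N)) * L2_set v {1..N}"
proof -
  define A where "A = {1..N}"
  define w where "w = (\<lambda>i j. W (real i / real N) (real j / real N))"
  define d where "d = (\<lambda>c. w (fst c) (snd c) / (real N)\<^sup>2 - cell_mass V N c)"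
  define u where "u = (\<lambda>i. \<Sum>j\<in>A. w i j / real N * v j)"
  define K where "K = op_norm W + sqrt (grid_error W V N)"
  have [simp]: "finite A" by (simp add: A_def)
  have w01: "0 \<le> w i j" "w i j \<le> 1" if "i \<in> A" "j \<in> A" for i j
    using grid_point_graphon[OF W] that by (auto simp: w_def A_def)
  have d_le: "\<bar>d c\<bar> \<le> 1 / (real N)\<^sup>2" if cA: "c \<in> A \<times> A" for c
  proof -
    obtain i j where c: "c = (i, j)" "i \<in> A" "j \<in> A" using cA by auto
    have cell: "W (fst p) (snd p) \<in> {0..1}" if p: "p \<in> grid_cell N (i, j)" for p
    proof -
      have "0 \<le> (real i - 1) / real N" "real i / real N \<le> 1" "0 \<le> (real j - 1) / real N" "real j / real N \<le> 1"
        using c N by (auto simp: A_def)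
      then have "fst p \<in> {0..1}" "snd p \<in> {0..1}"
        using p by (auto simp: grid_cell_def)
      then show ?thesis using W by (simp add: graphon_def)
    qed
    have "0 / (real N)\<^sup>2 \<le> cell_mass V N c" "cell_mass V N c \<le> 1 / (real N)\<^sup>2"
      unfolding c using c(2,3) cell by (intro cell_mass_bounds[OF N V]; simp add: A_def)+
    moreover have "0 \<le> w (fst c) (snd c) / (real N)\<^sup>2" "w (fst c) (snd c) / (real N)\<^sup>2 \<le> 1 / (real N)\<^sup>2"
      using w01[OF c(2,3)] c(1) by (auto intro!: divide_right_mono)
    ultimately show ?thesis unfolding d_def by (simp add: abs_le_iff)
  qed
  have err: "(\<Sum>c\<in>A \<times> A. \<bar>d c\<bar>) = grid_error W V N"
    by (simp add: grid_error_def d_def w_def A_def sum.cartesian_product split_beta)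
  have "(\<Sum>c\<in>A \<times> A. (d c)\<^sup>2) \<le> (\<Sum>c\<in>A \<times> A. 1 / (real N)\<^sup>2 * \<bar>d c\<bar>)"
  proof (rule sum_mono)
    fix c assume "c \<in> A \<times> A"
    then have "\<bar>d c\<bar> * \<bar>d c\<bar> \<le> 1 / (real N)\<^sup>2 * \<bar>d c\<bar>" by (intro mult_right_mono d_le) auto
    then show "(d c)\<^sup>2 \<le> 1 / (real N)\<^sup>2 * \<bar>d c\<bar>" by (simp add: power2_eq_square)
  qed
  also have "\<dots> = grid_error W V N / (real N)\<^sup>2"
    by (simp add: err[symmetric] sum_divide_distrib)
  finally have dn: "L2_set d (A \<times> A) \<le> sqrt (grid_error W V N) / real N"
    unfolding L2_set_def by (metis real_sqrt_divide real_sqrt_le_mono real_sqrt_power real_sqrt_abs abs_of_nat)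
  have uv: "L2_set (\<lambda>c. u (fst c) * v (snd c)) (A \<times> A) = L2_set u A * L2_set v A"
  proof -
    have "(\<Sum>c\<in>A \<times> A. (u (fst c) * v (snd c))\<^sup>2) = (\<Sum>i\<in>A. (u i)\<^sup>2) * (\<Sum>j\<in>A. (v j)\<^sup>2)"
      by (simp add: sum_product sum.cartesian_product split_beta power_mult_distrib)
    then show ?thesis by (simp add: L2_set_def real_sqrt_mult)
  qed
  have "(L2_set u A)\<^sup>2 = (\<Sum>i\<in>A. u i * (\<Sum>j\<in>A. w i j / real N * v j))"
    by (simp add: L2_set_def sum_nonneg u_def power2_eq_square)
  also have "\<dots> = (\<Sum>i\<in>A. \<Sum>j\<in>A. real N * (u i * v j * cell_mass V N (i, j)) + real N * ((u i * v j) * d (i, j)))"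
    unfolding sum_distrib_left using N
    by (intro sum.cong refl) (simp add: d_def field_simps power2_eq_square)
  also have "\<dots> = real N * (\<Sum>i\<in>A. \<Sum>j\<in>A. u i * v j * cell_mass V N (i, j)) + real N * (\<Sum>c\<in>A \<times> A. (u (fst c) * v (snd c)) * d c)"
    by (simp add: sum.distrib sum_distrib_left sum.cartesian_product split_beta)
  also have "\<dots> \<le> op_norm W * (L2_set u A * L2_set v A) + real N * ((L2_set u A * L2_set v A) * (sqrt (grid_error W V N) / real N))"
  proof (intro add_mono mult_left_mono)
    show "real N * (\<Sum>i\<in>A. \<Sum>j\<in>A. u i * v j * cell_mass V N (i, j)) \<le> op_norm W * (L2_set u A * L2_set v A)"
      unfolding A_def by (rule cell_mass_bilinear_le[OF W N V])
    have "(\<Sum>c\<in>A \<times> A. (u (fst c) * v (snd c)) * d c) \<le> (\<Sum>c\<in>A \<times> A. \<bar>u (fst c) * v (snd c)\<bar> * \<bar>d c\<bar>)"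
      by (intro sum_mono) (metis abs_ge_self abs_mult)
    also have "\<dots> \<le> L2_set (\<lambda>c. u (fst c) * v (snd c)) (A \<times> A) * L2_set d (A \<times> A)"
      by (rule L2_set_mult_ineq)
    also have "\<dots> \<le> (L2_set u A * L2_set v A) * (sqrt (grid_error W V N) / real N)"
      unfolding uv by (intro mult_left_mono dn mult_nonneg_nonneg) auto
    finally show "(\<Sum>c\<in>A \<times> A. (u (fst c) * v (snd c)) * d c) \<le> (L2_set u A * L2_set v A) * (sqrt (grid_error W V N) / real N)" .
  qed simp
  also have "\<dots> = L2_set u A * (K * L2_set v A)"
    using N by (simp add: K_def algebra_simps)
  finally have le: "L2_set u A * L2_set u A \<le> L2_set u A * (K * L2_set v A)" by (simp add: power2_eq_square)
  have "L2_set u A \<le> K * L2_set v A"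
  proof (cases "L2_set u A = 0")
    case False
    then have "0 < L2_set u A" using L2_set_nonneg[of u A] by linarith
    then show ?thesis using le by simp
  next
    case True
    have "0 \<le> K"
    proof -
      have "(\<lambda>_. 0) \<in> L2" "L2_norm (\<lambda>_. 0) \<le> 1" by (simp_all add: L2_def L2_norm_def)
      from L2_norm_graphon_operator_le_op_norm[OF W this]
      have "0 \<le> op_norm W" by (simp add: graphon_operator_def L2_norm_def)
      moreover have "0 \<le> grid_error W V N" by (simp add: err[symmetric] sum_nonneg)
      ultimately show ?thesis by (simp add: K_def)
    qed
    then show ?thesis using True by simp
  qed
  then show ?thesis by (simp add: u_def K_def A_def w_def)
qed

section \<open>Convergence in probability\<close>

text \<open>The probability space varies with the index, and only its distribution, a \<open>pmf\<close>, matters.\<close>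

definition conv_in_prob :: "(nat \<Rightarrow> 'a pmf) \<Rightarrow> (nat \<Rightarrow> 'a \<Rightarrow> 'b::metric_space) \<Rightarrow> 'b \<Rightarrow> bool" where
  "conv_in_prob M X c \<longleftrightarrow> (\<forall>e>0. (\<lambda>n. measure_pmf.prob (M n) {\<omega>. e \<le> dist (X n \<omega>) c}) \<longlonglongrightarrow> 0)"

lemma conv_in_probD:
  "conv_in_prob M X c \<Longrightarrow> e > 0 \<Longrightarrow> (\<lambda>n. measure_pmf.prob (M n) {\<omega>. e \<le> dist (X n \<omega>) c}) \<longlonglongrightarrow> 0"
  by (simp add: conv_in_prob_def)

lemma conv_in_prob_subset:
  assumes "conv_in_prob M Y d" and "e' > 0"
    and "\<forall>\<^sub>F n in sequentially. \<forall>\<omega>\<in>set_pmf (M n). e \<le> dist (X n \<omega>) c \<longrightarrow> e' \<le> dist (Y n \<omega>) d"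
  shows "(\<lambda>n. measure_pmf.prob (M n) {\<omega>. e \<le> dist (X n \<omega>) c}) \<longlonglongrightarrow> 0"
proof (rule Lim_null_comparison)
  show "(\<lambda>n. measure_pmf.prob (M n) {\<omega>. e' \<le> dist (Y n \<omega>) d}) \<longlonglongrightarrow> 0"
    using assms(1,2) by (simp add: conv_in_prob_def)
  show "\<forall>\<^sub>F n in sequentially. norm (measure_pmf.prob (M n) {\<omega>. e \<le> dist (X n \<omega>) c})
      \<le> measure_pmf.prob (M n) {\<omega>. e' \<le> dist (Y n \<omega>) d}"
    using assms(3)
  proof eventually_elim
    case (elim n)
    have "measure_pmf.prob (M n) {\<omega>. e \<le> dist (X n \<omega>) c} = measure_pmf.prob (M n) ({\<omega>. e \<le> dist (X n \<omega>) c} \<inter> set_pmf (M n))"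
      by (simp add: measure_Int_set_pmf)
    also have "\<dots> \<le> measure_pmf.prob (M n) {\<omega>. e' \<le> dist (Y n \<omega>) d}"
      using elim by (intro measure_pmf.finite_measure_mono) auto
    finally show ?case by simp
  qed
qed

lemma conv_in_prob_isCont:
  assumes "conv_in_prob M X c" "isCont f c"
  shows "conv_in_prob M (\<lambda>n \<omega>. f (X n \<omega>)) (f c)"
  unfolding conv_in_prob_def
proof safe
  fix e :: real assume "e > 0"
  then obtain d where d: "d > 0" "\<And>x. dist x c < d \<Longrightarrow> dist (f x) (f c) < e"
    using assms(2) unfolding continuous_at_eps_delta by blast
  show "(\<lambda>n. measure_pmf.prob (M n) {\<omega>. e \<le> dist (f (X n \<omega>)) (f c)}) \<longlonglongrightarrow> 0"
    by (rule conv_in_prob_subset[OF assms(1) d(1)])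
       (use d(2) in \<open>auto intro!: always_eventually simp: not_less[symmetric]\<close>)
qed

lemma conv_in_prob_Pair:
  assumes "conv_in_prob M X c" "conv_in_prob M Y d"
  shows "conv_in_prob M (\<lambda>n \<omega>. (X n \<omega>, Y n \<omega>)) (c, d)"
  unfolding conv_in_prob_def
proof safe
  fix e :: real assume e: "e > 0"
  have lim: "(\<lambda>n. measure_pmf.prob (M n) {\<omega>. e / 2 \<le> dist (X n \<omega>) c} + measure_pmf.prob (M n) {\<omega>. e / 2 \<le> dist (Y n \<omega>) d}) \<longlonglongrightarrow> 0 + 0"
    by (intro tendsto_add conv_in_probD[OF assms(1)] conv_in_probD[OF assms(2)] half_gt_zero e)
  have le: "measure_pmf.prob (M n) {\<omega>. e \<le> dist (X n \<omega>, Y n \<omega>) (c, d)} \<le>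
      measure_pmf.prob (M n) {\<omega>. e / 2 \<le> dist (X n \<omega>) c} + measure_pmf.prob (M n) {\<omega>. e / 2 \<le> dist (Y n \<omega>) d}" for n
  proof -
    have "{\<omega>. e \<le> dist (X n \<omega>, Y n \<omega>) (c, d)} \<subseteq> {\<omega>. e / 2 \<le> dist (X n \<omega>) c} \<union> {\<omega>. e / 2 \<le> dist (Y n \<omega>) d}"
    proof
      fix \<omega> assume "\<omega> \<in> {\<omega>. e \<le> dist (X n \<omega>, Y n \<omega>) (c, d)}"
      moreover have "dist (X n \<omega>, Y n \<omega>) (c, d) \<le> dist (X n \<omega>) c + dist (Y n \<omega>) d"
        unfolding dist_Pair_Pair by (rule sqrt_sum_squares_le_sum) auto
      ultimately show "\<omega> \<in> {\<omega>. e / 2 \<le> dist (X n \<omega>) c} \<union> {\<omega>. e / 2 \<le> dist (Y n \<omega>) d}"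
        by simp argo
    qed
    then have "measure_pmf.prob (M n) {\<omega>. e \<le> dist (X n \<omega>, Y n \<omega>) (c, d)} \<le>
      measure_pmf.prob (M n) ({\<omega>. e / 2 \<le> dist (X n \<omega>) c} \<union> {\<omega>. e / 2 \<le> dist (Y n \<omega>) d})"
      by (intro measure_pmf.finite_measure_mono) auto
    also have "\<dots> \<le> measure_pmf.prob (M n) {\<omega>. e / 2 \<le> dist (X n \<omega>) c} + measure_pmf.prob (M n) {\<omega>. e / 2 \<le> dist (Y n \<omega>) d}"
      by (rule measure_Un_le) auto
    finally show ?thesis .
  qed
  show "(\<lambda>n. measure_pmf.prob (M n) {\<omega>. e \<le> dist (X n \<omega>, Y n \<omega>) (c, d)}) \<longlonglongrightarrow> 0"
    by (rule Lim_null_comparison[OF always_eventually]) (use le lim in auto)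
qed

lemma conv_in_prob_add:
  fixes c d :: "'b::real_normed_vector"
  assumes "conv_in_prob M X c" "conv_in_prob M Y d"
  shows "conv_in_prob M (\<lambda>n \<omega>. X n \<omega> + Y n \<omega>) (c + d)"
  using conv_in_prob_isCont[OF conv_in_prob_Pair[OF assms], of "\<lambda>p. fst p + snd p"]
  by (auto intro!: continuous_intros)

lemma conv_in_prob_mult:
  fixes c d :: "'b::real_normed_algebra"
  assumes "conv_in_prob M X c" "conv_in_prob M Y d"
  shows "conv_in_prob M (\<lambda>n \<omega>. X n \<omega> * Y n \<omega>) (c * d)"
  using conv_in_prob_isCont[OF conv_in_prob_Pair[OF assms], of "\<lambda>p. fst p * snd p"]
  by (auto intro!: continuous_intros)

lemma conv_in_prob_const:
  assumes "x \<longlonglongrightarrow> c"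
  shows "conv_in_prob M (\<lambda>n \<omega>. x n) c"
  unfolding conv_in_prob_def
proof safe
  fix e :: real assume "e > 0"
  then have "\<forall>\<^sub>F n in sequentially. dist (x n) c < e" using assms tendstoD by blast
  then have "\<forall>\<^sub>F n in sequentially. measure_pmf.prob (M n) {\<omega>. e \<le> dist (x n) c} = 0"
    by eventually_elim simp
  then show "(\<lambda>n. measure_pmf.prob (M n) {\<omega>. e \<le> dist (x n) c}) \<longlonglongrightarrow> 0"
    by (rule tendsto_eventually)
qed

lemma conv_in_prob_dominated:
  assumes "conv_in_prob M Y (0::real)"
    and "\<forall>\<^sub>F n in sequentially. \<forall>\<omega>\<in>set_pmf (M n). dist (X n \<omega>) c \<le> Y n \<omega>"
  shows "conv_in_prob M X c"
  unfolding conv_in_prob_def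
proof safe
  fix e :: real assume e: "e > 0"
  show "(\<lambda>n. measure_pmf.prob (M n) {\<omega>. e \<le> dist (X n \<omega>) c}) \<longlonglongrightarrow> 0"
    by (rule conv_in_prob_subset[OF assms(1) e], rule eventually_mono[OF assms(2)]) force
qed

lemma conv_in_prob_eventually_eq:
  assumes "conv_in_prob M X c" and "\<forall>\<^sub>F n in sequentially. \<forall>\<omega>\<in>set_pmf (M n). Y n \<omega> = X n \<omega>"
  shows "conv_in_prob M Y c"
  unfolding conv_in_prob_def
proof safe
  fix e :: real assume e: "e > 0"
  show "(\<lambda>n. measure_pmf.prob (M n) {\<omega>. e \<le> dist (Y n \<omega>) c}) \<longlonglongrightarrow> 0"
    by (rule conv_in_prob_subset[OF assms(1) e], rule eventually_mono[OF assms(2)]) auto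
qed

lemma conv_in_prob_L1:
  assumes "(\<lambda>n. measure_pmf.expectation (M n) (Y n)) \<longlonglongrightarrow> (0::real)"
    and "\<And>n. finite (set_pmf (M n))"
    and "\<forall>\<^sub>F n in sequentially. \<forall>\<omega>\<in>set_pmf (M n). 0 \<le> Y n \<omega>"
  shows "conv_in_prob M Y 0"
  unfolding conv_in_prob_def
proof safe
  fix e :: real assume e: "e > 0"
  show "(\<lambda>n. measure_pmf.prob (M n) {\<omega>. e \<le> dist (Y n \<omega>) 0}) \<longlonglongrightarrow> 0"
  proof (rule Lim_null_comparison)
    show "(\<lambda>n. measure_pmf.expectation (M n) (Y n) / e) \<longlonglongrightarrow> 0"
      using tendsto_divide[OF assms(1) tendsto_const[of e]] e by simp
    show "\<forall>\<^sub>F n in sequentially. norm (measure_pmf.prob (M n) {\<omega>. e \<le> dist (Y n \<omega>) 0})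
        \<le> measure_pmf.expectation (M n) (Y n) / e"
      using assms(3)
    proof eventually_elim
      case (elim n)
      have "measure_pmf.prob (M n) {\<omega>. e \<le> dist (Y n \<omega>) 0} = measure_pmf.prob (M n) ({\<omega>. e \<le> dist (Y n \<omega>) 0} \<inter> set_pmf (M n))"
        by (simp add: measure_Int_set_pmf)
      also have "\<dots> \<le> measure_pmf.prob (M n) {\<omega>. e \<le> Y n \<omega>}"
        using elim by (intro measure_pmf.finite_measure_mono) (auto simp: dist_real_def)
      also have "\<dots> \<le> measure_pmf.expectation (M n) (Y n) / e"
        using integral_Markov_inequality_measure[of "M n" "Y n" "{}" e] e assms(2)[of n] elim
        by (auto intro!: integrable_measure_pmf_finite AE_pmfI)
      finally show ?case by simp
    qed
  qed
qed

lemma conv_in_prob_expectation: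
  fixes X :: "nat \<Rightarrow> 'a \<Rightarrow> complex"
  assumes X: "conv_in_prob M X c"
    and fin: "\<And>n. finite (set_pmf (M n))"
    and bounded: "\<And>n \<omega>. \<omega> \<in> set_pmf (M n) \<Longrightarrow> norm (X n \<omega>) \<le> 1"
  shows "(\<lambda>n. measure_pmf.expectation (M n) (X n)) \<longlonglongrightarrow> c"
proof (rule LIMSEQ_I)
  fix e :: real assume e: "e > 0"
  define K where "K = 1 + norm c"
  have K: "K > 0" by (simp add: K_def add_pos_nonneg)
  have "(\<lambda>n. measure_pmf.prob (M n) {\<omega>. e / 2 \<le> dist (X n \<omega>) c}) \<longlonglongrightarrow> 0"
    by (intro conv_in_probD[OF X] half_gt_zero e)
  then have "\<forall>\<^sub>F n in sequentially. measure_pmf.prob (M n) {\<omega>. e / 2 \<le> dist (X n \<omega>) c} < e / (2 * K)"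
    using e K by (intro order_tendstoD) auto
  then have "\<forall>\<^sub>F n in sequentially. norm (measure_pmf.expectation (M n) (X n) - c) < e"
  proof eventually_elim
    case (elim n)
    have i: "integrable (measure_pmf (M n)) f" for f :: "'a \<Rightarrow> 'b::{banach, second_countable_topology}"
      using fin by (rule integrable_measure_pmf_finite)
    have "norm (measure_pmf.expectation (M n) (X n) - c) = norm (measure_pmf.expectation (M n) (\<lambda>\<omega>. X n \<omega> - c))"
      by (subst Bochner_Integration.integral_diff) (simp_all add: i)
    also have "\<dots> \<le> measure_pmf.expectation (M n) (\<lambda>\<omega>. norm (X n \<omega> - c))"
      by (rule integral_norm_bound)
    also have "\<dots> \<le> measure_pmf.expectation (M n) (\<lambda>\<omega>. e / 2 + K * indicator {\<omega>. e / 2 \<le> dist (X n \<omega>) c} \<omega>)"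
    proof (rule integral_mono_AE[OF i i])
      show "AE \<omega> in M n. norm (X n \<omega> - c) \<le> e / 2 + K * indicator {\<omega>. e / 2 \<le> dist (X n \<omega>) c} \<omega>"
      proof (rule AE_pmfI)
        fix \<omega> assume "\<omega> \<in> set_pmf (M n)"
        then have "norm (X n \<omega> - c) \<le> K"
          using bounded[of \<omega> n] norm_triangle_ineq4[of "X n \<omega>" c] by (simp add: K_def)
        then show "norm (X n \<omega> - c) \<le> e / 2 + K * indicator {\<omega>. e / 2 \<le> dist (X n \<omega>) c} \<omega>"
          using e by (auto simp: indicator_def dist_norm)
      qed
    qed
    also have "\<dots> = e / 2 + K * measure_pmf.prob (M n) {\<omega>. e / 2 \<le> dist (X n \<omega>) c}"
      by (subst Bochner_Integration.integral_add) (simp_all add: i)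
    also have "\<dots> < e / 2 + K * (e / (2 * K))"
      using elim K by (intro add_strict_left_mono mult_strict_left_mono)
    also have "\<dots> = e" using K by simp
    finally show ?case .
  qed
  then show "\<exists>no. \<forall>n\<ge>no. norm (measure_pmf.expectation (M n) (X n) - c) < e"
    by (simp add: eventually_sequentially)
qed

section \<open>Moments of the random graph\<close>

definition vertex_pairs :: "nat \<Rightarrow> (nat \<times> nat) set" where
  "vertex_pairs N = {(i, j). 1 \<le> i \<and> i \<le> j \<and> j \<le> N}"

lemma finite_vertex_pairs [simp]: "finite (vertex_pairs N)"
  by (rule finite_subset[of _ "{1..N} \<times> {1..N}"]) (auto simp: vertex_pairs_def)

lemma edges_subset_pairs: "edges N \<subseteq> vertex_pairs N"
  by (auto simp: edges_def vertex_pairs_def)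

text \<open>The success probabilities are arbitrary here because the moments below depend on the independence
of the entries only.\<close>

definition coins :: "(nat \<times> nat \<Rightarrow> real) \<Rightarrow> nat \<Rightarrow> (nat \<times> nat \<Rightarrow> bool) pmf" where
  "coins p N = Pi_pmf (vertex_pairs N) False (\<lambda>c. bernoulli_pmf (p c))"

definition adjacency :: "(nat \<times> nat \<Rightarrow> bool) \<Rightarrow> nat \<Rightarrow> nat \<Rightarrow> real" where
  "adjacency g = (\<lambda>i j. of_bool (g (min i j, max i j)))"

lemma finite_coins [simp]: "finite (set_pmf (coins p N))"
  unfolding coins_def by (subst set_Pi_pmf) (auto intro!: finite_PiE_dflt)

lemma random_graph_coins:
  "random_graph_pmf W \<theta> N = map_pmf adjacency (coins (\<lambda>c. \<theta> * W (real (fst c) / real N) (real (snd c) / real N)) N)"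
  by (simp add: random_graph_pmf_def coins_def vertex_pairs_def adjacency_def[abs_def] split_beta')

lemma expectation_coins_prod:
  fixes f :: "nat \<times> nat \<Rightarrow> bool \<Rightarrow> real"
  assumes F: "F \<subseteq> vertex_pairs N" and p: "\<And>c. c \<in> F \<Longrightarrow> p c \<in> {0..1}"
    and f: "\<And>c b. c \<in> F \<Longrightarrow> f c b \<ge> 0"
  shows "measure_pmf.expectation (coins p N) (\<lambda>g. \<Prod>c\<in>F. f c (g c)) =
    (\<Prod>c\<in>F. p c * f c True + (1 - p c) * f c False)"
proof -
  \<comment> \<open>the factor 1 outside \<open>F\<close> extends the product to all independent coins\<close>
  define f' where "f' = (\<lambda>c b. if c \<in> F then f c b else 1)"
  have mono: "(\<Prod>c\<in>F. h c) = (\<Prod>c\<in>vertex_pairs N. if c \<in> F then h c else 1)" for h :: "nat \<times> nat \<Rightarrow> real"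
    using F by (subst prod.inter_restrict[symmetric]) (simp_all add: Int_absorb1)
  have "measure_pmf.expectation (coins p N) (\<lambda>g. \<Prod>c\<in>F. f c (g c)) =
    measure_pmf.expectation (coins p N) (\<lambda>g. \<Prod>c\<in>vertex_pairs N. f' c (g c))"
    by (simp add: mono f'_def)
  also have "\<dots> = (\<Prod>c\<in>vertex_pairs N. measure_pmf.expectation (bernoulli_pmf (p c)) (f' c))"
    unfolding coins_def
    by (rule expectation_prod_Pi_pmf) (use f in \<open>auto simp: f'_def intro!: integrable_measure_pmf_finite\<close>)
  also have "\<dots> = (\<Prod>c\<in>vertex_pairs N. if c \<in> F then p c * f c True + (1 - p c) * f c False else 1)"
    using p by (intro prod.cong refl) (auto simp: f'_def)
  finally show ?thesis by (simp add: mono)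
qed

lemma expectation_coin:
  assumes "c \<in> vertex_pairs N" "p c \<in> {0..1}"
  shows "measure_pmf.expectation (coins p N) (\<lambda>g. of_bool (g c)) = p c"
  using expectation_coins_prod[of "{c}" N p "\<lambda>_ b. of_bool b"] assms by simp

lemma expectation_two_coins:
  assumes "c \<in> vertex_pairs N" "p c \<in> {0..1}" "d \<in> vertex_pairs N" "p d \<in> {0..1}" "c \<noteq> d"
  shows "measure_pmf.expectation (coins p N) (\<lambda>g. of_bool (g c) * of_bool (g d)) = p c * p d"
proof -
  have "measure_pmf.expectation (coins p N) (\<lambda>g. \<Prod>c\<in>{c, d}. of_bool (g c)) =
    (\<Prod>c\<in>{c, d}. p c * of_bool True + (1 - p c) * of_bool False)"
    by (rule expectation_coins_prod) (use assms in auto)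
  then show ?thesis using assms by simp
qed

lemma coins_sum_variance:
  assumes F: "F \<subseteq> vertex_pairs N" and p: "\<And>c. c \<in> F \<Longrightarrow> p c \<in> {0..1}"
  shows "measure_pmf.expectation (coins p N) (\<lambda>g. ((\<Sum>c\<in>F. of_bool (g c)) - (\<Sum>c\<in>F. p c))\<^sup>2) \<le> (\<Sum>c\<in>F. p c)"
proof -
  let ?E = "measure_pmf.expectation (coins p N)"
  have fin: "finite F" using F by (rule finite_subset) simp
  have i: "integrable (measure_pmf (coins p N)) f" for f :: "(nat \<times> nat \<Rightarrow> bool) \<Rightarrow> real"
    by (rule integrable_measure_pmf_finite) simp
  define h where "h = (\<lambda>c g. of_bool (g c) - p c :: real)"
  have hh: "?E (\<lambda>g. h c g * h d g) = (if c = d then p c * (1 - p c) else 0)" if c: "c \<in> F" "d \<in> F" for c d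
  proof -
    have "?E (\<lambda>g. h c g * h d g) = ?E (\<lambda>g. of_bool (g c) * of_bool (g d) - p d * of_bool (g c) - p c * of_bool (g d) + p c * p d)"
      by (simp add: h_def algebra_simps)
    also have "\<dots> = ?E (\<lambda>g. of_bool (g c) * of_bool (g d)) - p d * ?E (\<lambda>g. of_bool (g c)) - p c * ?E (\<lambda>g. of_bool (g d)) + p c * p d"
      by (simp add: i)
    also have "\<dots> = (if c = d then p c * (1 - p c) else 0)"
    proof (cases "c = d")
      case True
      have "?E (\<lambda>g. of_bool (g c) * of_bool (g d)) = (?E (\<lambda>g. of_bool (g c)) :: real)"
        using True by (intro Bochner_Integration.integral_cong) auto
      then show ?thesis using expectation_coin[of c N p] True subsetD[OF F c(1)] p[OF c(1)] by (auto simp: algebra_simps)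
    next
      case False
      then show ?thesis
        using expectation_two_coins[of c N p d] expectation_coin[of c N p] expectation_coin[of d N p] subsetD[OF F c(1)] subsetD[OF F c(2)] p[OF c(1)] p[OF c(2)]
        by (auto simp: algebra_simps)
    qed
    finally show ?thesis .
  qed
  have "?E (\<lambda>g. ((\<Sum>c\<in>F. of_bool (g c)) - (\<Sum>c\<in>F. p c))\<^sup>2) = ?E (\<lambda>g. \<Sum>c\<in>F. \<Sum>d\<in>F. h c g * h d g)"
    by (simp only: h_def sum_subtractf[symmetric] power2_eq_square sum_product)
  also have "\<dots> = (\<Sum>c\<in>F. \<Sum>d\<in>F. ?E (\<lambda>g. h c g * h d g))"
    by (simp add: i)
  also have "\<dots> = (\<Sum>c\<in>F. p c * (1 - p c))"
    using fin by (simp add: hh cong: sum.cong)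
  also have "\<dots> \<le> (\<Sum>c\<in>F. p c)"
    using p by (intro sum_mono) (simp add: mult_left_le)
  finally show ?thesis .
qed

text \<open>For fixed spins the bonds are independent and each factor is affine in its coin.
The condition \<open>u \<le> 1\<close> keeps all factors non-negative.\<close>

lemma expectation_bond_weight:
  assumes p: "\<And>c. c \<in> edges N \<Longrightarrow> p c \<in> {0..1}" and u: "0 \<le> u" "u \<le> 1"
  shows "measure_pmf.expectation (coins p N) (\<lambda>g. spin_avg N (bond_weight N (\<lambda>i j. u * adjacency g i j)))
    = spin_avg N (bond_weight N (\<lambda>i j. u * p (i, j)))"
proof -
  let ?E = "measure_pmf.expectation (coins p N)"
  have i: "integrable (measure_pmf (coins p N)) f" for f :: "(nat \<times> nat \<Rightarrow> bool) \<Rightarrow> real"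
    by (rule integrable_measure_pmf_finite) simp
  have *: "?E (\<lambda>g. bond_weight N (\<lambda>i j. u * adjacency g i j) \<sigma>) = bond_weight N (\<lambda>i j. u * p (i, j)) \<sigma>"
    if s: "\<sigma> \<in> spins N" for \<sigma>
  proof -
    define f where "f = (\<lambda>e b. 1 + u * of_bool b * (\<sigma> (fst e) * \<sigma> (snd e)))"
    have "?E (\<lambda>g. bond_weight N (\<lambda>i j. u * adjacency g i j) \<sigma>) = ?E (\<lambda>g. \<Prod>e\<in>edges N. f e (g e))"
      unfolding bond_weight_def f_def adjacency_def
      by (intro Bochner_Integration.integral_cong prod.cong refl) (auto simp: edges_def min_def max_def mult_ac)
    also have "\<dots> = (\<Prod>e\<in>edges N. p e * f e True + (1 - p e) * f e False)"
    proof (rule expectation_coins_prod[OF edges_subset_pairs p])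
      fix e b assume "e \<in> edges N"
      then have "fst e \<in> {1..N}" "snd e \<in> {1..N}" using edges_subset by force+
      then have "\<sigma> (fst e) * \<sigma> (snd e) = 1 \<or> \<sigma> (fst e) * \<sigma> (snd e) = -1"
        using spin_values[OF s, of "fst e"] spin_values[OF s, of "snd e"] by auto
      then show "f e b \<ge> 0" using u by (auto simp: f_def)
    qed
    also have "\<dots> = bond_weight N (\<lambda>i j. u * p (i, j)) \<sigma>"
      unfolding bond_weight_def f_def by (intro prod.cong refl) (simp add: algebra_simps)
    finally show ?thesis .
  qed
  have "?E (\<lambda>g. spin_avg N (bond_weight N (\<lambda>i j. u * adjacency g i j)))
      = (\<Sum>\<sigma>\<in>spins N. ?E (\<lambda>g. bond_weight N (\<lambda>i j. u * adjacency g i j) \<sigma>)) / 2 ^ N"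
    unfolding spin_avg_def by (simp add: i)
  also have "\<dots> = spin_avg N (bond_weight N (\<lambda>i j. u * p (i, j)))"
    unfolding spin_avg_def by (simp add: * cong: sum.cong)
  finally show ?thesis .
qed

section \<open>Hyperbolic functions near the origin\<close>

lemma norm_cosh_le:
  fixes z :: complex
  assumes "norm z \<le> 1" shows "norm (cosh z) \<le> 3"
proof -
  have e: "norm (exp w) \<le> 3" if "norm w \<le> 1" for w :: complex
  proof -
    have "norm (exp w) \<le> exp (norm w)" by (rule norm_exp)
    also have "\<dots> \<le> exp 1" using that by simp
    also have "\<dots> \<le> 3" by (rule exp_le)
    finally show ?thesis .
  qed
  have "norm (cosh z) \<le> (norm (exp z) + norm (exp (- z))) / 2"
    using norm_triangle_ineq[of "exp z" "exp (- z)"] by (simp add: cosh_def del: norm_exp_eq_Re)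
  also have "\<dots> \<le> 3" using e[of z] e[of "- z"] assms by simp
  finally show ?thesis .
qed

lemma norm_sinh_le:
  fixes z :: complex
  assumes "norm z \<le> 1" shows "norm (sinh z) \<le> 3 * norm z"
proof -
  have "norm (sinh z - sinh 0) \<le> 3 * norm (z - 0)"
  proof (rule field_differentiable_bound[of "cball 0 1"])
    show "(sinh has_field_derivative cosh w) (at w within cball 0 1)" for w :: complex
      by (auto intro!: derivative_eq_intros)
  qed (use assms norm_cosh_le in auto)
  then show ?thesis by simp
qed

lemma norm_cosh_minus_one_le:
  fixes z :: complex
  assumes "norm z \<le> 1" shows "norm (cosh z - 1) \<le> 3 * (norm z)\<^sup>2"
proof -
  have "norm (cosh z - cosh 0) \<le> (3 * norm z) * norm (z - 0)"
  proof (rule field_differentiable_bound[of "cball 0 (norm z)"])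
    show "(cosh has_field_derivative sinh w) (at w within cball 0 (norm z))" for w :: complex
      by (auto intro!: derivative_eq_intros)
    show "norm (sinh w) \<le> 3 * norm z" if "w \<in> cball 0 (norm z)" for w :: complex
      using norm_sinh_le[of w] that assms by simp
  qed auto
  then show ?thesis by (simp add: power2_eq_square)
qed

lemma norm_cosh_ge:
  fixes z :: complex
  assumes "norm z \<le> 1 / 3" shows "1 / 2 \<le> norm (cosh z)"
proof -
  have "(norm z)\<^sup>2 \<le> (1 / 3)\<^sup>2" using assms by (intro power_mono) auto
  then have "norm (cosh z - 1) \<le> 1 / 2"
    using norm_cosh_minus_one_le[of z] assms by (simp add: power2_eq_square)
  moreover have "1 \<le> norm (cosh z) + norm (cosh z - 1)"
    using norm_triangle_ineq4[of "cosh z" "cosh z - 1"] by simp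
  ultimately show ?thesis by simp
qed

text \<open>Dividing \<open>cosh\<close> by its Gaussian approximation \<open>exp (z\<^sup>2 / 2)\<close> leaves a function whose derivative is
of third order at 0. Working with this quotient avoids complex logarithms.\<close>

definition cosh_gauss :: "complex \<Rightarrow> complex" where
  "cosh_gauss z = cosh z * exp (- (z\<^sup>2) / 2)"

lemma cosh_gauss_lipschitz:
  assumes "norm z \<le> R" "norm w \<le> R" "R \<le> 1"
  shows "norm (cosh_gauss z - cosh_gauss w) \<le> 6 * R ^ 3 * norm (z - w)"
proof (rule field_differentiable_bound[of "cball 0 R"])
  define k where "k = (\<lambda>z :: complex. sinh z - z * cosh z)"
  fix v :: complex assume v: "v \<in> cball 0 R"
  then have v': "norm v \<le> R" "norm v \<le> 1" using assms by auto
  show "(cosh_gauss has_field_derivative k v * exp (- (v\<^sup>2) / 2)) (at v within cball 0 R)"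
    unfolding cosh_gauss_def k_def by (auto intro!: derivative_eq_intros simp: algebra_simps)
  have "norm (k v - k 0) \<le> (norm v * (3 * norm v)) * norm (v - 0)"
  proof (rule field_differentiable_bound[of "cball 0 (norm v)"])
    show "(k has_field_derivative - u * sinh u) (at u within cball 0 (norm v))" for u
      unfolding k_def by (auto intro!: derivative_eq_intros simp: algebra_simps)
    fix u :: complex assume "u \<in> cball 0 (norm v)"
    then show "norm (- u * sinh u) \<le> norm v * (3 * norm v)"
      using norm_sinh_le[of u] v' by (auto simp: norm_mult intro!: mult_mono)
  qed auto
  then have "norm (k v) \<le> 3 * norm v ^ 3" by (simp add: k_def power3_eq_cube)
  also have "\<dots> \<le> 3 * R ^ 3" using v' by (intro mult_left_mono power_mono) auto
  finally have k: "norm (k v) \<le> 3 * R ^ 3" .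
  have "norm (exp (- (v\<^sup>2) / 2)) \<le> exp (norm (- (v\<^sup>2) / 2))" by (rule norm_exp)
  also have "norm (- (v\<^sup>2) / 2) \<le> 1 / 2"
    using power_le_one[of "norm v" 2] v' by (simp add: norm_divide norm_power)
  also have "exp (1 / 2 :: real) \<le> 2" using exp_half_le2 by simp
  finally have "norm (exp (- (v\<^sup>2) / 2)) \<le> 2" by simp
  with k show "norm (k v * exp (- (v\<^sup>2) / 2)) \<le> 6 * R ^ 3"
    unfolding norm_mult using mult_mono[OF k, of "norm (exp (- (v\<^sup>2) / 2))" 2] norm_ge_zero[of "k v"]
    by (smt (verit, best) norm_ge_zero)
qed (use assms in auto)

lemma cosh_gauss_real_ge:
  assumes "\<bar>x\<bar> \<le> 1"
  shows "1 / 2 \<le> norm (cosh_gauss (complex_of_real x))"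
proof -
  have "x\<^sup>2 \<le> 1" using assms by (simp add: abs_square_le_1)
  then have "(1 - x\<^sup>2 / 2) \<ge> 1 / 2" by simp
  also have "1 - x\<^sup>2 / 2 \<le> exp (- (x\<^sup>2) / 2)" using exp_ge_add_one_self[of "- (x\<^sup>2) / 2"] by simp
  finally have "1 / 2 \<le> exp (- (x\<^sup>2) / 2)" .
  moreover have "1 \<le> cosh x" by (rule cosh_real_ge_1)
  ultimately have "1 * (1 / 2) \<le> cosh x * exp (- (x\<^sup>2) / 2)" by (intro mult_mono) auto
  moreover have "cosh (complex_of_real x) = complex_of_real (cosh x)"
    by (simp add: cosh_def exp_of_real[symmetric] scaleR_conv_of_real)
  then have "cosh_gauss (complex_of_real x) = complex_of_real (cosh x * exp (- (x\<^sup>2) / 2))"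
    unfolding cosh_gauss_def of_real_mult exp_of_real[symmetric] by simp
  ultimately show ?thesis by (simp only: norm_of_real)
qed

text \<open>The error is relative and linear in the distance of the two arguments. A bound of the order
\<open>R\<^sup>4\<close> alone would be too weak, since the number of edges times the fourth power of the arguments
is merely bounded.\<close>

lemma cosh_ratio:
  fixes x :: real and z :: complex
  assumes "norm z \<le> R" "\<bar>x\<bar> \<le> R" "R \<le> 1 / 3"
  shows "\<exists>cosh_defect. cosh z = cosh (complex_of_real x) * exp ((z\<^sup>2 - (complex_of_real x)\<^sup>2) / 2) * (1 + cosh_defect) \<and>
    norm cosh_defect \<le> 12 * R ^ 3 * norm (z - complex_of_real x)"
proof -
  let ?x = "complex_of_real x"
  define cosh_defect where "cosh_defect = (cosh_gauss z - cosh_gauss ?x) / cosh_gauss ?x"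
  have g: "1 / 2 \<le> norm (cosh_gauss ?x)" using assms by (intro cosh_gauss_real_ge) auto
  then have g0: "cosh_gauss ?x \<noteq> 0" by auto
  have "cosh z = cosh_gauss z * exp (z\<^sup>2 / 2)"
    by (simp add: cosh_gauss_def mult.assoc exp_add[symmetric])
  also have "cosh_gauss z = cosh_gauss ?x * (1 + cosh_defect)" using g0 by (simp add: cosh_defect_def field_simps)
  also have "\<dots> * exp (z\<^sup>2 / 2) = cosh ?x * (exp (- (?x\<^sup>2) / 2) * exp (z\<^sup>2 / 2)) * (1 + cosh_defect)"
    by (simp add: cosh_gauss_def mult_ac)
  also have "exp (- (?x\<^sup>2) / 2) * exp (z\<^sup>2 / 2) = exp ((z\<^sup>2 - ?x\<^sup>2) / 2)"
    by (simp add: exp_add[symmetric] diff_divide_distrib)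
  finally have eq: "cosh z = cosh ?x * exp ((z\<^sup>2 - ?x\<^sup>2) / 2) * (1 + cosh_defect)" .
  have "norm cosh_defect = norm (cosh_gauss z - cosh_gauss ?x) / norm (cosh_gauss ?x)"
    by (simp add: cosh_defect_def norm_divide)
  also have "\<dots> \<le> (6 * R ^ 3 * norm (z - ?x)) / (1 / 2)"
    using assms g cosh_gauss_lipschitz[of z R ?x] by (intro frac_le) auto
  finally show ?thesis using eq by auto
qed

lemma tanh_lipschitz:
  fixes z w :: complex
  assumes "norm z \<le> 1 / 3" "norm w \<le> 1 / 3"
  shows "norm (tanh z - tanh w) \<le> 4 * norm (z - w)"
  unfolding tanh_def
proof (rule field_differentiable_bound[of "cball 0 (1 / 3)"])
  fix v :: complex assume "v \<in> cball 0 (1 / 3)"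
  then have c: "1 / 2 \<le> norm (cosh v)" by (intro norm_cosh_ge) simp
  then have c0: "cosh v \<noteq> 0" by auto
  show "((\<lambda>v. sinh v / cosh v) has_field_derivative 1 / (cosh v)\<^sup>2) (at v within cball 0 (1 / 3))"
    using c0 cosh_square_eq[of v] by (auto intro!: derivative_eq_intros simp: power2_eq_square field_simps)
  have "(1 / 2)\<^sup>2 \<le> (norm (cosh v))\<^sup>2" using c by (intro power_mono) auto
  then have "1 / (norm (cosh v))\<^sup>2 \<le> 1 / (1 / 2)\<^sup>2" using c0 by (intro divide_left_mono) (auto simp: power2_eq_square)
  then show "norm (1 / (cosh v)\<^sup>2) \<le> 4"
    by (simp add: norm_divide norm_mult power2_eq_square)
qed (use assms in auto)

lemma abs_tanh_le: "\<bar>tanh x\<bar> \<le> \<bar>x\<bar>" for x :: real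
proof -
  have "norm (tanh x - tanh 0) \<le> 1 * norm (x - 0)"
    unfolding tanh_def
  proof (rule field_differentiable_bound[of UNIV])
    fix v :: real
    have c: "1 \<le> cosh v" by (rule cosh_real_ge_1)
    show "((\<lambda>v. sinh v / cosh v) has_field_derivative 1 / (cosh v)\<^sup>2) (at v within UNIV)"
      using c cosh_square_eq[of v] by (auto intro!: derivative_eq_intros simp: power2_eq_square field_simps)
    show "norm (1 / (cosh v)\<^sup>2) \<le> 1" using c by (simp add: one_le_power)
  qed auto
  then show ?thesis by simp
qed

section \<open>Polynomials with non-negative coefficients and the sum over even subgraphs\<close>

text \<open>Both sides compare difference quotients of the power function: between \<open>z\<close> and \<open>w\<close>, and between
\<open>m\<close> and \<open>u\<close>.\<close>

lemma norm_power_diff_majorant: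
  fixes z w :: "'a::real_normed_field" and m u :: real
  assumes "norm z \<le> m" "norm w \<le> m" "m \<le> u"
  shows "norm (z ^ k - w ^ k) * (u - m) \<le> norm (z - w) * (u ^ k - m ^ k)"
proof (induction k)
  case (Suc k)
  have m: "0 \<le> m" by (rule order_trans[OF norm_ge_zero assms(1)])
  have "norm (z ^ Suc k - w ^ Suc k) = norm (z * (z ^ k - w ^ k) + (z - w) * w ^ k)"
    by (simp add: algebra_simps)
  also have "\<dots> \<le> m * norm (z ^ k - w ^ k) + norm (z - w) * m ^ k"
    using assms m by (intro norm_triangle_le add_mono) (auto simp: norm_mult norm_power intro!: mult_mono power_mono)
  finally have "norm (z ^ Suc k - w ^ Suc k) * (u - m) \<le> (m * norm (z ^ k - w ^ k) + norm (z - w) * m ^ k) * (u - m)"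
    using assms(3) by (intro mult_right_mono) auto
  also have "\<dots> = m * (norm (z ^ k - w ^ k) * (u - m)) + norm (z - w) * (m ^ k * (u - m))"
    by (simp add: algebra_simps)
  also have "\<dots> \<le> m * (norm (z - w) * (u ^ k - m ^ k)) + norm (z - w) * (m ^ k * (u - m))"
    using Suc m by (intro add_right_mono mult_left_mono)
  also have "\<dots> = norm (z - w) * (m * (u ^ k - m ^ k) + m ^ k * (u - m))"
    by (simp add: algebra_simps)
  also have "\<dots> \<le> norm (z - w) * (u ^ Suc k - m ^ Suc k)"
  proof (rule mult_left_mono)
    have "0 \<le> (u - m) * (u ^ k - m ^ k)"
      using assms(3) m by (intro mult_nonneg_nonneg) (auto intro: power_mono)
    then show "m * (u ^ k - m ^ k) + m ^ k * (u - m) \<le> u ^ Suc k - m ^ Suc k"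
      by (simp add: algebra_simps)
  qed simp
  finally show ?case .
qed simp

text \<open>The same average as \<open>bond_weight\<close> with all bonds multiplied by a complex number, viewed as a
polynomial in that number.\<close>

definition bond_sum :: "nat \<Rightarrow> (nat \<Rightarrow> nat \<Rightarrow> real) \<Rightarrow> complex \<Rightarrow> complex" where
  "bond_sum N A u = spin_avg N (\<lambda>\<sigma>. \<Prod>e\<in>edges N. u * complex_of_real (A (fst e) (snd e) * \<sigma> (fst e) * \<sigma> (snd e)) + 1)"

text \<open>The coefficient of a set \<open>X\<close> of edges is the product of the entries of \<open>A\<close> on \<open>X\<close> times the average
of the product of the spins at their endpoints; the average is 1 if every vertex has even degree in
\<open>X\<close> and 0 otherwise.\<close>

lemma bond_sum_expansion:
  assumes A: "\<And>e. e \<in> edges N \<Longrightarrow> A (fst e) (snd e) \<ge> 0"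
  shows "\<exists>c :: (nat \<times> nat) set \<Rightarrow> real. (\<forall>X\<subseteq>edges N. c X \<ge> 0) \<and> c {} = 1 \<and>
    (\<forall>u. bond_sum N A u = (\<Sum>X\<in>Pow (edges N). u ^ card X * complex_of_real (c X))) \<and>
    (\<forall>u. spin_avg N (bond_weight N (\<lambda>i j. u * A i j)) = (\<Sum>X\<in>Pow (edges N). u ^ card X * c X))"
proof (intro exI conjI allI impI)
  define a where "a = (\<lambda>X \<sigma>. \<Prod>e\<in>X. A (fst e) (snd e) * \<sigma> (fst e) * \<sigma> (snd e))"
  define c where "c = (\<lambda>X. spin_avg N (a X))"
  show "0 \<le> c X" if X: "X \<subseteq> edges N" for X
  proof -
    have "finite X" using X by (rule finite_subset) simp
    then have "ferromagnetic N (a X)" using X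
    proof (induction X rule: finite_induct)
      case empty
      then show ?case by (simp add: a_def ferromagnetic_one)
    next
      case (insert e X)
      then have "fst e \<in> {1..N}" "snd e \<in> {1..N}" "A (fst e) (snd e) \<ge> 0" using edges_subset A by force+
      then have "ferromagnetic N (\<lambda>\<sigma>. A (fst e) (snd e) * (\<sigma> (fst e) * (\<sigma> (snd e) * a X \<sigma>)))"
        using insert by (intro ferromagnetic_cmult ferromagnetic_spin_mult) auto
      moreover have "a (insert e X) = (\<lambda>\<sigma>. A (fst e) (snd e) * (\<sigma> (fst e) * (\<sigma> (snd e) * a X \<sigma>)))"
        using insert.hyps by (simp add: a_def fun_eq_iff mult.assoc)
      ultimately show ?case by simp
    qed
    then show ?thesis unfolding c_def by (rule ferromagnetic_nonneg)
  qed
  show "c {} = 1" by (simp add: c_def a_def)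
  have of_real_avg: "complex_of_real (spin_avg N f) = spin_avg N (\<lambda>\<sigma>. complex_of_real (f \<sigma>))" for f
    by (simp add: spin_avg_def)
  show "bond_sum N A u = (\<Sum>X\<in>Pow (edges N). u ^ card X * complex_of_real (c X))" for u
    unfolding bond_sum_def c_def of_real_avg a_def
    by (simp add: prod_add spin_avg_sum prod.distrib spin_avg_cmult)
  show "spin_avg N (bond_weight N (\<lambda>i j. u * A i j)) = (\<Sum>X\<in>Pow (edges N). u ^ card X * c X)" for u
  proof -
    have "bond_weight N (\<lambda>i j. u * A i j) = (\<lambda>\<sigma>. \<Prod>e\<in>edges N. u * (A (fst e) (snd e) * \<sigma> (fst e) * \<sigma> (snd e)) + 1)"
      by (simp add: bond_weight_def fun_eq_iff add.commute mult.assoc)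
    then show ?thesis unfolding c_def a_def
      by (simp add: prod_add spin_avg_sum prod.distrib[of "\<lambda>_. u"] spin_avg_cmult)
  qed
qed

lemma bond_sum_of_real:
  assumes A: "\<And>e. e \<in> edges N \<Longrightarrow> A (fst e) (snd e) \<ge> 0"
  shows "bond_sum N A (complex_of_real u) = complex_of_real (spin_avg N (bond_weight N (\<lambda>i j. u * A i j)))"
proof -
  obtain c where "\<And>u. bond_sum N A u = (\<Sum>X\<in>Pow (edges N). u ^ card X * complex_of_real (c X))"
    "\<And>u. spin_avg N (bond_weight N (\<lambda>i j. u * A i j)) = (\<Sum>X\<in>Pow (edges N). u ^ card X * c X)"
    using bond_sum_expansion[of N A] A by blast
  then show ?thesis by simp
qed

lemma bond_sum_ge_one:
  assumes A: "\<And>e. e \<in> edges N \<Longrightarrow> A (fst e) (snd e) \<ge> 0" and u: "u \<ge> 0"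
  shows "1 \<le> spin_avg N (bond_weight N (\<lambda>i j. u * A i j))"
proof -
  obtain c where c: "\<And>X. X \<subseteq> edges N \<Longrightarrow> c X \<ge> 0" "c {} = 1"
    "spin_avg N (bond_weight N (\<lambda>i j. u * A i j)) = (\<Sum>X\<in>Pow (edges N). u ^ card X * c X)"
    using bond_sum_expansion[of N A] A by blast
  have "(\<Sum>X\<in>{{}}. u ^ card X * c X) \<le> (\<Sum>X\<in>Pow (edges N). u ^ card X * c X)"
    using c u by (intro sum_mono2) auto
  then show ?thesis using c by simp
qed

text \<open>Apply the majorant of each power coefficientwise. The denominator is at least 1 because the
constant coefficient is 1 and the others are non-negative.\<close>

lemma bond_sum_ratio:
  assumes A: "\<And>e. e \<in> edges N \<Longrightarrow> A (fst e) (snd e) \<ge> 0"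
    and u: "0 \<le> u" "u \<le> m" "norm v \<le> m" "m < b"
  shows "norm (bond_sum N A v / bond_sum N A (complex_of_real u) - 1)
    \<le> norm (v - complex_of_real u) / (b - m) * spin_avg N (bond_weight N (\<lambda>i j. b * A i j))"
proof -
  obtain c where c: "\<And>X. X \<subseteq> edges N \<Longrightarrow> c X \<ge> 0" "c {} = 1"
    "\<And>u. bond_sum N A u = (\<Sum>X\<in>Pow (edges N). u ^ card X * complex_of_real (c X))"
    "spin_avg N (bond_weight N (\<lambda>i j. b * A i j)) = (\<Sum>X\<in>Pow (edges N). b ^ card X * c X)"
    using bond_sum_expansion[of N A] A by blast
  let ?u = "complex_of_real u"
  have m: "m \<ge> 0" using u by linarith
  have "norm (bond_sum N A ?u) \<ge> 1"
    using bond_sum_of_real[of N A u] bond_sum_ge_one[of N A u] A u(1) by simp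
  then have Z: "bond_sum N A ?u \<noteq> 0" "1 \<le> norm (bond_sum N A ?u)" by auto
  have "norm (bond_sum N A v - bond_sum N A ?u) = norm (\<Sum>X\<in>Pow (edges N). (v ^ card X - ?u ^ card X) * complex_of_real (c X))"
    by (simp add: c(3) sum_subtractf[symmetric] left_diff_distrib)
  also have "\<dots> \<le> (\<Sum>X\<in>Pow (edges N). norm (v ^ card X - ?u ^ card X) * c X)"
    using c(1) by (intro sum_norm_le) (auto simp: norm_mult)
  also have "\<dots> \<le> (\<Sum>X\<in>Pow (edges N). (norm (v - ?u) / (b - m) * b ^ card X) * c X)"
  proof (intro sum_mono mult_right_mono)
    fix X assume X: "X \<in> Pow (edges N)"
    have "norm (v ^ card X - ?u ^ card X) * (b - m) \<le> norm (v - ?u) * (b ^ card X - m ^ card X)"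
      using u by (intro norm_power_diff_majorant) auto
    also have "\<dots> \<le> norm (v - ?u) * b ^ card X" using m by (intro mult_left_mono) auto
    finally show "norm (v ^ card X - ?u ^ card X) \<le> norm (v - ?u) / (b - m) * b ^ card X"
      using u by (simp add: field_simps)
    show "0 \<le> c X" using c(1) X by simp
  qed
  also have "\<dots> = norm (v - ?u) / (b - m) * spin_avg N (bond_weight N (\<lambda>i j. b * A i j))"
    by (simp add: c(4) sum_distrib_left mult.assoc)
  finally have d: "norm (bond_sum N A v - bond_sum N A ?u) \<le> norm (v - ?u) / (b - m) * spin_avg N (bond_weight N (\<lambda>i j. b * A i j))" .
  have "norm (bond_sum N A v / bond_sum N A ?u - 1) = norm (bond_sum N A v - bond_sum N A ?u) / norm (bond_sum N A ?u)"
    using Z by (simp add: norm_divide[symmetric] diff_divide_distrib)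
  also have "\<dots> \<le> norm (bond_sum N A v - bond_sum N A ?u) / 1"
    using Z by (intro divide_left_mono) auto
  finally show ?thesis using d by simp
qed

section \<open>The partition function at complex inverse temperature\<close>

definition edge_count :: "nat \<Rightarrow> (nat \<Rightarrow> nat \<Rightarrow> real) \<Rightarrow> nat" where
  "edge_count N A = card {e \<in> edges N. A (fst e) (snd e) = 1}"

lemma sum_symmetric_split:
  fixes f :: "nat \<Rightarrow> nat \<Rightarrow> real"
  assumes sym: "\<And>i j. f i j = f j i"
  shows "(\<Sum>i=1..N. \<Sum>j=1..N. f i j) = (\<Sum>i=1..N. f i i) + 2 * (\<Sum>e\<in>edges N. f (fst e) (snd e))"
proof -
  let ?g = "\<lambda>e. f (fst e) (snd e)"
  have split: "{1..N} \<times> {1..N} = ((\<lambda>i. (i, i)) ` {1..N} \<union> edges N) \<union> prod.swap ` edges N"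
  proof -
    have "(i, j) \<in> prod.swap ` edges N" if "(j, i) \<in> edges N" for i j
      using that by (intro image_eqI[of _ _ "(j, i)"]) auto
    then show ?thesis by (force simp: edges_def)
  qed
  have "(\<Sum>i=1..N. \<Sum>j=1..N. f i j) = sum ?g ({1..N} \<times> {1..N})"
    by (simp add: sum.cartesian_product split_beta)
  also have "\<dots> = sum ?g ((\<lambda>i. (i, i)) ` {1..N}) + sum ?g (edges N) + sum ?g (prod.swap ` edges N)"
  proof -
    have "((\<lambda>i. (i, i)) ` {1..N} \<union> edges N) \<inter> prod.swap ` edges N = {}" "(\<lambda>i. (i, i)) ` {1..N} \<inter> edges N = {}"
      by (auto simp: edges_def)
    then show ?thesis unfolding split by (simp add: sum.union_disjoint)
  qed
  also have "sum ?g ((\<lambda>i. (i, i)) ` {1..N}) = (\<Sum>i=1..N. f i i)"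
    by (subst sum.reindex) (auto simp: inj_on_def)
  also have "sum ?g (prod.swap ` edges N) = sum ?g (edges N)"
    by (subst sum.reindex) (auto intro!: sum.cong sym)
  finally show ?thesis by simp
qed

definition diagonal_sum :: "nat \<Rightarrow> (nat \<Rightarrow> nat \<Rightarrow> real) \<Rightarrow> real" where
  "diagonal_sum N A = (\<Sum>i=1..N. A i i)"

definition graph_matrix :: "(nat \<Rightarrow> nat \<Rightarrow> real) \<Rightarrow> bool" where
  "graph_matrix A \<longleftrightarrow> (\<forall>i j. A i j = A j i \<and> A i j \<in> {0, 1})"

lemma sum_graph_matrix:
  assumes A: "graph_matrix A"
  shows "(\<Sum>e\<in>edges N. A (fst e) (snd e)) = real (edge_count N A)"
    and "(\<Sum>i=1..N. \<Sum>j=1..N. A i j) = diagonal_sum N A + 2 * real (edge_count N A)"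
proof -
  have "A i j = of_bool (A i j = 1)" for i j using A by (auto simp: graph_matrix_def)
  then have "(\<Sum>e\<in>edges N. A (fst e) (snd e)) = (\<Sum>e\<in>edges N. of_bool (A (fst e) (snd e) = 1))"
    by (intro sum.cong refl)
  then show e: "(\<Sum>e\<in>edges N. A (fst e) (snd e)) = real (edge_count N A)"
    by (simp add: edge_count_def Int_def)
  have "A i j = A j i" for i j using A by (simp add: graph_matrix_def)
  from sum_symmetric_split[of A, OF this] e
  show "(\<Sum>i=1..N. \<Sum>j=1..N. A i j) = diagonal_sum N A + 2 * real (edge_count N A)"
    by (simp add: diagonal_sum_def)
qed

lemma exp_bond:
  fixes \<kappa> :: complex
  assumes c: "cosh \<kappa> \<noteq> 0" and s: "s = 1 \<or> s = (-1 :: real)"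
  shows "exp (\<kappa> * complex_of_real s) = cosh \<kappa> * (tanh \<kappa> * complex_of_real s + 1)"
proof -
  have "exp \<kappa> = cosh \<kappa> + sinh \<kappa>" "exp (- \<kappa>) = cosh \<kappa> - sinh \<kappa>"
    by (simp_all add: cosh_plus_sinh cosh_minus_sinh)
  then show ?thesis using s c by (elim disjE) (simp_all add: tanh_def distrib_left right_diff_distrib)
qed

text \<open>The classical identity \<open>exp (\<kappa> s) = cosh \<kappa> (1 + s tanh \<kappa>)\<close> for \<open>s = \<plusminus>1\<close>, applied to every edge. A loop
contributes the constant \<open>exp (\<kappa> / 2)\<close> because \<open>\<sigma>\<^sub>i\<^sup>2 = 1\<close>.\<close>

lemma partition_factorization:
  fixes z :: complex
  assumes A: "graph_matrix A" and N: "N \<ge> 1" and \<theta>: "\<theta> > 0"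
    and \<kappa>: "\<kappa> = z / complex_of_real (real N * \<theta>)" "cosh \<kappa> \<noteq> 0"
  shows "spin_avg N (\<lambda>\<sigma>. exp (- z * complex_of_real (hamiltonian N \<theta> A \<sigma>)))
    = exp (\<kappa> * complex_of_real (diagonal_sum N A) / 2) * cosh \<kappa> ^ edge_count N A * bond_sum N A (tanh \<kappa>)"
proof -
  have "exp (- z * complex_of_real (hamiltonian N \<theta> A \<sigma>)) =
      (exp (\<kappa> * complex_of_real (diagonal_sum N A) / 2) * cosh \<kappa> ^ edge_count N A) *
      (\<Prod>e\<in>edges N. tanh \<kappa> * complex_of_real (A (fst e) (snd e) * \<sigma> (fst e) * \<sigma> (snd e)) + 1)"
    if s: "\<sigma> \<in> spins N" for \<sigma>
  proof -
    let ?f = "\<lambda>e. A (fst e) (snd e) * \<sigma> (fst e) * \<sigma> (snd e)"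
    have "(\<Sum>i=1..N. \<Sum>j=1..N. A i j * \<sigma> i * \<sigma> j) = (\<Sum>i=1..N. A i i * \<sigma> i * \<sigma> i) + 2 * sum ?f (edges N)"
      using A by (intro sum_symmetric_split) (simp add: graph_matrix_def mult_ac)
    also have "(\<Sum>i=1..N. A i i * \<sigma> i * \<sigma> i) = diagonal_sum N A"
      unfolding diagonal_sum_def using s by (intro sum.cong refl) (simp add: mult.assoc)
    finally have H: "hamiltonian N \<theta> A \<sigma> = - (1 / (2 * real N * \<theta>)) * (diagonal_sum N A + 2 * sum ?f (edges N))"
      by (simp add: hamiltonian_def)
    have "- z * complex_of_real (hamiltonian N \<theta> A \<sigma>) =
        \<kappa> * complex_of_real (diagonal_sum N A) / 2 + (\<Sum>e\<in>edges N. \<kappa> * complex_of_real (?f e))"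
      unfolding H \<kappa> sum_distrib_left[symmetric] of_real_sum[symmetric] using N \<theta> by (simp add: field_simps)
    then have "exp (- z * complex_of_real (hamiltonian N \<theta> A \<sigma>)) =
        exp (\<kappa> * complex_of_real (diagonal_sum N A) / 2) * (\<Prod>e\<in>edges N. exp (\<kappa> * complex_of_real (?f e)))"
      by (simp add: exp_add exp_sum)
    also have "(\<Prod>e\<in>edges N. exp (\<kappa> * complex_of_real (?f e))) =
        (\<Prod>e\<in>edges N. (if A (fst e) (snd e) = 1 then cosh \<kappa> else 1) * (tanh \<kappa> * complex_of_real (?f e) + 1))"
    proof (rule prod.cong)
      fix e assume "e \<in> edges N"
      then have "fst e \<in> {1..N}" "snd e \<in> {1..N}" using edges_subset by force+
      then have "\<sigma> (fst e) * \<sigma> (snd e) = 1 \<or> \<sigma> (fst e) * \<sigma> (snd e) = -1"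
        using spin_values[OF s, of "fst e"] spin_values[OF s, of "snd e"] by auto
      moreover have "A (fst e) (snd e) = 0 \<or> A (fst e) (snd e) = 1" using A by (auto simp: graph_matrix_def)
      ultimately show "exp (\<kappa> * complex_of_real (?f e)) =
          (if A (fst e) (snd e) = 1 then cosh \<kappa> else 1) * (tanh \<kappa> * complex_of_real (?f e) + 1)"
        using exp_bond[OF \<kappa>(2), of "?f e"] by (auto simp: mult.assoc)
    qed simp
    also have "\<dots> = (\<Prod>e\<in>edges N. if A (fst e) (snd e) = 1 then cosh \<kappa> else 1) *
        (\<Prod>e\<in>edges N. tanh \<kappa> * complex_of_real (?f e) + 1)"
      by (rule prod.distrib)
    also have "(\<Prod>e\<in>edges N. if A (fst e) (snd e) = 1 then cosh \<kappa> else 1) = cosh \<kappa> ^ edge_count N A"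
      by (simp add: prod.If_cases edge_count_def Int_def)
    finally show ?thesis by (simp only: mult.assoc)
  qed
  then have "spin_avg N (\<lambda>\<sigma>. exp (- z * complex_of_real (hamiltonian N \<theta> A \<sigma>))) = spin_avg N (\<lambda>\<sigma>.
      (exp (\<kappa> * complex_of_real (diagonal_sum N A) / 2) * cosh \<kappa> ^ edge_count N A) *
      (\<Prod>e\<in>edges N. tanh \<kappa> * complex_of_real (A (fst e) (snd e) * \<sigma> (fst e) * \<sigma> (snd e)) + 1))"
    by (rule spin_avg_cong)
  then show ?thesis by (simp only: spin_avg_cmult bond_sum_def)
qed

lemma ising_characteristic_function:
  "measure_pmf.expectation (ising_pmf N \<theta> A \<beta>) (\<lambda>\<sigma>. exp (\<i> * complex_of_real (s * hamiltonian N \<theta> A \<sigma>)))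
    = spin_avg N (\<lambda>\<sigma>. exp (- (complex_of_real \<beta> - \<i> * complex_of_real s) * complex_of_real (hamiltonian N \<theta> A \<sigma>)))
      / spin_avg N (\<lambda>\<sigma>. exp (- complex_of_real \<beta> * complex_of_real (hamiltonian N \<theta> A \<sigma>)))"
proof -
  define Z where "Z = (\<Sum>\<sigma>\<in>spins N. exp (- \<beta> * hamiltonian N \<theta> A \<sigma>))"
  have "measure_pmf.expectation (ising_pmf N \<theta> A \<beta>) (\<lambda>\<sigma>. exp (\<i> * complex_of_real (s * hamiltonian N \<theta> A \<sigma>)))
    = (\<Sum>\<sigma>\<in>spins N. pmf (ising_pmf N \<theta> A \<beta>) \<sigma> *\<^sub>R exp (\<i> * complex_of_real (s * hamiltonian N \<theta> A \<sigma>)))"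
    by (rule integral_measure_pmf[OF finite_spins]) (auto simp: set_pmf_iff pmf_ising_pmf ising_mass_def split: if_splits)
  also have "\<dots> = (\<Sum>\<sigma>\<in>spins N. exp (- (complex_of_real \<beta> - \<i> * complex_of_real s) * complex_of_real (hamiltonian N \<theta> A \<sigma>)) / complex_of_real Z)"
  proof (rule sum.cong)
    fix \<sigma> assume s: "\<sigma> \<in> spins N"
    have "pmf (ising_pmf N \<theta> A \<beta>) \<sigma> = exp (- \<beta> * hamiltonian N \<theta> A \<sigma>) / Z"
      using s by (simp add: pmf_ising_pmf ising_mass_def partition_function_def Z_def)
    moreover have "exp (- (complex_of_real \<beta> - \<i> * complex_of_real s) * complex_of_real (hamiltonian N \<theta> A \<sigma>))
      = complex_of_real (exp (- \<beta> * hamiltonian N \<theta> A \<sigma>)) * exp (\<i> * complex_of_real (s * hamiltonian N \<theta> A \<sigma>))"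
      unfolding exp_of_real[symmetric] exp_add[symmetric] by (simp add: algebra_simps)
    ultimately show "pmf (ising_pmf N \<theta> A \<beta>) \<sigma> *\<^sub>R exp (\<i> * complex_of_real (s * hamiltonian N \<theta> A \<sigma>))
      = exp (- (complex_of_real \<beta> - \<i> * complex_of_real s) * complex_of_real (hamiltonian N \<theta> A \<sigma>)) / complex_of_real Z"
      by (simp add: scaleR_conv_of_real)
  qed simp
  also have "\<dots> = (\<Sum>\<sigma>\<in>spins N. exp (- (complex_of_real \<beta> - \<i> * complex_of_real s) * complex_of_real (hamiltonian N \<theta> A \<sigma>))) / complex_of_real Z"
    by (simp add: sum_divide_distrib)
  also have "complex_of_real Z = (\<Sum>\<sigma>\<in>spins N. exp (- complex_of_real \<beta> * complex_of_real (hamiltonian N \<theta> A \<sigma>)))"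
    unfolding Z_def of_real_sum exp_of_real[symmetric] by simp
  finally show ?thesis by (simp add: spin_avg_def)
qed

section \<open>Limits along the sequence of graphs\<close>

locale sparse_ising =
  fixes W :: "real \<Rightarrow> real \<Rightarrow> real" and \<theta> :: "nat \<Rightarrow> real" and \<beta>\<^sub>0 t :: real
  assumes graphon: "graphon W"
    and riemann: "(\<lambda>(x, y). W x y) riemann_integrable_on ({0..1} \<times> {0..1})"
    and \<theta>_range: "\<And>N. N \<ge> 1 \<Longrightarrow> 0 < \<theta> N \<and> \<theta> N < 1"
    and growth: "\<exists>C>0. \<forall>\<^sub>F N in sequentially. real N powr (2 / 3) * \<theta> N \<ge> C"
    and sparse: "\<theta> \<longlonglongrightarrow> 0"
    and \<beta>\<^sub>0_pos: "0 < \<beta>\<^sub>0" and high_temperature: "\<beta>\<^sub>0 < 1 / op_norm W"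
begin

definition "probs N = (\<lambda>c. \<theta> N * W (real (fst c) / real N) (real (snd c) / real N))"

definition "graph N = coins (probs N) N"

definition "\<beta> N = \<beta>\<^sub>0 + t * sqrt (\<theta> N)"

lemma mean_degree_inverse: "(\<lambda>N. 1 / (real N * \<theta> N)) \<longlonglongrightarrow> 0"
proof -
  obtain C where C: "C > 0" and ev: "\<forall>\<^sub>F N in sequentially. real N powr (2 / 3) * \<theta> N \<ge> C"
    using growth by blast
  show ?thesis
  proof (rule Lim_null_comparison)
    show "(\<lambda>N. 1 / (C * real N powr (1 / 3))) \<longlonglongrightarrow> 0" using C by real_asymp
    show "\<forall>\<^sub>F N in sequentially. norm (1 / (real N * \<theta> N)) \<le> 1 / (C * real N powr (1 / 3))"
      using ev eventually_ge_at_top[of 1]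
    proof eventually_elim
      case (elim N)
      have "C * real N powr (1 / 3) \<le> (real N powr (2 / 3) * \<theta> N) * real N powr (1 / 3)"
        using elim by (intro mult_right_mono) auto
      also have "\<dots> = real N * \<theta> N"
        using elim by (simp add: powr_add[symmetric] mult_ac flip: mult.assoc)
      finally show ?case using C elim \<theta>_range[of N] by (auto intro!: divide_left_mono)
    qed
  qed
qed

text \<open>Up to constants this is the number of edges times the relative error of \<open>cosh_ratio\<close>. The growth
condition keeps \<open>N\<^sup>2 \<theta>\<^sup>3\<close>, the cube of its left-hand side, away from 0.\<close>

lemma quartic_error: "(\<lambda>N. sqrt (\<theta> N) / ((real N)\<^sup>2 * \<theta> N ^ 3)) \<longlonglongrightarrow> 0"
proof -
  obtain C where C: "C > 0" and ev: "\<forall>\<^sub>F N in sequentially. real N powr (2 / 3) * \<theta> N \<ge> C"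
    using growth by blast
  have sq: "(\<lambda>N. sqrt (\<theta> N) / C ^ 3) \<longlonglongrightarrow> sqrt 0 / C ^ 3"
    using C by (intro tendsto_intros sparse) auto
  show ?thesis
  proof (rule Lim_null_comparison)
    show "(\<lambda>N. sqrt (\<theta> N) / C ^ 3) \<longlonglongrightarrow> 0" using sq by simp
    show "\<forall>\<^sub>F N in sequentially. norm (sqrt (\<theta> N) / ((real N)\<^sup>2 * \<theta> N ^ 3)) \<le> sqrt (\<theta> N) / C ^ 3"
      using ev eventually_ge_at_top[of 1]
    proof eventually_elim
      case (elim N)
      have "C ^ 3 \<le> (real N powr (2 / 3) * \<theta> N) ^ 3"
        using elim C by (intro power_mono) auto
      also have "\<dots> = (real N)\<^sup>2 * \<theta> N ^ 3"
        using elim by (simp add: power_mult_distrib powr_power)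
      finally have "C ^ 3 \<le> (real N)\<^sup>2 * \<theta> N ^ 3" .
      then show ?case using C elim \<theta>_range[of N] by (auto intro!: divide_left_mono)
    qed
  qed
qed

lemma sqrt_\<theta>_tendsto: "(\<lambda>N. sqrt (\<theta> N)) \<longlonglongrightarrow> 0"
  using tendsto_real_sqrt[OF sparse] by simp

lemma \<beta>_tendsto: "\<beta> \<longlonglongrightarrow> \<beta>\<^sub>0"
  unfolding \<beta>_def using tendsto_add[OF tendsto_const tendsto_mult[OF tendsto_const sqrt_\<theta>_tendsto], of \<beta>\<^sub>0 t] by simp

lemma probs_range: "c \<in> vertex_pairs N \<Longrightarrow> probs N c \<in> {0..\<theta> N}"
proof -
  assume c: "c \<in> vertex_pairs N"
  then have "fst c \<in> {1..N}" "snd c \<in> {1..N}" "N \<ge> 1" by (auto simp: vertex_pairs_def)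
  then show ?thesis
    using grid_point_graphon[OF graphon, of "fst c" N "snd c"] \<theta>_range[of N]
    by (auto simp: probs_def mult_left_le)
qed

lemma probs_unit: "c \<in> vertex_pairs N \<Longrightarrow> probs N c \<in> {0..1}"
  using probs_range[of c N] \<theta>_range[of N] by (cases "N = 0") (force simp: vertex_pairs_def)+

lemma finite_graph [simp]: "finite (set_pmf (graph N))"
  by (simp add: graph_def)

lemma grid_error_tendsto: "borel_version W V \<Longrightarrow> grid_error W V \<longlonglongrightarrow> 0"
  unfolding grid_error_def using cell_mass_close[OF _ riemann] .

lemma op_norm_pos: "op_norm W > 0"
  using \<beta>\<^sub>0_pos high_temperature
  by (metis divide_nonneg_nonpos less_asym linorder_not_less order_less_le_trans zero_le_one)

lemma ex_larger_temperature: "\<exists>b>\<beta>\<^sub>0. b * op_norm W < 1"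
proof -
  obtain b where b: "\<beta>\<^sub>0 < b" "b < 1 / op_norm W" using dense[OF high_temperature] by blast
  then show ?thesis using op_norm_pos by (auto simp: field_simps)
qed

text \<open>The deterministic mean-field model with bonds \<open>b W (i/N, j/N) / N\<close>. Its trace is at most \<open>b\<close> and its
squared Frobenius norm at most \<open>b\<^sup>2\<close>, uniformly in \<open>N\<close>.\<close>

lemma mean_field_bounded:
  assumes b: "b > 0" "b * op_norm W < 1"
  shows "\<exists>K. \<forall>\<^sub>F N in sequentially.
    spin_avg N (bond_weight N (\<lambda>i j. b / real N * W (real i / real N) (real j / real N))) \<le> K"
proof -
  obtain V where V: "borel_version W V" using ex_borel_version[OF graphon] by blast
  \<comment> \<open>halfway between the limiting norm and 1, so that the grid error fits in between\<close>
  define c where "c = (1 + b * op_norm W) / 2"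
  have c: "0 \<le> c" "c < 1" "b * op_norm W < c" using b op_norm_pos by (auto simp: c_def intro!: add_nonneg_nonneg)
  have "(\<lambda>N. b * (op_norm W + sqrt (grid_error W V N))) \<longlonglongrightarrow> b * (op_norm W + sqrt 0)"
    by (intro tendsto_intros grid_error_tendsto V)
  then have "\<forall>\<^sub>F N in sequentially. b * (op_norm W + sqrt (grid_error W V N)) < c"
    using c(3) by (intro order_tendstoD) auto
  then have "\<forall>\<^sub>F N in sequentially. spin_avg N (bond_weight N (\<lambda>i j. b / real N * W (real i / real N) (real j / real N)))
      \<le> exp (b + b\<^sup>2 / (1 - c))"
    using eventually_ge_at_top[of "1::nat"]
  proof eventually_elim
    case (elim N)
    note N = elim(2)
    let ?w = "\<lambda>i j. b / real N * W (real i / real N) (real j / real N)"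
    have w: "?w i j \<ge> 0 \<and> ?w i j = ?w j i" "?w i j \<le> b / real N" if "i \<in> {1..N}" "j \<in> {1..N}" for i j
      using grid_point_graphon[OF graphon that] b N by (auto simp: mult_left_le intro!: divide_right_mono)
    have "spin_avg N (bond_weight N ?w)
      \<le> exp ((\<Sum>i=1..N. ?w i i) + (\<Sum>i=1..N. \<Sum>j=1..N. (?w i j)\<^sup>2) / (1 - c))"
    proof (rule spin_avg_bond_weight_bound[OF w(1) c(1,2)])
      fix v
      have "L2_set (\<lambda>i. \<Sum>j=1..N. ?w i j * v j) {1..N}
        = L2_set (\<lambda>i. b * (\<Sum>j=1..N. W (real i / real N) (real j / real N) / real N * v j)) {1..N}"
        by (simp add: sum_distrib_left mult_ac)
      also have "\<dots> = b * L2_set (\<lambda>i. \<Sum>j=1..N. W (real i / real N) (real j / real N) / real N * v j) {1..N}"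
        using b by (subst L2_set_right_distrib) auto
      also have "\<dots> \<le> b * ((op_norm W + sqrt (grid_error W V N)) * L2_set v {1..N})"
        using b by (intro mult_left_mono grid_matrix_norm[OF graphon N V]) auto
      also have "\<dots> \<le> c * L2_set v {1..N}"
        unfolding mult.assoc[symmetric] using elim(1) by (intro mult_right_mono) auto
      finally show "L2_set (\<lambda>i. \<Sum>j=1..N. ?w i j * v j) {1..N} \<le> c * L2_set v {1..N}" .
    qed
    also have "\<dots> \<le> exp (b + b\<^sup>2 / (1 - c))"
    proof -
      have "(\<Sum>i=1..N. ?w i i) \<le> (\<Sum>i=1..N. b / real N)" by (intro sum_mono w(2))
      also have "\<dots> = b" using N by simp
      finally have 1: "(\<Sum>i=1..N. ?w i i) \<le> b" .
      have "(\<Sum>i=1..N. \<Sum>j=1..N. (?w i j)\<^sup>2) \<le> (\<Sum>i=1..N. \<Sum>j=1..N. (b / real N)\<^sup>2)"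
        using w by (intro sum_mono power_mono) blast+
      also have "\<dots> = b\<^sup>2" using N by (simp add: power2_eq_square)
      finally have "(\<Sum>i=1..N. \<Sum>j=1..N. (?w i j)\<^sup>2) / (1 - c) \<le> b\<^sup>2 / (1 - c)"
        using c by (intro divide_right_mono) auto
      with 1 show ?thesis by simp
    qed
    finally show ?case .
  qed
  then show ?thesis by blast
qed

lemma expected_bond_weight_bounded:
  assumes b: "b > 0" "b * op_norm W < 1"
  shows "\<exists>K. \<forall>\<^sub>F N in sequentially. measure_pmf.expectation (graph N)
    (\<lambda>g. spin_avg N (bond_weight N (\<lambda>i j. b / (real N * \<theta> N) * adjacency g i j))) \<le> K"
proof -
  obtain K where K: "\<forall>\<^sub>F N in sequentially.
    spin_avg N (bond_weight N (\<lambda>i j. b / real N * W (real i / real N) (real j / real N))) \<le> K"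
    using mean_field_bounded[OF b] by blast
  have "(\<lambda>N. b * (1 / (real N * \<theta> N))) \<longlonglongrightarrow> b * 0"
    by (intro tendsto_intros mean_degree_inverse)
  then have "\<forall>\<^sub>F N in sequentially. b * (1 / (real N * \<theta> N)) < 1"
    by (intro order_tendstoD) auto
  with K have "\<forall>\<^sub>F N in sequentially. measure_pmf.expectation (graph N)
    (\<lambda>g. spin_avg N (bond_weight N (\<lambda>i j. b / (real N * \<theta> N) * adjacency g i j))) \<le> K"
    using eventually_ge_at_top[of "1::nat"]
  proof eventually_elim
    case (elim N)
    have \<theta>: "0 < \<theta> N" using \<theta>_range elim by auto
    have "measure_pmf.expectation (graph N)
      (\<lambda>g. spin_avg N (bond_weight N (\<lambda>i j. b / (real N * \<theta> N) * adjacency g i j)))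
      = spin_avg N (bond_weight N (\<lambda>i j. b / (real N * \<theta> N) * probs N (i, j)))"
      unfolding graph_def using elim \<theta> b edges_subset_pairs[of N]
      by (intro expectation_bond_weight probs_unit) auto
    also have "(\<lambda>i j. b / (real N * \<theta> N) * probs N (i, j)) = (\<lambda>i j. b / real N * W (real i / real N) (real j / real N))"
      using \<theta> by (simp add: probs_def fun_eq_iff)
    finally show ?case using elim by simp
  qed
  then show ?thesis by blast
qed

lemma adjacency_graph_matrix: "graph_matrix (adjacency g)"
  by (auto simp: graph_matrix_def adjacency_def min_def max_def)

lemma edge_count_adjacency: "real (edge_count N (adjacency g)) = (\<Sum>e\<in>edges N. of_bool (g e))"
  unfolding sum_graph_matrix(1)[OF adjacency_graph_matrix, symmetric]
  by (intro sum.cong refl) (auto simp: adjacency_def edges_def)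

lemma expected_diagonal_sum: "measure_pmf.expectation (graph N) (\<lambda>g. diagonal_sum N (adjacency g)) \<le> real N * \<theta> N"
proof -
  have i: "integrable (measure_pmf (graph N)) f" for f :: "(nat \<times> nat \<Rightarrow> bool) \<Rightarrow> real"
    by (rule integrable_measure_pmf_finite) simp
  have "measure_pmf.expectation (graph N) (\<lambda>g. diagonal_sum N (adjacency g))
    = (\<Sum>i=1..N. measure_pmf.expectation (graph N) (\<lambda>g. of_bool (g (i, i))))"
    unfolding diagonal_sum_def adjacency_def min.idem max.idem
    by (rule Bochner_Integration.integral_sum) (rule i)
  also have "\<dots> = (\<Sum>i=1..N. probs N (i, i))"
    unfolding graph_def
    by (intro sum.cong refl expectation_coin probs_unit) (auto simp: vertex_pairs_def)
  also have "\<dots> \<le> (\<Sum>i=1..N. \<theta> N)"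
  proof (rule sum_mono)
    fix i assume "i \<in> {1..N}"
    then have "(i, i) \<in> vertex_pairs N" by (auto simp: vertex_pairs_def)
    from probs_range[OF this] show "probs N (i, i) \<le> \<theta> N" by simp
  qed
  finally show ?thesis by simp
qed

lemma diagonal_sum_nonneg: "0 \<le> diagonal_sum N (adjacency g)"
  by (auto simp: diagonal_sum_def adjacency_def intro!: sum_nonneg)

definition "mean_edges N = (\<Sum>e\<in>edges N. W (real (fst e) / real N) (real (snd e) / real N)) / (real N)\<^sup>2"

lemma mean_edges_tendsto: "mean_edges \<longlonglongrightarrow> graphon_integral W / 2"
proof -
  obtain V where V: "borel_version W V" using ex_borel_version[OF graphon] by blast
  let ?w = "\<lambda>N i j. W (real i / real N) (real j / real N)"
  have "(\<lambda>N. (graphon_integral W - 2 * mean_edges N)) \<longlonglongrightarrow> 0"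
  proof (rule Lim_null_comparison)
    have "(\<lambda>N. grid_error W V N + 1 / real N) \<longlonglongrightarrow> 0 + 0"
      by (intro tendsto_add grid_error_tendsto V) real_asymp
    then show "(\<lambda>N. grid_error W V N + 1 / real N) \<longlonglongrightarrow> 0" by simp
    show "\<forall>\<^sub>F N in sequentially. norm (graphon_integral W - 2 * mean_edges N) \<le> grid_error W V N + 1 / real N"
      using eventually_ge_at_top[of "1::nat"]
    proof eventually_elim
      case (elim N)
      have "(\<Sum>i=1..N. \<Sum>j=1..N. ?w N i j / (real N)\<^sup>2) - graphon_integral W
        = (\<Sum>i=1..N. \<Sum>j=1..N. ?w N i j / (real N)\<^sup>2 - cell_mass V N (i, j))"
        unfolding sum_cell_mass[OF elim V, symmetric] by (simp add: sum_subtractf sum.cartesian_product)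
      also have "\<bar>\<dots>\<bar> \<le> grid_error W V N"
        unfolding grid_error_def by (rule order_trans[OF sum_abs], rule sum_mono, rule sum_abs)
      finally have 1: "\<bar>(\<Sum>i=1..N. \<Sum>j=1..N. ?w N i j / (real N)\<^sup>2) - graphon_integral W\<bar> \<le> grid_error W V N" .
      \<comment> \<open>\<open>W\<close> is symmetric on the unit square only, hence the cut-off\<close>
      have "(\<Sum>i=1..N. \<Sum>j=1..N. ?w N i j / (real N)\<^sup>2) =
          (\<Sum>i=1..N. \<Sum>j=1..N. (if i \<in> {1..N} \<and> j \<in> {1..N} then ?w N i j else 0)) / (real N)\<^sup>2"
        by (simp add: sum_divide_distrib)
      also have "(\<Sum>i=1..N. \<Sum>j=1..N. (if i \<in> {1..N} \<and> j \<in> {1..N} then ?w N i j else 0)) =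
          (\<Sum>i=1..N. ?w N i i) + 2 * (\<Sum>e\<in>edges N. if fst e \<in> {1..N} \<and> snd e \<in> {1..N} then ?w N (fst e) (snd e) else 0)"
        using grid_point_graphon(3)[OF graphon]
        by (subst sum_symmetric_split) auto
      also have "(\<Sum>e\<in>edges N. if fst e \<in> {1..N} \<and> snd e \<in> {1..N} then ?w N (fst e) (snd e) else 0)
          = (\<Sum>e\<in>edges N. ?w N (fst e) (snd e))"
        by (intro sum.cong refl) (auto simp: edges_def)
      also have "((\<Sum>i=1..N. ?w N i i) + 2 * (\<Sum>e\<in>edges N. ?w N (fst e) (snd e))) / (real N)\<^sup>2
          = (\<Sum>i=1..N. ?w N i i) / (real N)\<^sup>2 + 2 * mean_edges N"
        by (simp add: mean_edges_def add_divide_distrib)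
      finally have 2: "(\<Sum>i=1..N. \<Sum>j=1..N. ?w N i j / (real N)\<^sup>2) = (\<Sum>i=1..N. ?w N i i) / (real N)\<^sup>2 + 2 * mean_edges N" .
      have "(\<Sum>i=1..N. ?w N i i) \<le> (\<Sum>i=1..N. 1)" "0 \<le> (\<Sum>i=1..N. ?w N i i)"
        using grid_point_graphon[OF graphon] by (intro sum_mono sum_nonneg; simp)+
      then have "0 \<le> (\<Sum>i=1..N. ?w N i i) / (real N)\<^sup>2" "(\<Sum>i=1..N. ?w N i i) / (real N)\<^sup>2 \<le> real N / (real N)\<^sup>2"
        by (auto intro!: divide_right_mono)
      moreover have "real N / (real N)\<^sup>2 = 1 / real N" by (simp add: power2_eq_square)
      ultimately show ?case using 1 2 by simp
    qed
  qed
  then have "(\<lambda>N. (graphon_integral W - (graphon_integral W - 2 * mean_edges N)) / 2) \<longlonglongrightarrow> (graphon_integral W - 0) / 2"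
    by (intro tendsto_intros) auto
  then show ?thesis by simp
qed

text \<open>The three functions of the graph on which the conditional characteristic function depends,
apart from the two relative errors below.\<close>

definition "edge_ratio N g = real (edge_count N (adjacency g)) / ((real N)\<^sup>2 * \<theta> N)"
definition "loop_shift N g = sqrt (\<theta> N) * diagonal_sum N (adjacency g) / (real N * \<theta> N)"
definition "loop_ratio N g = diagonal_sum N (adjacency g) / ((real N)\<^sup>2 * \<theta> N)"

lemma loop_shift_tendsto: "conv_in_prob graph loop_shift 0"
proof (rule conv_in_prob_L1)
  show "\<forall>\<^sub>F N in sequentially. \<forall>g\<in>set_pmf (graph N). 0 \<le> loop_shift N g"
    using eventually_ge_at_top[of "1::nat"]
    by eventually_elim (use \<theta>_range diagonal_sum_nonneg in \<open>force simp: loop_shift_def\<close>)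
  show "(\<lambda>N. measure_pmf.expectation (graph N) (loop_shift N)) \<longlonglongrightarrow> 0"
  proof (rule tendsto_sandwich[OF _ _ tendsto_const sqrt_\<theta>_tendsto])
    show "\<forall>\<^sub>F N in sequentially. 0 \<le> measure_pmf.expectation (graph N) (loop_shift N)"
      using eventually_ge_at_top[of "1::nat"]
      by eventually_elim (use \<theta>_range diagonal_sum_nonneg in \<open>force simp: loop_shift_def intro!: integral_nonneg_AE\<close>)
    show "\<forall>\<^sub>F N in sequentially. measure_pmf.expectation (graph N) (loop_shift N) \<le> sqrt (\<theta> N)"
      using eventually_ge_at_top[of "1::nat"]
    proof eventually_elim
      case (elim N)
      have \<theta>: "0 < \<theta> N" using \<theta>_range elim by auto
      have "measure_pmf.expectation (graph N) (loop_shift N) =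
        sqrt (\<theta> N) / (real N * \<theta> N) * measure_pmf.expectation (graph N) (\<lambda>g. diagonal_sum N (adjacency g))"
        unfolding loop_shift_def by simp
      also have "\<dots> \<le> sqrt (\<theta> N) / (real N * \<theta> N) * (real N * \<theta> N)"
        using \<theta> by (intro mult_left_mono expected_diagonal_sum) auto
      also have "\<dots> = sqrt (\<theta> N)" using \<theta> elim by simp
      finally show ?case .
    qed
  qed
qed simp

lemma loop_ratio_tendsto: "conv_in_prob graph loop_ratio 0"
proof (rule conv_in_prob_eventually_eq)
  have "(\<lambda>N. sqrt (\<theta> N) * (1 / (real N * \<theta> N))) \<longlonglongrightarrow> 0 * 0"
    by (intro tendsto_mult sqrt_\<theta>_tendsto mean_degree_inverse)
  then have "conv_in_prob graph (\<lambda>N g. loop_shift N g * (sqrt (\<theta> N) * (1 / (real N * \<theta> N)))) (0 * (0 * 0))"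
    by (intro conv_in_prob_mult loop_shift_tendsto conv_in_prob_const)
  then show "conv_in_prob graph (\<lambda>N g. loop_shift N g * (sqrt (\<theta> N) * (1 / (real N * \<theta> N)))) 0" by simp
  show "\<forall>\<^sub>F N in sequentially. \<forall>g\<in>set_pmf (graph N). loop_ratio N g = loop_shift N g * (sqrt (\<theta> N) * (1 / (real N * \<theta> N)))"
    using eventually_ge_at_top[of "1::nat"]
  proof eventually_elim
    case (elim N)
    define q where "q = sqrt (\<theta> N)"
    have "q > 0" "\<theta> N = q\<^sup>2" using \<theta>_range[OF elim] by (simp_all add: q_def)
    then show ?case
      using elim by (simp add: loop_shift_def loop_ratio_def q_def[symmetric] power2_eq_square field_simps)
  qed
qed

text \<open>By Chebyshev's inequality: the variance is at most \<open>1 / (N\<^sup>2 \<theta>)\<close>, and the means are Riemann sums.\<close>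

lemma edge_ratio_tendsto: "conv_in_prob graph edge_ratio (graphon_integral W / 2)"
proof -
  have "conv_in_prob graph (\<lambda>N g. (edge_ratio N g - mean_edges N)\<^sup>2) 0"
  proof (rule conv_in_prob_L1)
    show "(\<lambda>N. measure_pmf.expectation (graph N) (\<lambda>g. (edge_ratio N g - mean_edges N)\<^sup>2)) \<longlonglongrightarrow> 0"
    proof (rule tendsto_sandwich[OF _ _ tendsto_const])
      have "(\<lambda>N. 1 / (real N * \<theta> N) * (1 / real N)) \<longlonglongrightarrow> 0 * 0"
        by (intro tendsto_mult mean_degree_inverse) real_asymp
      then show "(\<lambda>N. 1 / (real N * \<theta> N) * (1 / real N)) \<longlonglongrightarrow> 0" by simp
      show "\<forall>\<^sub>F N in sequentially. measure_pmf.expectation (graph N) (\<lambda>g. (edge_ratio N g - mean_edges N)\<^sup>2)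
          \<le> 1 / (real N * \<theta> N) * (1 / real N)"
        using eventually_ge_at_top[of "1::nat"]
      proof eventually_elim
        case (elim N)
        have \<theta>: "0 < \<theta> N" using \<theta>_range elim by auto
        let ?K = "(real N)\<^sup>2 * \<theta> N"
        have K: "?K > 0" using \<theta> elim by simp
        have mean: "mean_edges N = (\<Sum>e\<in>edges N. probs N e) / ?K"
          using \<theta> elim by (simp add: mean_edges_def probs_def sum_distrib_left[symmetric])
        have "measure_pmf.expectation (graph N) (\<lambda>g. (edge_ratio N g - mean_edges N)\<^sup>2)
          = measure_pmf.expectation (graph N) (\<lambda>g. ((\<Sum>e\<in>edges N. of_bool (g e)) - (\<Sum>e\<in>edges N. probs N e))\<^sup>2 / ?K\<^sup>2)"
          unfolding edge_ratio_def mean edge_count_adjacency by (simp add: diff_divide_distrib[symmetric] power_divide)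
        also have "\<dots> = measure_pmf.expectation (graph N) (\<lambda>g. ((\<Sum>e\<in>edges N. of_bool (g e)) - (\<Sum>e\<in>edges N. probs N e))\<^sup>2) / ?K\<^sup>2"
          by simp
        also have "\<dots> \<le> (\<Sum>e\<in>edges N. probs N e) / ?K\<^sup>2"
          unfolding graph_def using edges_subset_pairs
          by (intro divide_right_mono coins_sum_variance probs_unit) auto
        also have "\<dots> \<le> ?K / ?K\<^sup>2"
        proof (rule divide_right_mono)
          have "(\<Sum>e\<in>edges N. probs N e) \<le> (\<Sum>e\<in>edges N. \<theta> N)"
            using probs_range edges_subset_pairs[of N] by (intro sum_mono) force
          also have "\<dots> \<le> real (card ({1..N} \<times> {1..N})) * \<theta> N"
            using \<theta> card_mono[OF _ edges_subset[of N]] by (simp add: mult_right_mono flip: of_nat_mult)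
          also have "\<dots> = ?K" by (simp add: power2_eq_square)
          finally show "(\<Sum>e\<in>edges N. probs N e) \<le> ?K" .
        qed simp
        also have "\<dots> = 1 / (real N * \<theta> N) * (1 / real N)" using K by (simp add: power2_eq_square)
        finally show ?case .
      qed
    qed (auto intro!: always_eventually integral_nonneg_AE)
  qed auto
  from conv_in_prob_isCont[OF this, of sqrt]
  have "conv_in_prob graph (\<lambda>N g. \<bar>edge_ratio N g - mean_edges N\<bar>) 0"
    using isCont_real_sqrt[of 0] by simp
  then have "conv_in_prob graph (\<lambda>N g. edge_ratio N g - mean_edges N) 0"
    by (rule conv_in_prob_dominated) simp
  from conv_in_prob_add[OF this conv_in_prob_const[OF mean_edges_tendsto]]
  show ?thesis by simp
qed

end

section \<open>The characteristic function given the graph\<close>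

lemma norm_one_plus_power_minus_one:
  fixes z :: complex
  shows "norm ((1 + z) ^ n - 1) \<le> exp (real n * norm z) - 1"
proof (induction n)
  case (Suc n)
  have "norm ((1 + z) ^ Suc n - 1) = norm ((1 + z) * ((1 + z) ^ n - 1) + z)"
    by (simp add: algebra_simps)
  also have "\<dots> \<le> norm (1 + z) * norm ((1 + z) ^ n - 1) + norm z"
    by (intro norm_triangle_le add_mono) (auto simp: norm_mult)
  also have "\<dots> \<le> (1 + norm z) * (exp (real n * norm z) - 1) + norm z"
    using Suc norm_triangle_ineq[of 1 z] by (intro add_right_mono mult_mono) auto
  also have "\<dots> = (1 + norm z) * exp (real n * norm z) - 1" by (simp add: algebra_simps)
  also have "\<dots> \<le> exp (norm z) * exp (real n * norm z) - 1"
    by (intro diff_right_mono mult_right_mono exp_ge_add_one_self) auto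
  also have "\<dots> = exp (real (Suc n) * norm z) - 1" by (simp add: exp_add[symmetric] algebra_simps)
  finally show ?case .
qed simp

lemma conv_in_prob_of_real:
  "conv_in_prob M X c \<Longrightarrow> conv_in_prob M (\<lambda>n \<omega>. complex_of_real (X n \<omega>)) (complex_of_real c)"
  by (erule conv_in_prob_isCont) (intro continuous_intros)

definition total_sum :: "nat \<Rightarrow> (nat \<Rightarrow> nat \<Rightarrow> real) \<Rightarrow> real" where
  "total_sum N A = (\<Sum>i=1..N. \<Sum>j=1..N. A i j)"

context sparse_ising
begin

text \<open>The arguments \<open>\<beta> / (N \<theta>)\<close> and \<open>(\<beta> - \<i> r \<surd>\<theta>) / (N \<theta>)\<close> of the hyperbolic functions, and the relative
errors of the two corresponding factors of the partition function.\<close>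

definition "real_tilt N = complex_of_real (\<beta> N / (real N * \<theta> N))"
definition "imag_tilt r N = r * sqrt (\<theta> N) / (real N * \<theta> N)"
definition "tilt r N = real_tilt N - \<i> * complex_of_real (imag_tilt r N)"
definition "cosh_defect r N = cosh (tilt r N) / (cosh (real_tilt N) * exp (((tilt r N)\<^sup>2 - (real_tilt N)\<^sup>2) / 2)) - 1"
definition "bond_defect r N g = bond_sum N (adjacency g) (tanh (tilt r N)) / bond_sum N (adjacency g) (tanh (real_tilt N)) - 1"

lemma \<beta>_eventually_pos: "\<forall>\<^sub>F N in sequentially. 0 < \<beta> N"
  using \<beta>_tendsto \<beta>\<^sub>0_pos by (rule order_tendstoD)

lemma tilt_bounds:
  defines "\<rho> \<equiv> \<lambda>r. \<beta>\<^sub>0 + \<bar>t\<bar> + \<bar>r\<bar>"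
  assumes "N \<ge> 1"
  shows "norm (tilt r N) \<le> \<rho> r * (1 / (real N * \<theta> N))" "\<bar>\<beta> N / (real N * \<theta> N)\<bar> \<le> \<rho> r * (1 / (real N * \<theta> N))"
    "norm (tilt r N - real_tilt N) = \<bar>r\<bar> * sqrt (\<theta> N) / (real N * \<theta> N)"
proof -
  have \<theta>: "0 < \<theta> N" "sqrt (\<theta> N) \<le> 1" using \<theta>_range[OF assms(2)] by auto
  have K: "real N * \<theta> N > 0" using \<theta> assms by simp
  have "\<bar>\<beta> N\<bar> \<le> \<bar>\<beta>\<^sub>0\<bar> + \<bar>t * sqrt (\<theta> N)\<bar>" unfolding \<beta>_def by (rule abs_triangle_ineq)
  also have "\<bar>t * sqrt (\<theta> N)\<bar> \<le> \<bar>t\<bar>" using \<theta> by (simp add: abs_mult mult_left_le)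
  finally have b: "\<bar>\<beta> N\<bar> \<le> \<beta>\<^sub>0 + \<bar>t\<bar>" using \<beta>\<^sub>0_pos by simp
  have s: "\<bar>imag_tilt r N\<bar> = \<bar>r\<bar> * sqrt (\<theta> N) / (real N * \<theta> N)"
    using K \<theta> by (simp add: imag_tilt_def abs_mult)
  have s': "\<bar>imag_tilt r N\<bar> \<le> \<bar>r\<bar> * (1 / (real N * \<theta> N))"
    unfolding s using K \<theta> by (simp add: divide_right_mono mult_left_le)
  have b': "\<bar>\<beta> N / (real N * \<theta> N)\<bar> \<le> (\<beta>\<^sub>0 + \<bar>t\<bar>) * (1 / (real N * \<theta> N))"
    using b K \<theta> by (simp add: abs_mult divide_right_mono)
  show "norm (tilt r N - real_tilt N) = \<bar>r\<bar> * sqrt (\<theta> N) / (real N * \<theta> N)"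
    using s by (simp add: tilt_def norm_mult)
  show "\<bar>\<beta> N / (real N * \<theta> N)\<bar> \<le> \<rho> r * (1 / (real N * \<theta> N))"
    using b' K unfolding \<rho>_def distrib_right by (intro order_trans[OF b']) (simp add: distrib_right add_divide_distrib)
  have "norm (tilt r N) \<le> norm (real_tilt N) + norm (\<i> * complex_of_real (imag_tilt r N))"
    unfolding tilt_def by (rule norm_triangle_ineq4)
  also have "\<dots> = \<bar>\<beta> N / (real N * \<theta> N)\<bar> + \<bar>imag_tilt r N\<bar>"
    unfolding real_tilt_def norm_mult norm_of_real by simp
  also have "\<dots> \<le> \<rho> r * (1 / (real N * \<theta> N))"
    using b' s' unfolding \<rho>_def distrib_right by linarith
  finally show "norm (tilt r N) \<le> \<rho> r * (1 / (real N * \<theta> N))" .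
qed

lemma eventually_small_radius:
  "\<forall>\<^sub>F N in sequentially. K * (1 / (real N * \<theta> N)) \<le> 1 / 3"
proof -
  have "(\<lambda>N. K * (1 / (real N * \<theta> N))) \<longlonglongrightarrow> K * 0"
    by (intro tendsto_intros mean_degree_inverse)
  then have "\<forall>\<^sub>F N in sequentially. K * (1 / (real N * \<theta> N)) < 1 / 3"
    by (intro order_tendstoD) auto
  then show ?thesis by eventually_elim simp
qed

lemma eventually_cosh_nonzero:
  "\<forall>\<^sub>F N in sequentially. cosh (tilt r N) \<noteq> 0 \<and> cosh (real_tilt N) \<noteq> 0 \<and>
     norm (tilt r N) \<le> 1 / 3 \<and> norm (real_tilt N) \<le> 1 / 3"
  using eventually_small_radius[of "\<beta>\<^sub>0 + \<bar>t\<bar> + \<bar>r\<bar>"] eventually_ge_at_top[of "1::nat"]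
proof eventually_elim
  case (elim N)
  have "norm (tilt r N) \<le> 1 / 3" "norm (real_tilt N) \<le> 1 / 3"
    using tilt_bounds(1,2)[OF elim(2), of r] elim(1) unfolding real_tilt_def norm_of_real by linarith+
  then show ?case using norm_cosh_ge[of "tilt r N"] norm_cosh_ge[of "real_tilt N"] by auto
qed

lemma cosh_defect_small: "(\<lambda>N. (real N)\<^sup>2 * \<theta> N * norm (cosh_defect r N)) \<longlonglongrightarrow> 0"
proof -
  define \<rho> where "\<rho> = \<beta>\<^sub>0 + \<bar>t\<bar> + \<bar>r\<bar>"
  show ?thesis
  proof (rule Lim_null_comparison)
    have "(\<lambda>N. 12 * \<rho> ^ 3 * \<bar>r\<bar> * (sqrt (\<theta> N) / ((real N)\<^sup>2 * \<theta> N ^ 3))) \<longlonglongrightarrow> 12 * \<rho> ^ 3 * \<bar>r\<bar> * 0"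
      by (intro tendsto_mult tendsto_const quartic_error)
    then show "(\<lambda>N. 12 * \<rho> ^ 3 * \<bar>r\<bar> * (sqrt (\<theta> N) / ((real N)\<^sup>2 * \<theta> N ^ 3))) \<longlonglongrightarrow> 0" by simp
    show "\<forall>\<^sub>F N in sequentially. norm ((real N)\<^sup>2 * \<theta> N * norm (cosh_defect r N))
        \<le> 12 * \<rho> ^ 3 * \<bar>r\<bar> * (sqrt (\<theta> N) / ((real N)\<^sup>2 * \<theta> N ^ 3))"
      using eventually_small_radius[of \<rho>] eventually_ge_at_top[of "1::nat"] eventually_cosh_nonzero[of r]
    proof eventually_elim
      case (elim N)
      have \<theta>: "0 < \<theta> N" using \<theta>_range elim(2) by auto
      let ?R = "\<rho> * (1 / (real N * \<theta> N))"
      note b = tilt_bounds[OF elim(2), of r, folded \<rho>_def]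
      obtain \<epsilon> where \<epsilon>: "cosh (tilt r N) = cosh (real_tilt N) * exp (((tilt r N)\<^sup>2 - (real_tilt N)\<^sup>2) / 2) * (1 + \<epsilon>)"
        "norm \<epsilon> \<le> 12 * ?R ^ 3 * norm (tilt r N - real_tilt N)"
        using cosh_ratio[OF b(1,2) elim(1)] unfolding real_tilt_def by blast
      have "cosh_defect r N = \<epsilon>"
        using elim(3) unfolding cosh_defect_def \<epsilon>(1) by simp
      then have "norm (cosh_defect r N) \<le> 12 * ?R ^ 3 * (\<bar>r\<bar> * sqrt (\<theta> N) / (real N * \<theta> N))"
        using \<epsilon>(2) b(3) by simp
      then have "(real N)\<^sup>2 * \<theta> N * norm (cosh_defect r N) \<le> (real N)\<^sup>2 * \<theta> N * (12 * ?R ^ 3 * (\<bar>r\<bar> * sqrt (\<theta> N) / (real N * \<theta> N)))"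
        using \<theta> by (intro mult_left_mono) auto
      also have "\<dots> = 12 * \<rho> ^ 3 * \<bar>r\<bar> * (sqrt (\<theta> N) / ((real N)\<^sup>2 * \<theta> N ^ 3))"
        using \<theta> elim(2) by (simp add: field_simps power2_eq_square power3_eq_cube)
      finally show ?case using \<theta> by (simp add: abs_mult)
    qed
  qed
qed

lemma cosh_defect_power_tendsto:
  "conv_in_prob graph (\<lambda>N g. (1 + cosh_defect r N) ^ edge_count N (adjacency g)) 1"
proof (rule conv_in_prob_dominated)
  have "conv_in_prob graph (\<lambda>N g. edge_ratio N g * ((real N)\<^sup>2 * \<theta> N * norm (cosh_defect r N))) (graphon_integral W / 2 * 0)"
    by (intro conv_in_prob_mult edge_ratio_tendsto conv_in_prob_const cosh_defect_small)
  then have "conv_in_prob graph (\<lambda>N g. exp (edge_ratio N g * ((real N)\<^sup>2 * \<theta> N * norm (cosh_defect r N))) - 1) (exp (graphon_integral W / 2 * 0) - 1)"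
    by (rule conv_in_prob_isCont) (intro continuous_intros)
  then show "conv_in_prob graph (\<lambda>N g. exp (edge_ratio N g * ((real N)\<^sup>2 * \<theta> N * norm (cosh_defect r N))) - 1) 0" by simp
  show "\<forall>\<^sub>F N in sequentially. \<forall>g\<in>set_pmf (graph N). dist ((1 + cosh_defect r N) ^ edge_count N (adjacency g)) 1
      \<le> exp (edge_ratio N g * ((real N)\<^sup>2 * \<theta> N * norm (cosh_defect r N))) - 1"
    using eventually_ge_at_top[of "1::nat"]
  proof (rule eventually_mono, intro ballI)
    fix N :: nat and g assume "1 \<le> N"
    then have "0 < \<theta> N" using \<theta>_range by auto
    then have "edge_ratio N g * ((real N)\<^sup>2 * \<theta> N * norm (cosh_defect r N)) = real (edge_count N (adjacency g)) * norm (cosh_defect r N)"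
      using \<open>1 \<le> N\<close> by (simp add: edge_ratio_def)
    then show "dist ((1 + cosh_defect r N) ^ edge_count N (adjacency g)) 1 \<le> exp (edge_ratio N g * ((real N)\<^sup>2 * \<theta> N * norm (cosh_defect r N))) - 1"
      using norm_one_plus_power_minus_one[of "cosh_defect r N" "edge_count N (adjacency g)"] by (simp only: dist_norm)
  qed
qed

lemma adjacency_nonneg: "0 \<le> adjacency g i j"
  by (simp add: adjacency_def)

text \<open>The two arguments \<open>tanh (tilt r N)\<close> and \<open>tanh (real_tilt N)\<close> differ by an amount of order
\<open>\<surd>\<theta> / (N \<theta>)\<close>, while the distance of both to the larger coupling \<open>b / (N \<theta>)\<close> is of order
\<open>1 / (N \<theta>)\<close>. At that coupling the expected sum over even subgraphs is bounded.\<close>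

lemma bond_defect_tendsto: "conv_in_prob graph (bond_defect r) 0"
proof -
  obtain b where b: "b > \<beta>\<^sub>0" "b * op_norm W < 1" using ex_larger_temperature by blast
  then have b0: "b > 0" using \<beta>\<^sub>0_pos by linarith
  obtain K where K: "\<forall>\<^sub>F N in sequentially. measure_pmf.expectation (graph N)
    (\<lambda>g. spin_avg N (bond_weight N (\<lambda>i j. b / (real N * \<theta> N) * adjacency g i j))) \<le> K"
    using expected_bond_weight_bounded[OF b0 b(2)] by blast
  \<comment> \<open>the ratio of the displacement of the coupling to its distance from \<open>b / (N \<theta>)\<close>\<close>
  define k where "k = (\<lambda>N. 4 * \<bar>r\<bar> * sqrt (\<theta> N) / (b - (\<beta> N + 4 * \<bar>r\<bar> * sqrt (\<theta> N))))"
  define Z where "Z = (\<lambda>N g. spin_avg N (bond_weight N (\<lambda>i j. b / (real N * \<theta> N) * adjacency g i j)))"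
  have Z1: "1 \<le> Z N g" if "N \<ge> 1" for N g
    unfolding Z_def using adjacency_nonneg b0 \<theta>_range[OF that] by (intro bond_sum_ge_one) auto
  then have Z0: "0 \<le> Z N g" if "N \<ge> 1" for N g
    using that by (meson order_trans zero_le_one)
  have lim: "(\<lambda>N. \<beta> N + 4 * \<bar>r\<bar> * sqrt (\<theta> N)) \<longlonglongrightarrow> \<beta>\<^sub>0 + 4 * \<bar>r\<bar> * 0"
    by (intro tendsto_intros \<beta>_tendsto sqrt_\<theta>_tendsto)
  have gap: "\<forall>\<^sub>F N in sequentially. \<beta> N + 4 * \<bar>r\<bar> * sqrt (\<theta> N) < b"
    using lim b(1) by (intro order_tendstoD) auto
  have k: "k \<longlonglongrightarrow> 4 * \<bar>r\<bar> * 0 / (b - (\<beta>\<^sub>0 + 4 * \<bar>r\<bar> * 0))"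
    unfolding k_def using b(1) by (intro tendsto_intros lim sqrt_\<theta>_tendsto) auto
  have "conv_in_prob graph (\<lambda>N g. k N * Z N g) 0"
  proof (rule conv_in_prob_L1)
    show "\<forall>\<^sub>F N in sequentially. \<forall>g\<in>set_pmf (graph N). 0 \<le> k N * Z N g"
      using gap eventually_ge_at_top[of "1::nat"]
    proof eventually_elim
      case (elim N)
      have "0 \<le> k N" unfolding k_def using elim \<theta>_range[of N] by simp
      then show ?case using Z0[OF elim(2)] by (auto intro!: mult_nonneg_nonneg)
    qed
    show "(\<lambda>N. measure_pmf.expectation (graph N) (\<lambda>g. k N * Z N g)) \<longlonglongrightarrow> 0"
    proof (rule tendsto_sandwich[OF _ _ tendsto_const])
      show "(\<lambda>N. k N * K) \<longlonglongrightarrow> 0" using tendsto_mult[OF k tendsto_const[of K]] by simp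
      show "\<forall>\<^sub>F N in sequentially. 0 \<le> measure_pmf.expectation (graph N) (\<lambda>g. k N * Z N g)"
        using gap eventually_ge_at_top[of "1::nat"]
      proof eventually_elim
        case (elim N)
        have "0 \<le> k N" unfolding k_def using elim \<theta>_range[of N] by simp
        then show ?case using Z0[OF elim(2)]
          by (auto intro!: integral_nonneg_AE mult_nonneg_nonneg)
      qed
      show "\<forall>\<^sub>F N in sequentially. measure_pmf.expectation (graph N) (\<lambda>g. k N * Z N g) \<le> k N * K"
        using gap K eventually_ge_at_top[of "1::nat"]
      proof eventually_elim
        case (elim N)
        have "0 \<le> k N" unfolding k_def using elim \<theta>_range[of N] by simp
        then show ?case using elim(2) by (simp add: Z_def mult_left_mono)
      qed
    qed
  qed simp
  then show ?thesis
  proof (rule conv_in_prob_dominated)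
    show "\<forall>\<^sub>F N in sequentially. \<forall>g\<in>set_pmf (graph N). dist (bond_defect r N g) 0 \<le> k N * Z N g"
      using eventually_conj[OF eventually_conj[OF gap \<beta>_eventually_pos]
        eventually_conj[OF eventually_ge_at_top[of "1::nat"] eventually_cosh_nonzero[of r]]]
    proof (rule eventually_mono, intro ballI)
      fix N g
      assume "(\<beta> N + 4 * \<bar>r\<bar> * sqrt (\<theta> N) < b \<and> 0 < \<beta> N) \<and> 1 \<le> N \<and>
        cosh (tilt r N) \<noteq> 0 \<and> cosh (real_tilt N) \<noteq> 0 \<and> norm (tilt r N) \<le> 1 / 3 \<and> norm (real_tilt N) \<le> 1 / 3"
      then have gap: "\<beta> N + 4 * \<bar>r\<bar> * sqrt (\<theta> N) < b" and \<beta>: "0 < \<beta> N" and N: "1 \<le> N"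
        and small: "cosh (tilt r N) \<noteq> 0 \<and> cosh (real_tilt N) \<noteq> 0 \<and> norm (tilt r N) \<le> 1 / 3 \<and> norm (real_tilt N) \<le> 1 / 3"
        by blast+
      have \<theta>: "0 < \<theta> N" using \<theta>_range[OF N] by simp
      let ?n = "real N * \<theta> N"
      have n: "?n > 0" using \<theta> N by simp
      define x where "x = \<beta> N / ?n"
      define d where "d = 4 * \<bar>r\<bar> * sqrt (\<theta> N) / ?n"
      have x: "0 \<le> x" using \<beta> n by (simp add: x_def)
      have u: "complex_of_real (tanh x) = tanh (real_tilt N)"
        by (simp add: real_tilt_def x_def tanh_def sinh_def cosh_def exp_of_real[symmetric] scaleR_conv_of_real)
      have tx: "0 \<le> tanh x" "tanh x \<le> x" using x abs_tanh_le[of x] by auto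
      have diff: "norm (tanh (tilt r N) - complex_of_real (tanh x)) \<le> d"
        unfolding u d_def using tanh_lipschitz[of "tilt r N" "real_tilt N"] small tilt_bounds(3)[OF N, of r] by simp
      have d0: "0 \<le> d" using \<theta> by (simp add: d_def)
      have v: "norm (tanh (tilt r N)) \<le> x + d"
        using norm_triangle_ineq[of "tanh (tilt r N) - complex_of_real (tanh x)" "complex_of_real (tanh x)"] diff tx by simp
      have xd: "x + d = (\<beta> N + 4 * \<bar>r\<bar> * sqrt (\<theta> N)) / ?n" by (simp add: x_def d_def add_divide_distrib)
      then have xdb: "x + d < b / ?n" using gap n by (simp add: divide_strict_right_mono)
      have "norm (bond_defect r N g) \<le> norm (tanh (tilt r N) - complex_of_real (tanh x)) / (b / ?n - (x + d)) * Z N g"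
        unfolding bond_defect_def u[symmetric] Z_def using tx d0 v xdb adjacency_nonneg
        by (intro bond_sum_ratio) auto
      also have "\<dots> \<le> d / (b / ?n - (x + d)) * Z N g"
        using diff xdb Z1[OF N, of g] by (intro mult_right_mono divide_right_mono) auto
      also have "d / (b / ?n - (x + d)) = k N"
        unfolding xd diff_divide_distrib[symmetric] using n N by (simp add: d_def k_def)
      finally show "dist (bond_defect r N g) 0 \<le> k N * Z N g" by simp
    qed
  qed
qed

text \<open>The Hamiltonian minus a threshold of the test, rescaled by \<open>\<surd>\<theta>\<close>: for \<open>a = z\<close> it is negative exactly
below the lower threshold, for \<open>a = - z\<close> positive exactly above the upper one. Absorbing the random
thresholds into the statistic leaves events with a deterministic boundary.\<close>

definition "statistic a N A \<sigma> = sqrt (\<theta> N) * (hamiltonian N (\<theta> N) A \<sigma> + \<beta>\<^sub>0 / (2 * (real N)\<^sup>2 * (\<theta> N)\<^sup>2) * total_sum N A)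
   + a * sqrt (total_sum N A / (2 * (real N)\<^sup>2 * \<theta> N))"

definition "conditional_char r a N g = measure_pmf.expectation (ising_pmf N (\<theta> N) (adjacency g) (\<beta> N))
   (\<lambda>\<sigma>. exp (\<i> * complex_of_real (r * statistic a N (adjacency g) \<sigma>)))"

definition "phase r a N g = r * a * sqrt (edge_ratio N g + loop_ratio N g / 2) - r * t * edge_ratio N g
   + r * loop_shift N g * (\<beta>\<^sub>0 / (2 * real N * \<theta> N) - 1 / 2)"

text \<open>The identity collects all exponents. The term \<open>\<beta>\<^sub>0 E\<close> of the centring cancels against the linear
term in the imaginary displacement and leaves the drift that comes from
the term \<open>t \<surd>\<theta>\<close> of \<open>\<beta>\<close>.\<close>

lemma conditional_char_factorization:
  "\<forall>\<^sub>F N in sequentially. \<forall>g\<in>set_pmf (graph N). conditional_char r a N g =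
     exp (\<i> * complex_of_real (phase r a N g) - complex_of_real (r\<^sup>2 * edge_ratio N g / 2))
     * (1 + cosh_defect r N) ^ edge_count N (adjacency g) * (1 + bond_defect r N g)"
  using eventually_conj[OF \<beta>_eventually_pos
    eventually_conj[OF eventually_ge_at_top[of "1::nat"] eventually_cosh_nonzero[of r]]]
proof (rule eventually_mono, intro ballI)
  fix N g
  assume "0 < \<beta> N \<and> 1 \<le> N \<and>
    cosh (tilt r N) \<noteq> 0 \<and> cosh (real_tilt N) \<noteq> 0 \<and> norm (tilt r N) \<le> 1 / 3 \<and> norm (real_tilt N) \<le> 1 / 3"
  then have \<beta>: "0 < \<beta> N" and N: "1 \<le> N"
    and nz: "cosh (tilt r N) \<noteq> 0 \<and> cosh (real_tilt N) \<noteq> 0 \<and> norm (tilt r N) \<le> 1 / 3 \<and> norm (real_tilt N) \<le> 1 / 3"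
    by blast+
  define A where "A = adjacency g"
  define E where "E = edge_count N A"
  define D where "D = diagonal_sum N A"
  define s where "s = r * sqrt (\<theta> N)"
  define q where "q = sqrt (\<theta> N)"
  define x where "x = \<beta> N / (real N * \<theta> N)"
  define y where "y = imag_tilt r N"
  define z where "z = tilt r N"
  have \<theta>: "0 < \<theta> N" using \<theta>_range[OF N] by simp
  have q: "q > 0" "\<theta> N = q\<^sup>2" using \<theta> by (simp_all add: q_def)
  have A: "graph_matrix A" by (simp add: A_def adjacency_graph_matrix)
  have S: "total_sum N A = D + 2 * real E"
    using sum_graph_matrix(2)[OF A, of N] by (simp add: total_sum_def D_def E_def)
  have zx: "z = complex_of_real x - \<i> * complex_of_real y" "real_tilt N = complex_of_real x"
    by (simp_all add: z_def tilt_def real_tilt_def x_def y_def)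
  have kz: "z = (complex_of_real (\<beta> N) - \<i> * complex_of_real s) / complex_of_real (real N * \<theta> N)"
    by (simp add: zx(1) x_def y_def imag_tilt_def s_def diff_divide_distrib)
  have kx: "complex_of_real x = complex_of_real (\<beta> N) / complex_of_real (real N * \<theta> N)"
    by (simp add: x_def)
  have nz': "cosh z \<noteq> 0" "cosh (complex_of_real x) \<noteq> 0" using nz zx by (simp_all add: z_def)
  have tx: "tanh (complex_of_real x) = complex_of_real (tanh x)"
    by (simp add: tanh_def sinh_def cosh_def exp_of_real[symmetric] scaleR_conv_of_real)
  have Ann: "A i j \<ge> 0" for i j by (simp add: A_def adjacency_nonneg)
  have "0 \<le> tanh x" using \<beta> N \<theta> by (simp add: x_def)
  then have "1 \<le> spin_avg N (bond_weight N (\<lambda>i j. tanh x * A i j))"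
    by (intro bond_sum_ge_one Ann)
  then have B0: "bond_sum N A (tanh (complex_of_real x)) \<noteq> 0"
    unfolding tx by (subst bond_sum_of_real) (use Ann in auto)
  \<comment> \<open>the part of the exponent that depends on the graph but not on the spins\<close>
  define c where "c = r * (sqrt (\<theta> N) * (\<beta>\<^sub>0 / (2 * (real N)\<^sup>2 * (\<theta> N)\<^sup>2) * total_sum N A)
      + a * sqrt (total_sum N A / (2 * (real N)\<^sup>2 * \<theta> N)))"
  have "conditional_char r a N g = measure_pmf.expectation (ising_pmf N (\<theta> N) A (\<beta> N))
      (\<lambda>\<sigma>. exp (\<i> * complex_of_real c) * exp (\<i> * complex_of_real (s * hamiltonian N (\<theta> N) A \<sigma>)))"
    unfolding conditional_char_def A_def[symmetric] exp_add[symmetric]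
    by (simp add: statistic_def c_def s_def algebra_simps)
  also have "\<dots> = exp (\<i> * complex_of_real c) * measure_pmf.expectation (ising_pmf N (\<theta> N) A (\<beta> N))
      (\<lambda>\<sigma>. exp (\<i> * complex_of_real (s * hamiltonian N (\<theta> N) A \<sigma>)))"
    by simp
  also have "\<dots> = exp (\<i> * complex_of_real c) *
     ((exp (z * complex_of_real D / 2) * cosh z ^ E * bond_sum N A (tanh z)) /
      (exp (complex_of_real x * complex_of_real D / 2) * cosh (complex_of_real x) ^ E * bond_sum N A (tanh (complex_of_real x))))"
    unfolding ising_characteristic_function partition_factorization[OF A N \<theta> kz nz'(1)]
      partition_factorization[OF A N \<theta> kx nz'(2)] D_def E_def ..
  also have "bond_sum N A (tanh z) = bond_sum N A (tanh (complex_of_real x)) * (1 + bond_defect r N g)"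
    using B0 by (simp add: bond_defect_def A_def[symmetric] z_def[symmetric] zx(2))
  also have "cosh z ^ E = cosh (complex_of_real x) ^ E * exp (of_nat E * ((z\<^sup>2 - (complex_of_real x)\<^sup>2) / 2)) * (1 + cosh_defect r N) ^ E"
  proof -
    have "cosh z = cosh (complex_of_real x) * exp ((z\<^sup>2 - (complex_of_real x)\<^sup>2) / 2) * (1 + cosh_defect r N)"
      using nz' by (simp add: cosh_defect_def z_def[symmetric] zx(2))
    then show ?thesis by (simp only: power_mult_distrib exp_of_nat_mult)
  qed
  also have "exp (\<i> * complex_of_real c) *
     ((exp (z * complex_of_real D / 2) * (cosh (complex_of_real x) ^ E * exp (of_nat E * ((z\<^sup>2 - (complex_of_real x)\<^sup>2) / 2)) * (1 + cosh_defect r N) ^ E)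
        * (bond_sum N A (tanh (complex_of_real x)) * (1 + bond_defect r N g))) /
      (exp (complex_of_real x * complex_of_real D / 2) * cosh (complex_of_real x) ^ E * bond_sum N A (tanh (complex_of_real x))))
     = (exp (\<i> * complex_of_real c) * exp (z * complex_of_real D / 2) * exp (of_nat E * ((z\<^sup>2 - (complex_of_real x)\<^sup>2) / 2))
         / exp (complex_of_real x * complex_of_real D / 2)) * (1 + cosh_defect r N) ^ E * (1 + bond_defect r N g)"
    using nz' B0 by (simp add: field_simps)
  also have "exp (\<i> * complex_of_real c) * exp (z * complex_of_real D / 2) * exp (of_nat E * ((z\<^sup>2 - (complex_of_real x)\<^sup>2) / 2))
         / exp (complex_of_real x * complex_of_real D / 2)
     = exp (\<i> * complex_of_real c + z * complex_of_real D / 2 + of_nat E * ((z\<^sup>2 - (complex_of_real x)\<^sup>2) / 2)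
         - complex_of_real x * complex_of_real D / 2)"
    by (simp only: exp_add exp_diff)
  also have "\<i> * complex_of_real c + z * complex_of_real D / 2 + of_nat E * ((z\<^sup>2 - (complex_of_real x)\<^sup>2) / 2)
         - complex_of_real x * complex_of_real D / 2
     = \<i> * complex_of_real (c - y * D / 2 - real E * x * y) - complex_of_real (real E * y\<^sup>2 / 2)"
    unfolding zx(1) by (simp add: complex_eq_iff power2_eq_square field_simps)
  also have "real E * y\<^sup>2 / 2 = r\<^sup>2 * edge_ratio N g / 2"
    using N q by (simp add: y_def imag_tilt_def edge_ratio_def E_def A_def q_def[symmetric] field_simps power2_eq_square)
  also have "c - y * D / 2 - real E * x * y = phase r a N g"
  proof -
    have v: "total_sum N A / (2 * (real N)\<^sup>2 * \<theta> N) = edge_ratio N g + loop_ratio N g / 2"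
      unfolding S edge_ratio_def loop_ratio_def A_def[symmetric] D_def[symmetric] E_def[symmetric]
      using N q by (simp add: add_divide_distrib)
    have "sqrt (\<theta> N) * (\<beta>\<^sub>0 / (2 * (real N)\<^sup>2 * (\<theta> N)\<^sup>2) * total_sum N A) * r - y * D / 2 - real E * x * y
      = - r * t * edge_ratio N g + r * loop_shift N g * (\<beta>\<^sub>0 / (2 * real N * \<theta> N) - 1 / 2)"
      unfolding S x_def y_def imag_tilt_def edge_ratio_def loop_shift_def D_def[symmetric] A_def[symmetric] E_def[symmetric] \<beta>_def q_def[symmetric] q(2)
      using N q(1) by (simp add: field_simps power2_eq_square)
    then show ?thesis unfolding c_def v phase_def by (simp add: algebra_simps)
  qed
  finally show "conditional_char r a N g =
     exp (\<i> * complex_of_real (phase r a N g) - complex_of_real (r\<^sup>2 * edge_ratio N g / 2))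
     * (1 + cosh_defect r N) ^ edge_count N (adjacency g) * (1 + bond_defect r N g)"
    by (simp only: E_def A_def)
qed

lemma conditional_char_tendsto:
  defines "w \<equiv> graphon_integral W / 2"
  shows "conv_in_prob graph (conditional_char r a)
    (exp (\<i> * complex_of_real (r * (a * sqrt w - t * w)) - complex_of_real (r\<^sup>2 * w / 2)))"
proof (rule conv_in_prob_eventually_eq[OF _ conditional_char_factorization])
  note X1 = edge_ratio_tendsto[folded w_def]
  have inv: "(\<lambda>N. \<beta>\<^sub>0 / (2 * real N * \<theta> N) - 1 / 2) \<longlonglongrightarrow> \<beta>\<^sub>0 / 2 * 0 - 1 / 2"
  proof -
    have "(\<lambda>N. \<beta>\<^sub>0 / 2 * (1 / (real N * \<theta> N)) - 1 / 2) \<longlonglongrightarrow> \<beta>\<^sub>0 / 2 * 0 - 1 / 2"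
      by (intro tendsto_intros mean_degree_inverse)
    then show ?thesis by (simp add: mult_ac)
  qed
  have "conv_in_prob graph (\<lambda>N g. sqrt (edge_ratio N g + loop_ratio N g * (1 / 2))) (sqrt (w + 0 * (1 / 2)))"
    by (rule conv_in_prob_isCont) (intro conv_in_prob_add conv_in_prob_mult X1 loop_ratio_tendsto conv_in_prob_const tendsto_const isCont_real_sqrt)+
  then have "conv_in_prob graph (\<lambda>N g. (r * a * sqrt (edge_ratio N g + loop_ratio N g * (1 / 2)) + (- r * t) * edge_ratio N g)
      + r * loop_shift N g * (\<beta>\<^sub>0 / (2 * real N * \<theta> N) - 1 / 2)) ((r * a * sqrt (w + 0 * (1 / 2)) + (- r * t) * w) + r * 0 * (\<beta>\<^sub>0 / 2 * 0 - 1 / 2))"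
    by (intro conv_in_prob_add conv_in_prob_mult X1 loop_shift_tendsto conv_in_prob_const[OF inv] conv_in_prob_const[OF tendsto_const])
  then have "conv_in_prob graph (phase r a) (r * (a * sqrt w - t * w))"
    by (simp add: phase_def[abs_def] algebra_simps)
  then have "conv_in_prob graph (\<lambda>N g. \<i> * complex_of_real (phase r a N g) + complex_of_real (r\<^sup>2 * edge_ratio N g * (- 1 / 2)))
     (\<i> * complex_of_real (r * (a * sqrt w - t * w)) + complex_of_real (r\<^sup>2 * w * (- 1 / 2)))"
    by (intro conv_in_prob_add conv_in_prob_of_real conv_in_prob_mult X1 conv_in_prob_const[OF tendsto_const])
  then have "conv_in_prob graph (\<lambda>N g. \<i> * complex_of_real (phase r a N g) - complex_of_real (r\<^sup>2 * edge_ratio N g / 2))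
     (\<i> * complex_of_real (r * (a * sqrt w - t * w)) - complex_of_real (r\<^sup>2 * w / 2))"
    by simp
  then have e: "conv_in_prob graph (\<lambda>N g. exp (\<i> * complex_of_real (phase r a N g) - complex_of_real (r\<^sup>2 * edge_ratio N g / 2)))
     (exp (\<i> * complex_of_real (r * (a * sqrt w - t * w)) - complex_of_real (r\<^sup>2 * w / 2)))"
    by (rule conv_in_prob_isCont) (intro continuous_intros)
  have "conv_in_prob graph (\<lambda>N g. exp (\<i> * complex_of_real (phase r a N g) - complex_of_real (r\<^sup>2 * edge_ratio N g / 2))
     * (1 + cosh_defect r N) ^ edge_count N (adjacency g) * (1 + bond_defect r N g))
     (exp (\<i> * complex_of_real (r * (a * sqrt w - t * w)) - complex_of_real (r\<^sup>2 * w / 2)) * 1 * (1 + 0))"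
    by (intro conv_in_prob_mult conv_in_prob_add e cosh_defect_power_tendsto bond_defect_tendsto conv_in_prob_const[OF tendsto_const])
  then show "conv_in_prob graph (\<lambda>N g. exp (\<i> * complex_of_real (phase r a N g) - complex_of_real (r\<^sup>2 * edge_ratio N g / 2))
     * (1 + cosh_defect r N) ^ edge_count N (adjacency g) * (1 + bond_defect r N g))
     (exp (\<i> * complex_of_real (r * (a * sqrt w - t * w)) - complex_of_real (r\<^sup>2 * w / 2)))"
    by simp
qed

end

section \<open>The limit law and the power of the test\<close>

lemma std_normal_point: "measure std_normal_distribution {x} = 0"
proof -
  have "emeasure std_normal_distribution {x} = (\<integral>\<^sup>+y. ennreal (std_normal_density y) * indicator {x} y \<partial>lborel)"
    by (rule emeasure_density) auto
  also have "\<dots> = (\<integral>\<^sup>+y. 0 \<partial>(lborel :: real measure))"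
  proof (rule nn_integral_cong_AE)
    show "AE y in lborel. ennreal (std_normal_density y) * indicator {x} y = 0"
      using AE_lborel_singleton[of x] by eventually_elim simp
  qed
  finally show ?thesis by (simp add: measure_def)
qed

lemma isCont_Phi: "isCont Phi x"
proof -
  interpret real_distribution std_normal_distribution by (rule real_dist_normal_dist)
  show ?thesis unfolding Phi_def using std_normal_point by (simp add: isCont_cdf)
qed

lemma Phi_minus: "Phi (- x) = 1 - Phi x"
proof -
  interpret real_distribution std_normal_distribution by (rule real_dist_normal_dist)
  have "emeasure std_normal_distribution {..- x} = (\<integral>\<^sup>+y. ennreal (std_normal_density y) * indicator {..- x} y \<partial>lborel)"
    by (rule emeasure_density) auto
  also have "\<dots> = (\<integral>\<^sup>+y. ennreal (std_normal_density y) * indicator {..- x} y \<partial>(distr lborel borel uminus))"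
    by (simp add: lborel_distr_uminus)
  also have "\<dots> = (\<integral>\<^sup>+y. ennreal (std_normal_density (- y)) * indicator {..- x} (- y) \<partial>lborel)"
    by (rule nn_integral_distr) auto
  also have "\<dots> = (\<integral>\<^sup>+y. ennreal (std_normal_density y) * indicator {x..} y \<partial>lborel)"
    by (intro nn_integral_cong) (auto simp: indicator_def normal_density_def)
  also have "\<dots> = emeasure std_normal_distribution {x..}"
    by (rule emeasure_density[symmetric]) auto
  finally have "Phi (- x) = measure std_normal_distribution {x..}"
    by (simp add: Phi_def cdf_def measure_def)
  also have "{x..} = space std_normal_distribution - ({..x} - {x})" by auto
  also have "measure std_normal_distribution \<dots> = 1 - measure std_normal_distribution ({..x} - {x})"
    by (rule prob_compl) simp
  also have "measure std_normal_distribution ({..x} - {x}) = Phi x"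
    using std_normal_point[of x] by (subst finite_measure_Diff) (auto simp: Phi_def cdf_def)
  finally show ?thesis .
qed

context sparse_ising
begin

abbreviation "joint N \<equiv> joint_pmf W (\<theta> N) N (\<beta> N)"

lemma finite_ising: "finite (set_pmf (ising_pmf N u A b))"
  by (rule finite_subset[OF _ finite_spins[of N]]) (auto simp: set_pmf_iff pmf_ising_pmf ising_mass_def split: if_splits)

lemma joint_expectation:
  fixes h :: "(nat \<Rightarrow> nat \<Rightarrow> real) \<times> (nat \<Rightarrow> real) \<Rightarrow> complex"
  shows "measure_pmf.expectation (joint N) h = measure_pmf.expectation (graph N)
    (\<lambda>g. measure_pmf.expectation (ising_pmf N (\<theta> N) (adjacency g) (\<beta> N)) (\<lambda>\<sigma>. h (adjacency g, \<sigma>)))"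
proof -
  let ?I = "\<lambda>g. ising_pmf N (\<theta> N) (adjacency g) (\<beta> N)"
  have j: "joint N = graph N \<bind> (\<lambda>g. map_pmf (\<lambda>\<sigma>. (adjacency g, \<sigma>)) (?I g))"
    by (simp add: joint_pmf_def random_graph_coins graph_def probs_def bind_map_pmf)
  have "measure_pmf.expectation (joint N) h =
    (\<Sum>g\<in>set_pmf (graph N). pmf (graph N) g *\<^sub>R measure_pmf.expectation (map_pmf (\<lambda>\<sigma>. (adjacency g, \<sigma>)) (?I g)) h)"
    unfolding j by (rule pmf_expectation_bind) (auto simp: finite_ising)
  also have "\<dots> = measure_pmf.expectation (graph N) (\<lambda>g. measure_pmf.expectation (?I g) (\<lambda>\<sigma>. h (adjacency g, \<sigma>)))"
    by (subst integral_measure_pmf[of "set_pmf (graph N)"]) auto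
  finally show ?thesis .
qed

lemma annealed_char_tendsto:
  defines "w \<equiv> graphon_integral W / 2"
  shows "(\<lambda>N. measure_pmf.expectation (joint N) (\<lambda>(A, \<sigma>). exp (\<i> * complex_of_real (r * statistic a N A \<sigma>))))
    \<longlonglongrightarrow> exp (\<i> * complex_of_real (r * (a * sqrt w - t * w)) - complex_of_real (r\<^sup>2 * w / 2))"
  unfolding joint_expectation prod.case conditional_char_def[symmetric]
proof (rule conv_in_prob_expectation)
  show "conv_in_prob graph (conditional_char r a) (exp (\<i> * complex_of_real (r * (a * sqrt w - t * w)) - complex_of_real (r\<^sup>2 * w / 2)))"
    unfolding w_def by (rule conditional_char_tendsto)
  show "norm (conditional_char r a N g) \<le> 1" for N g
  proof -
    have "norm (conditional_char r a N g) \<le> measure_pmf.expectation (ising_pmf N (\<theta> N) (adjacency g) (\<beta> N))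
       (\<lambda>\<sigma>. norm (exp (\<i> * complex_of_real (r * statistic a N (adjacency g) \<sigma>))))"
      unfolding conditional_char_def by (rule integral_norm_bound)
    then show ?thesis by (simp add: norm_exp_i_times)
  qed
qed simp

text \<open>Both signs are needed: strict inequalities are complements of weak ones, so that the
lower tail of the statistic is read off from the distribution function of its negative.\<close>

lemma statistic_clt:
  defines "w \<equiv> graphon_integral W / 2"
  assumes w: "w > 0" and k: "k = 1 \<or> k = (-1 :: real)"
  shows "(\<lambda>N. measure_pmf.prob (joint N) {(A, \<sigma>). k * (statistic a N A \<sigma> - (a * sqrt w - t * w)) / sqrt w \<le> q}) \<longlonglongrightarrow> Phi q"
proof -
  define \<mu> where "\<mu> = a * sqrt w - t * w"
  define Y where "Y = (\<lambda>N (A, \<sigma>). k * (statistic a N A \<sigma> - \<mu>) / sqrt w)"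
  define M where "M = (\<lambda>N. distr (measure_pmf (joint N)) borel (Y N))"
  have "weak_conv_m M std_normal_distribution"
  proof (rule levy_continuity)
    show "real_distribution (M N)" for N
      unfolding M_def by (intro prob_space.real_distribution_distr measure_pmf.prob_space_axioms) simp
    show "real_distribution std_normal_distribution" by (rule real_dist_normal_dist)
    fix \<xi> :: real
    define r where "r = k * \<xi> / sqrt w"
    have char_M: "char (M N) \<xi> = exp (- \<i> * complex_of_real (r * \<mu>)) *
        measure_pmf.expectation (joint N) (\<lambda>(A, \<sigma>). exp (\<i> * complex_of_real (r * statistic a N A \<sigma>)))" for N
    proof -
      have "char (M N) \<xi> = measure_pmf.expectation (joint N) (\<lambda>p. exp (\<i> * complex_of_real (\<xi> * Y N p)))"
        unfolding char_def M_def by (subst integral_distr) auto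
      also have "\<dots> = measure_pmf.expectation (joint N) (\<lambda>p. exp (- \<i> * complex_of_real (r * \<mu>)) *
          (case p of (A, \<sigma>) \<Rightarrow> exp (\<i> * complex_of_real (r * statistic a N A \<sigma>))))"
      proof (rule Bochner_Integration.integral_cong)
        fix p
        show "exp (\<i> * complex_of_real (\<xi> * Y N p)) = exp (- \<i> * complex_of_real (r * \<mu>)) *
          (case p of (A, \<sigma>) \<Rightarrow> exp (\<i> * complex_of_real (r * statistic a N A \<sigma>)))"
        proof (cases p)
          case (Pair A \<sigma>)
          have "\<xi> * Y N p = r * statistic a N A \<sigma> - r * \<mu>"
            by (simp add: Pair Y_def r_def algebra_simps diff_divide_distrib)
          then have "\<i> * complex_of_real (\<xi> * Y N p) = - \<i> * complex_of_real (r * \<mu>) + \<i> * complex_of_real (r * statistic a N A \<sigma>)"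
            by (simp only: of_real_diff) (simp add: algebra_simps)
          then show ?thesis unfolding Pair prod.case exp_add[symmetric] by simp
        qed
      qed simp
      also have "\<dots> = exp (- \<i> * complex_of_real (r * \<mu>)) *
        measure_pmf.expectation (joint N) (\<lambda>(A, \<sigma>). exp (\<i> * complex_of_real (r * statistic a N A \<sigma>)))"
        by (rule integral_mult_right_zero)
      finally show ?thesis .
    qed
    have lim: "(\<lambda>N. exp (- \<i> * complex_of_real (r * \<mu>)) *
        measure_pmf.expectation (joint N) (\<lambda>(A, \<sigma>). exp (\<i> * complex_of_real (r * statistic a N A \<sigma>))))
      \<longlonglongrightarrow> exp (- \<i> * complex_of_real (r * \<mu>)) * exp (\<i> * complex_of_real (r * \<mu>) - complex_of_real (r\<^sup>2 * w / 2))"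
      unfolding \<mu>_def w_def by (intro tendsto_mult tendsto_const annealed_char_tendsto)
    have gauss: "exp (- \<i> * complex_of_real (r * \<mu>)) * exp (\<i> * complex_of_real (r * \<mu>) - complex_of_real (r\<^sup>2 * w / 2))
      = char std_normal_distribution \<xi>"
    proof -
      have "r\<^sup>2 * w = \<xi>\<^sup>2" using w k by (auto simp: r_def power_divide)
      then show ?thesis
        unfolding char_std_normal_distribution exp_of_real[symmetric] exp_add[symmetric] by simp
    qed
    show "(\<lambda>N. char (M N) \<xi>) \<longlonglongrightarrow> char std_normal_distribution \<xi>"
      unfolding char_M gauss[symmetric] by (rule lim)
  qed
  then have "(\<lambda>N. cdf (M N) q) \<longlonglongrightarrow> Phi q"
    using isCont_Phi[of q] by (simp add: weak_conv_m_def weak_conv_def Phi_def)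
  moreover have "cdf (M N) q = measure_pmf.prob (joint N) {(A, \<sigma>). k * (statistic a N A \<sigma> - \<mu>) / sqrt w \<le> q}" for N
    unfolding cdf_def M_def by (subst measure_distr) (auto simp: Y_def intro!: arg_cong[where f = "measure_pmf.prob _"])
  ultimately show ?thesis by (simp add: \<mu>_def)
qed

lemma prob_statistic_pos:
  assumes w: "graphon_integral W > 0"
  shows "(\<lambda>N. measure_pmf.prob (joint N) {(A, \<sigma>). statistic a N A \<sigma> > 0})
      \<longlonglongrightarrow> Phi (a - t * sqrt (1 / 2 * graphon_integral W))"
    and "(\<lambda>N. measure_pmf.prob (joint N) {(A, \<sigma>). statistic a N A \<sigma> < 0})
      \<longlonglongrightarrow> Phi (- a + t * sqrt (1 / 2 * graphon_integral W))"
proof -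
  define s where "s = sqrt (graphon_integral W / 2)"
  have s: "s > 0" "graphon_integral W / 2 = s * s" "1 / 2 * graphon_integral W = s * s" "sqrt (s * s) = s"
    using w by (simp_all add: s_def)
  have compl: "measure_pmf.prob (joint N) {(A, \<sigma>). \<not> P A \<sigma>} = 1 - measure_pmf.prob (joint N) {(A, \<sigma>). P A \<sigma>}" for N P
    using measure_pmf.prob_compl[of "{(A, \<sigma>). P A \<sigma>}" "joint N"]
    by (simp add: Compl_eq_Diff_UNIV[symmetric] Collect_neg_eq[symmetric] case_prod_unfold)
  have clt: "(\<lambda>N. 1 - measure_pmf.prob (joint N) {(A, \<sigma>). k * (statistic a N A \<sigma> - (a * s - t * (s * s))) / s \<le> q}) \<longlonglongrightarrow> 1 - Phi q"
    if "k = 1 \<or> k = (-1 :: real)" for k q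
    using statistic_clt[OF half_gt_zero[OF w] that, of a q] unfolding s by (intro tendsto_diff tendsto_const)
  have std: "1 * (x - (a * s - t * (s * s))) / s = x / s - (a - t * s)"
    "(-1) * (x - (a * s - t * (s * s))) / s = (a - t * s) - x / s" for x
    using s(1) by (simp_all add: field_simps)
  have pos: "{(A, \<sigma>). statistic a N A \<sigma> > 0} = {(A, \<sigma>). \<not> 1 * (statistic a N A \<sigma> - (a * s - t * (s * s))) / s \<le> - (a - t * s)}" for N
    unfolding std using s(1) by (auto simp: zero_less_divide_iff divide_less_0_iff not_le)
  have neg: "{(A, \<sigma>). statistic a N A \<sigma> < 0} = {(A, \<sigma>). \<not> (-1) * (statistic a N A \<sigma> - (a * s - t * (s * s))) / s \<le> a - t * s}" for N
    unfolding std using s(1) by (auto simp: zero_less_divide_iff divide_less_0_iff not_le)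
  show "(\<lambda>N. measure_pmf.prob (joint N) {(A, \<sigma>). statistic a N A \<sigma> > 0})
      \<longlonglongrightarrow> Phi (a - t * sqrt (1 / 2 * graphon_integral W))"
    unfolding pos compl s using clt[of 1 "- (a - t * s)"] Phi_minus[of "a - t * s"] by simp
  show "(\<lambda>N. measure_pmf.prob (joint N) {(A, \<sigma>). statistic a N A \<sigma> < 0})
      \<longlonglongrightarrow> Phi (- a + t * sqrt (1 / 2 * graphon_integral W))"
    unfolding neg compl s using clt[of "-1" "a - t * s"] Phi_minus[of "a - t * s"] by simp
qed

lemma reject_iff_statistic:
  assumes N: "N \<ge> 1"
  shows "hamiltonian N (\<theta> N) A \<sigma> < c_hat \<beta>\<^sub>0 \<alpha> N (\<theta> N) A \<longleftrightarrow> statistic (z_value (\<alpha> / 2)) N A \<sigma> < 0"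
    and "hamiltonian N (\<theta> N) A \<sigma> > d_hat \<beta>\<^sub>0 \<alpha> N (\<theta> N) A \<longleftrightarrow> statistic (- z_value (\<alpha> / 2)) N A \<sigma> > 0"
proof -
  have \<theta>: "0 < \<theta> N" using \<theta>_range[OF N] by simp
  define h where "h = hamiltonian N (\<theta> N) A \<sigma>"
  define S where "S = total_sum N A"
  define z where "z = z_value (\<alpha> / 2)"
  have root: "sqrt (S / (2 * (real N)\<^sup>2 * \<theta> N)) = sqrt (\<theta> N) * sqrt (1 / (2 * (real N)\<^sup>2 * (\<theta> N)\<^sup>2) * S)"
    using \<theta> by (simp add: real_sqrt_mult[symmetric] power2_eq_square field_simps)
  have stat: "statistic a N A \<sigma> = sqrt (\<theta> N) * (h + \<beta>\<^sub>0 / (2 * (real N)\<^sup>2 * (\<theta> N)\<^sup>2) * S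
      + a * sqrt (1 / (2 * (real N)\<^sup>2 * (\<theta> N)\<^sup>2) * S))" for a
    unfolding statistic_def h_def[symmetric] S_def[symmetric] root by (simp only: distrib_left mult_ac)
  have c: "c_hat \<beta>\<^sub>0 \<alpha> N (\<theta> N) A = - z * sqrt (1 / (2 * (real N)\<^sup>2 * (\<theta> N)\<^sup>2) * S) - \<beta>\<^sub>0 / (2 * (real N)\<^sup>2 * (\<theta> N)\<^sup>2) * S"
    by (simp only: c_hat_def total_sum_def S_def z_def)
  have d: "d_hat \<beta>\<^sub>0 \<alpha> N (\<theta> N) A = z * sqrt (1 / (2 * (real N)\<^sup>2 * (\<theta> N)\<^sup>2) * S) - \<beta>\<^sub>0 / (2 * (real N)\<^sup>2 * (\<theta> N)\<^sup>2) * S"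
    by (simp only: d_hat_def total_sum_def S_def z_def)
  have "0 < sqrt (\<theta> N)" using \<theta> by simp
  then have m: "sqrt (\<theta> N) * y < 0 \<longleftrightarrow> y < 0" "sqrt (\<theta> N) * y > 0 \<longleftrightarrow> y > 0" for y
    by (simp_all add: mult_less_0_iff zero_less_mult_iff)
  show "hamiltonian N (\<theta> N) A \<sigma> < c_hat \<beta>\<^sub>0 \<alpha> N (\<theta> N) A \<longleftrightarrow> statistic (z_value (\<alpha> / 2)) N A \<sigma> < 0"
    unfolding stat c m h_def[symmetric] z_def[symmetric] by (auto simp: algebra_simps)
  show "hamiltonian N (\<theta> N) A \<sigma> > d_hat \<beta>\<^sub>0 \<alpha> N (\<theta> N) A \<longleftrightarrow> statistic (- z_value (\<alpha> / 2)) N A \<sigma> > 0"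
    unfolding stat d m h_def[symmetric] z_def[symmetric] by (auto simp: algebra_simps)
qed

end

theorem theorem3p2:
  fixes W :: "real \<Rightarrow> real \<Rightarrow> real" and \<theta> :: "nat \<Rightarrow> real" and \<beta>\<^sub>0 \<alpha> t :: real
  assumes "graphon W"
    and "(\<lambda>(x, y). W x y) riemann_integrable_on ({0..1} \<times> {0..1})"
    and "(\<lambda>x. W x x) riemann_integrable_on {0..1}"
    and "graphon_integral W > 0"
    and "\<And>N. N \<ge> 1 \<Longrightarrow> 0 < \<theta> N \<and> \<theta> N < 1"
    and "\<exists>C>0. \<forall>\<^sub>F N in sequentially. real N powr (2 / 3) * \<theta> N \<ge> C"
    and "\<theta> \<longlonglongrightarrow> 0"
    and "0 < \<beta>\<^sub>0" and "\<beta>\<^sub>0 < 1 / op_norm W"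
    and "0 < \<alpha>" and "\<alpha> < 1"
  shows "(\<lambda>N. power_function W \<theta> \<beta>\<^sub>0 \<alpha> N (\<beta>\<^sub>0 + t * sqrt (\<theta> N))) \<longlonglongrightarrow>
      Phi (- z_value (\<alpha> / 2) - t * sqrt (1 / 2 * graphon_integral W)) +
      Phi (- z_value (\<alpha> / 2) + t * sqrt (1 / 2 * graphon_integral W))"
proof -
  interpret sparse_ising W \<theta> \<beta>\<^sub>0 t
    using assms by unfold_locales auto
  let ?z = "z_value (\<alpha> / 2)"
  have "(\<lambda>N. measure_pmf.prob (joint N) {(A, \<sigma>). statistic ?z N A \<sigma> < 0}
      + measure_pmf.prob (joint N) {(A, \<sigma>). statistic (- ?z) N A \<sigma> > 0})
    \<longlonglongrightarrow> Phi (- ?z + t * sqrt (1 / 2 * graphon_integral W)) + Phi (- ?z - t * sqrt (1 / 2 * graphon_integral W))"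
    by (intro tendsto_add prob_statistic_pos assms(4))
  moreover have "\<forall>\<^sub>F N in sequentially. measure_pmf.prob (joint N) {(A, \<sigma>). statistic ?z N A \<sigma> < 0}
      + measure_pmf.prob (joint N) {(A, \<sigma>). statistic (- ?z) N A \<sigma> > 0}
      = power_function W \<theta> \<beta>\<^sub>0 \<alpha> N (\<beta>\<^sub>0 + t * sqrt (\<theta> N))"
    using eventually_ge_at_top[of "1::nat"]
    by eventually_elim (simp only: power_function_def reject_iff_statistic \<beta>_def)
  ultimately show ?thesis
    by (subst add.commute) (rule Lim_transform_eventually)
qed

end
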